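(* Let $F_m=\langle x_1,\ldots,x_m\rangle$ be a free group, let $u_1,\ldots,u_n\in\{x_1,\ldots,x_m\}$, and let $b\in B_n$ be an element of the stabilizer of $(u_1,\ldots,u_n)$ for the Hurwitz action of $B_n$ on $F_m^n$. Let $F_n=\langle v_1,\ldots,v_n\rangle$ be a free group and $t_{\mathrm{triv}}=(v_1,\ldots,v_n)\in F_n^n$. Consider the following procedure. Initialize $t:=b\cdot t_{\mathrm{triv}}\in F_n^n$ (Hurwitz action) and let $l:=()$ be the empty sequence. As long as $t\ne t_{\mathrm{triv}}$: choose an entry $t_k$ of $t$ whose reduced word contains a subword of the form $v_i^{\eta}v_j^{-\eta}$ with $u_i=u_j$ and $\eta\in\{\pm1\}$ (necessarily $i\neq j$), replace $t$ by $a_{ij}^{-\eta}\bullet t$, and prepend $a_{ij}^{-\eta}$ to $l$. Then, as long as $t\neq t_{\mathrm{triv}}$, a subword as required always exists; the procedure terminates after finitely many steps; and if $l=(a_{i_rj_r}^{\gamma_r},\ldots,a_{i_1j_1}^{\gamma_1})$ is the final sequence (where $\gamma_s\in\{\pm1\}$ and $u_{i_s}=u_{j_s}$ for all $s$), then $$b=a_{i_rj_r}^{\gamma_r}\cdots a_{i_1j_1}^{\gamma_1}.$$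
   Context: $B_n$ is the braid group on $n$ strands with standard generators $\sigma_1,\ldots,\sigma_{n-1}$. For a group $G$, the Hurwitz action (denoted $\cdot$) of $B_n$ on $G^n$ is the left action determined by $$\sigma_i\cdot(g_1,\ldots,g_i,g_{i+1},\ldots,g_n)=(g_1,\ldots,g_{i+1},\,g_{i+1}^{-1}g_ig_{i+1},\ldots,g_n)$$ (the entries in positions $i,i+1$ are replaced by $g_{i+1},\ g_{i+1}^{-1}g_ig_{i+1}$, the others are unchanged). For $1\le i<j\le n$ the Birman-Ko-Lee generator is $a_{ij}=\sigma_i\cdots\sigma_{j-2}\,\sigma_{j-1}\,\sigma_{j-2}^{-1}\cdots\sigma_i^{-1}\in B_n$, and $a_{ji}:=a_{ij}$. $B_n$ acts on the left by automorphisms on $F_n=\langle v_1,\ldots,v_n\rangle$ via $\sigma_i(v_i)=v_iv_{i+1}v_i^{-1}$, $\sigma_i(v_{i+1})=v_i$, $\sigma_i(v_j)=v_j$ for $j\notin\{i,i+1\}$. The action $\bullet$ of $B_n$ on $F_n^n$ is obtained by applying these automorphisms entrywise: $c\bullet(t_1,\ldots,t_n)=(c(t_1),\ldots,c(t_n))$ for $c\in B_n$. *)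

theory Defs
  imports "HOL-Algebra.Group_Action" "HOL-Library.Sublist"
begin

section \<open>Free groups\<close>

text \<open>The letter \<open>(x, 1)\<close> is the generator \<open>x\<close>, the letter \<open>(x, -1)\<close> its inverse. The elements
  of the free group are the reduced words, so ``the reduced word of \<open>w\<close>'' is \<open>w\<close> itself.\<close>

type_synonym 'a word = "('a \<times> int) list"

definition reduced :: "'a word \<Rightarrow> bool" where
  "reduced = successively (\<lambda>(x, e) (y, d). \<not> (y = x \<and> d = - e))"

fun rcons :: "'a \<times> int \<Rightarrow> 'a word \<Rightarrow> 'a word" where
  "rcons l [] = [l]"
| "rcons (x, e) ((y, d) # w) = (if y = x \<and> d = - e then w else (x, e) # (y, d) # w)"

definition free_group :: "'a set \<Rightarrow> 'a word monoid" where
  "free_group X = \<lparr>carrier = {w. set w \<subseteq> X \<times> {1, -1} \<and> reduced w},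
                   monoid.mult = (\<lambda>v w. foldr rcons v w),
                   one = []\<rparr>"

definition free_gen :: "'a \<Rightarrow> 'a word" where
  "free_gen x = [(x, 1)]"

text \<open>The homomorphism from the free group to \<open>H\<close> that extends a map \<open>f\<close> on generators.\<close>

definition free_lift :: "('b, 'c) monoid_scheme \<Rightarrow> ('a \<Rightarrow> 'b) \<Rightarrow> 'a word \<Rightarrow> 'b" where
  "free_lift H f w = foldr (\<lambda>(x, e) h. f x [^]\<^bsub>H\<^esub> e \<otimes>\<^bsub>H\<^esub> h) w \<one>\<^bsub>H\<^esub>"

lemma reduced_ConsD: "reduced (l # w) \<Longrightarrow> reduced w"
  by (cases w) (auto simp: reduced_def)

lemma reduced_rcons: "reduced w \<Longrightarrow> reduced (rcons l w)"
  by (induction l w rule: rcons.induct) (auto simp: reduced_def successively_Cons)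

lemma rcons_reduced: "reduced (l # w) \<Longrightarrow> rcons l w = l # w"
  by (induction l w rule: rcons.induct) (auto simp: reduced_def)

lemma set_rcons: "set (rcons l w) \<subseteq> insert l (set w)"
  by (induction l w rule: rcons.induct) auto

lemma rcons_cancel: "reduced w \<Longrightarrow> rcons (x, - e) (rcons (x, e) w) = w"
proof (cases w)
  case (Cons l w')
  assume "reduced w"
  with Cons show ?thesis
    by (cases l) (auto intro!: rcons_reduced)
qed simp

lemma foldr_rcons_closed:
  "reduced w \<Longrightarrow> reduced (foldr rcons v w)" "set (foldr rcons v w) \<subseteq> set v \<union> set w"
proof -
  show "reduced w \<Longrightarrow> reduced (foldr rcons v w)"
    by (induction v) (auto intro: reduced_rcons)
  show "set (foldr rcons v w) \<subseteq> set v \<union> set w"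
  proof (induction v)
    case (Cons l v)
    then show ?case using set_rcons[of l "foldr rcons v w"] by auto
  qed simp
qed

lemma foldr_rcons_rcons:
  assumes "reduced w"
  shows "foldr rcons (rcons l v) w = rcons l (foldr rcons v w)"
proof (induction l v rule: rcons.induct)
  case (2 x e y d v)
  have "rcons (x, - (- e)) (rcons (x, - e) (foldr rcons v w)) = foldr rcons v w"
    using assms by (intro rcons_cancel foldr_rcons_closed)
  then show ?case by auto
qed simp

lemma foldr_rcons_assoc:
  "reduced w \<Longrightarrow> foldr rcons (foldr rcons u v) w = foldr rcons u (foldr rcons v w)"
  by (induction u) (auto simp: foldr_rcons_rcons)

lemma foldr_rcons_inverse:
  "reduced v \<Longrightarrow> foldr rcons (rev (map (\<lambda>(x, e). (x, - e)) v)) v = []"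
proof (induction v)
  case (Cons l v)
  obtain x e where l: "l = (x, e)" by fastforce
  have "rcons (x, - e) (l # v) = v" using Cons.prems by (auto simp: l)
  then show ?case using Cons by (auto simp: l dest: reduced_ConsD)
qed simp

lemma reduced_inverse: "reduced v \<Longrightarrow> reduced (rev (map (\<lambda>(x, e). (x, - e)) v))"
  unfolding reduced_def successively_rev successively_map
  by (erule successively_mono) auto

lemma group_free_group: "group (free_group X)"
proof (rule groupI)
  fix x y assume "x \<in> carrier (free_group X)" "y \<in> carrier (free_group X)"
  then show "x \<otimes>\<^bsub>free_group X\<^esub> y \<in> carrier (free_group X)"
    using foldr_rcons_closed(1)[of y x] foldr_rcons_closed(2)[of x y]
    by (simp add: free_group_def) blast
next
  fix x assume "x \<in> carrier (free_group X)"
  then have "set x \<subseteq> X \<times> {1, -1}" "reduced x" by (auto simp: free_group_def)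
  then show "\<exists>y\<in>carrier (free_group X). y \<otimes>\<^bsub>free_group X\<^esub> x = \<one>\<^bsub>free_group X\<^esub>"
    by (intro bexI[of _ "rev (map (\<lambda>(x, e). (x, - e)) x)"])
      (auto simp: free_group_def foldr_rcons_inverse reduced_inverse)
qed (auto simp: free_group_def foldr_rcons_assoc reduced_def)

lemma free_gen_closed: "x \<in> X \<Longrightarrow> free_gen x \<in> carrier (free_group X)"
  by (simp add: free_gen_def free_group_def reduced_def)

lemma free_lift_closed:
  assumes "group H" "f \<in> X \<rightarrow> carrier H" "set w \<subseteq> X \<times> {1, -1}"
  shows "free_lift H f w \<in> carrier H"
proof -
  interpret H: group H by fact
  show ?thesis using assms(2,3)
    by (induction w) (auto simp: free_lift_def Pi_iff)
qed

lemma free_lift_hom: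
  assumes "group H" "f \<in> X \<rightarrow> carrier H"
  shows "free_lift H f \<in> hom (free_group X) H"
proof -
  interpret H: group H by fact
  note closed = free_lift_closed[OF assms]
  have rcons: "free_lift H f (rcons l w) = free_lift H f (l # w)"
    if "set (l # w) \<subseteq> X \<times> {1, -1}" for l w
    using that
  proof (induction l w rule: rcons.induct)
    case (2 x e y d w)
    show ?case
    proof (cases "y = x \<and> d = - e")
      case True
      have x: "f x \<in> carrier H" using 2 assms by auto
      moreover have w: "free_lift H f w \<in> carrier H" using 2 by (intro closed) auto
      ultimately have "f x [^]\<^bsub>H\<^esub> e \<otimes>\<^bsub>H\<^esub> (f x [^]\<^bsub>H\<^esub> (- e) \<otimes>\<^bsub>H\<^esub> free_lift H f w) = free_lift H f w"
        by (simp add: H.int_pow_neg flip: H.m_assoc)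
      then show ?thesis using True by (simp add: free_lift_def)
    qed auto
  qed simp
  have mult: "free_lift H f (foldr rcons v w) = free_lift H f v \<otimes>\<^bsub>H\<^esub> free_lift H f w"
    if "set v \<subseteq> X \<times> {1, -1}" "set w \<subseteq> X \<times> {1, -1}" for v w
    using that(1)
  proof (induction v)
    case Nil
    then show ?case using closed[OF that(2)] by (simp add: free_lift_def)
  next
    case (Cons l v)
    obtain x e where l: "l = (x, e)" by fastforce
    have "set (foldr rcons v w) \<subseteq> X \<times> {1, -1}"
      using foldr_rcons_closed(2)[of v w] that(2) Cons.prems by auto
    then have "free_lift H f (foldr rcons (l # v) w) = free_lift H f (l # foldr rcons v w)"
      using Cons.prems by (simp add: rcons)
    also have "\<dots> = f x [^]\<^bsub>H\<^esub> e \<otimes>\<^bsub>H\<^esub> (free_lift H f v \<otimes>\<^bsub>H\<^esub> free_lift H f w)"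
      using Cons by (simp add: l free_lift_def)
    also have "\<dots> = free_lift H f (l # v) \<otimes>\<^bsub>H\<^esub> free_lift H f w"
    proof -
      have "f x \<in> carrier H" "free_lift H f v \<in> carrier H" "free_lift H f w \<in> carrier H"
        using Cons.prems assms(2) closed[OF that(2)] closed[of v] by (auto simp: l)
      then have "f x [^]\<^bsub>H\<^esub> e \<otimes>\<^bsub>H\<^esub> (free_lift H f v \<otimes>\<^bsub>H\<^esub> free_lift H f w)
                 = f x [^]\<^bsub>H\<^esub> e \<otimes>\<^bsub>H\<^esub> free_lift H f v \<otimes>\<^bsub>H\<^esub> free_lift H f w"
        by (simp add: H.m_assoc)
      then show ?thesis by (simp add: l free_lift_def)
    qed
    finally show ?case .
  qed
  show ?thesis
    using closed mult by (auto simp: hom_def free_group_def)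
qed

lemma free_lift_gen:
  assumes "group H" "f x \<in> carrier H"
  shows "free_lift H f (free_gen x) = f x"
proof -
  interpret H: group H by fact
  show ?thesis using assms by (simp add: free_lift_def free_gen_def)
qed

lemma free_hom_unique:
  assumes "group H" "h \<in> hom (free_group X) H" "h' \<in> hom (free_group X) H"
    and "\<And>x. x \<in> X \<Longrightarrow> h (free_gen x) = h' (free_gen x)"
    and "w \<in> carrier (free_group X)"
  shows "h w = h' w"
  using assms(5)
proof (induction w)
  let ?F = "free_group X"
  interpret F: group ?F by (rule group_free_group)
  interpret H: group H by fact
  interpret h: group_hom ?F H h using assms(1,2) by unfold_locales
  interpret h': group_hom ?F H h' using assms(1,3) by unfold_locales
  case Nil
  show ?case using h.hom_one h'.hom_one by (simp add: free_group_def)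
next
  let ?F = "free_group X"
  interpret F: group ?F by (rule group_free_group)
  interpret H: group H by fact
  interpret h: group_hom ?F H h using assms(1,2) by unfold_locales
  interpret h': group_hom ?F H h' using assms(1,3) by unfold_locales
  case (Cons l w)
  obtain x e where l: "l = (x, e)" by fastforce
  have x: "x \<in> X" "e \<in> {1, -1}" "w \<in> carrier ?F" "reduced (l # w)"
    using Cons.prems by (auto simp: free_group_def l dest: reduced_ConsD)
  have g: "free_gen x \<in> carrier ?F" by (rule free_gen_closed) fact
  have "[(x, -1)] \<in> carrier ?F" "[(x, -1)] \<otimes>\<^bsub>?F\<^esub> free_gen x = \<one>\<^bsub>?F\<^esub>"
    using x by (auto simp: free_group_def reduced_def free_gen_def)
  then have "[(x, -1)] = inv\<^bsub>?F\<^esub> free_gen x"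
    using g by (metis F.inv_equality)
  then have "[l] = free_gen x [^]\<^bsub>?F\<^esub> e"
    using x g by (auto simp: l F.int_pow_neg) (simp add: free_gen_def)
  moreover have "l # w = [l] \<otimes>\<^bsub>?F\<^esub> w"
    using x by (simp add: free_group_def rcons_reduced)
  ultimately show ?case
    using x g assms(4)[OF x(1)] Cons.IH by (simp add: h.hom_int_pow h'.hom_int_pow)
qed

definition free_n :: "nat \<Rightarrow> nat word monoid" where
  "free_n n = free_group {1..n}"

lemma group_free_n: "group (free_n n)"
  by (simp only: free_n_def group_free_group)

lemma free_gen_closed_n: "k \<in> {1..n} \<Longrightarrow> free_gen k \<in> carrier (free_n n)"
  by (simp only: free_n_def free_gen_closed)

lemma free_lift_hom_n:
  "group H \<Longrightarrow> f \<in> {1..n} \<rightarrow> carrier H \<Longrightarrow> free_lift H f \<in> hom (free_n n) H"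
  by (simp only: free_n_def free_lift_hom)

lemma free_hom_unique_n:
  assumes "group H" "h \<in> hom (free_n n) H" "h' \<in> hom (free_n n) H"
    and "\<And>k. k \<in> {1..n} \<Longrightarrow> h (free_gen k) = h' (free_gen k)"
    and "w \<in> carrier (free_n n)"
  shows "h w = h' w"
  using free_hom_unique[of H h "{1..n}" h' w] assms unfolding free_n_def by blast

section \<open>Groups given by generators and relators\<close>

definition normal_closure :: "('a, 'b) monoid_scheme \<Rightarrow> 'a set \<Rightarrow> 'a set" where
  "normal_closure G R = \<Inter> {N. N \<lhd> G \<and> R \<subseteq> N}"

definition presented_group :: "'a set \<Rightarrow> 'a word set \<Rightarrow> 'a word set monoid" where
  "presented_group X R = free_group X Mod normal_closure (free_group X) R"

definition presented_gen :: "'a set \<Rightarrow> 'a word set \<Rightarrow> 'a \<Rightarrow> 'a word set" where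
  "presented_gen X R x = normal_closure (free_group X) R #>\<^bsub>free_group X\<^esub> free_gen x"

text \<open>The homomorphism to \<open>H\<close> induced on the cosets by a map \<open>f\<close> on generators; it is well defined
  when \<open>free_lift H f\<close> kills the relators.\<close>

definition presented_lift :: "('b, 'c) monoid_scheme \<Rightarrow> ('a \<Rightarrow> 'b) \<Rightarrow> 'a word set \<Rightarrow> 'b" where
  "presented_lift H f C = the_elem (free_lift H f ` C)"

lemma normal_normal_closure:
  assumes "group G" "R \<subseteq> carrier G"
  shows "normal_closure G R \<lhd> G"
proof -
  interpret G: group G by fact
  have carr: "carrier G \<in> {N. N \<lhd> G \<and> R \<subseteq> N}"
    using assms(2) by (auto simp: G.normal_inv_iff G.subgroup_self)
  have "subgroup (normal_closure G R) G"
    unfolding normal_closure_def using carr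
    by (intro G.subgroups_Inter) (auto intro: normal_imp_subgroup)
  moreover have "x \<otimes>\<^bsub>G\<^esub> h \<otimes>\<^bsub>G\<^esub> inv\<^bsub>G\<^esub> x \<in> normal_closure G R"
    if "x \<in> carrier G" "h \<in> normal_closure G R" for x h
    using that by (auto simp: normal_closure_def G.normal_inv_iff)
  ultimately show ?thesis by (auto simp: G.normal_inv_iff)
qed

lemma group_presented_group:
  "R \<subseteq> carrier (free_group X) \<Longrightarrow> group (presented_group X R)"
  unfolding presented_group_def
  by (intro normal.factorgroup_is_group normal_normal_closure group_free_group)

lemma presented_lift_coset:
  assumes H: "group H" "f \<in> X \<rightarrow> carrier H"
    and R: "R \<subseteq> carrier (free_group X)" "\<And>r. r \<in> R \<Longrightarrow> free_lift H f r = \<one>\<^bsub>H\<^esub>"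
    and w: "w \<in> carrier (free_group X)"
  shows "presented_lift H f (normal_closure (free_group X) R #>\<^bsub>free_group X\<^esub> w) = free_lift H f w"
proof -
  let ?F = "free_group X" and ?N = "normal_closure (free_group X) R"
  interpret F: group ?F by (rule group_free_group)
  interpret H: group H by fact
  interpret L: group_hom ?F H "free_lift H f"
    using free_lift_hom[OF H] by unfold_locales
  have N: "?N \<lhd> ?F" by (rule normal_normal_closure) (use R in auto)
  then have "\<one>\<^bsub>?F\<^esub> \<in> ?N" by (meson normal_imp_subgroup subgroup.one_closed)
  have "?N \<subseteq> kernel ?F H (free_lift H f)"
    unfolding normal_closure_def
    by (rule Inter_lower) (use R L.normal_kernel in \<open>auto simp: kernel_def\<close>)
  then have "free_lift H f (h \<otimes>\<^bsub>?F\<^esub> w) = free_lift H f w" if "h \<in> ?N" for h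
    using that w by (auto simp: kernel_def)
  moreover have "free_lift H f ` (?N #>\<^bsub>?F\<^esub> w) = (\<lambda>h. free_lift H f (h \<otimes>\<^bsub>?F\<^esub> w)) ` ?N"
    unfolding r_coset_def by blast
  ultimately have "free_lift H f ` (?N #>\<^bsub>?F\<^esub> w) = (\<lambda>h. free_lift H f w) ` ?N"
    by (simp cong: image_cong)
  also have "\<dots> = {free_lift H f w}"
    using \<open>\<one>\<^bsub>?F\<^esub> \<in> ?N\<close> by blast
  finally have "free_lift H f ` (?N #>\<^bsub>?F\<^esub> w) = {free_lift H f w}" .
  then show ?thesis by (simp add: presented_lift_def)
qed

lemma presented_lift_hom:
  assumes H: "group H" "f \<in> X \<rightarrow> carrier H"
    and R: "R \<subseteq> carrier (free_group X)" "\<And>r. r \<in> R \<Longrightarrow> free_lift H f r = \<one>\<^bsub>H\<^esub>"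
  shows "presented_lift H f \<in> hom (presented_group X R) H"
proof -
  let ?F = "free_group X" and ?N = "normal_closure (free_group X) R"
  interpret F: group ?F by (rule group_free_group)
  interpret N: normal ?N ?F by (rule normal_normal_closure) (use R in auto)
  have L: "free_lift H f \<in> hom ?F H" by (rule free_lift_hom[OF H])
  show ?thesis
    using L by (auto simp: hom_def Pi_iff presented_group_def carrier_FactGroup N.rcos_sum
        presented_lift_coset[OF H R])
qed

lemma presented_lift_gen:
  assumes "group H" "f \<in> X \<rightarrow> carrier H"
    and "R \<subseteq> carrier (free_group X)" "\<And>r. r \<in> R \<Longrightarrow> free_lift H f r = \<one>\<^bsub>H\<^esub>" "x \<in> X"
  shows "presented_lift H f (presented_gen X R x) = f x"
proof -
  have "f x \<in> carrier H" using assms by auto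
  then show ?thesis
    by (simp add: presented_gen_def presented_lift_coset[OF assms(1-4)] free_gen_closed[OF assms(5)]
        free_lift_gen[OF assms(1)])
qed

section \<open>The braid group\<close>

definition braid_relators :: "nat \<Rightarrow> nat word set" where
  "braid_relators n =
     {[(i, 1), (j, 1), (i, -1), (j, -1)] | i j.
        i \<in> {1..<n} \<and> j \<in> {1..<n} \<and> (i + 2 \<le> j \<or> j + 2 \<le> i)} \<union>
     {[(i, 1), (i + 1, 1), (i, 1), (i + 1, -1), (i, -1), (i + 1, -1)] | i.
        i \<in> {1..<n} \<and> i + 1 \<in> {1..<n}}"

definition braid_group :: "nat \<Rightarrow> nat word set monoid" where
  "braid_group n = presented_group {1..<n} (braid_relators n)"

definition sigma :: "nat \<Rightarrow> nat \<Rightarrow> nat word set" where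
  "sigma n i = presented_gen {1..<n} (braid_relators n) i"

text \<open>Symmetric in \<open>i\<close> and \<open>j\<close> by construction; meaningful for distinct \<open>i, j \<in> {1..n}\<close> only.\<close>

definition bkl :: "nat \<Rightarrow> nat \<Rightarrow> nat \<Rightarrow> nat word set" where
  "bkl n i j =
     (let p = min i j; q = max i j;
          c = foldr (\<lambda>k h. sigma n k \<otimes>\<^bsub>braid_group n\<^esub> h) [p..<q - 1] \<one>\<^bsub>braid_group n\<^esub>
      in c \<otimes>\<^bsub>braid_group n\<^esub> sigma n (q - 1) \<otimes>\<^bsub>braid_group n\<^esub> inv\<^bsub>braid_group n\<^esub> c)"


lemma braid_relators_carrier: "braid_relators n \<subseteq> carrier (free_group {1..<n})"
  by (auto simp: braid_relators_def free_group_def reduced_def)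

lemma group_braid_group: "group (braid_group n)"
  unfolding braid_group_def by (intro group_presented_group braid_relators_carrier)

lemma free_lift_braid_relators:
  assumes "group H" "f \<in> {1..<n} \<rightarrow> carrier H"
    and comm: "\<And>i j. \<lbrakk>i \<in> {1..<n}; j \<in> {1..<n}; i + 2 \<le> j\<rbrakk> \<Longrightarrow> f i \<otimes>\<^bsub>H\<^esub> f j = f j \<otimes>\<^bsub>H\<^esub> f i"
    and braid: "\<And>i. \<lbrakk>i \<in> {1..<n}; i + 1 \<in> {1..<n}\<rbrakk> \<Longrightarrow>
      f i \<otimes>\<^bsub>H\<^esub> (f (i + 1) \<otimes>\<^bsub>H\<^esub> f i) = f (i + 1) \<otimes>\<^bsub>H\<^esub> (f i \<otimes>\<^bsub>H\<^esub> f (i + 1))"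
    and r: "r \<in> braid_relators n"
  shows "free_lift H f r = \<one>\<^bsub>H\<^esub>"
proof -
  interpret H: group H by fact
  have f: "f i \<in> carrier H" if "i \<in> {1..<n}" for i using assms(2) that by auto
  from r consider
    i j where "r = [(i, 1), (j, 1), (i, -1), (j, -1)]" "i \<in> {1..<n}" "j \<in> {1..<n}"
      "i + 2 \<le> j \<or> j + 2 \<le> i"
  | i where "r = [(i, 1), (i + 1, 1), (i, 1), (i + 1, -1), (i, -1), (i + 1, -1)]"
      "i \<in> {1..<n}" "i + 1 \<in> {1..<n}"
    unfolding braid_relators_def by blast
  then show ?thesis
  proof cases
    case 1
    then have c: "f i \<otimes>\<^bsub>H\<^esub> f j = f j \<otimes>\<^bsub>H\<^esub> f i" by (metis comm)
    have "free_lift H f r = (f i \<otimes>\<^bsub>H\<^esub> f j) \<otimes>\<^bsub>H\<^esub> inv\<^bsub>H\<^esub> (f j \<otimes>\<^bsub>H\<^esub> f i)"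
      using f[OF 1(2)] f[OF 1(3)]
      by (simp add: 1(1) free_lift_def H.int_pow_neg H.inv_mult_group H.m_assoc)
    then show ?thesis using c f[OF 1(2)] f[OF 1(3)] by simp
  next
    case 2
    have "free_lift H f r = (f i \<otimes>\<^bsub>H\<^esub> (f (i + 1) \<otimes>\<^bsub>H\<^esub> f i))
                            \<otimes>\<^bsub>H\<^esub> inv\<^bsub>H\<^esub> (f (i + 1) \<otimes>\<^bsub>H\<^esub> (f i \<otimes>\<^bsub>H\<^esub> f (i + 1)))"
      using f[OF 2(2)] f[OF 2(3)]
      by (simp add: 2(1) free_lift_def H.int_pow_neg H.inv_mult_group H.m_assoc)
    then show ?thesis using braid[OF 2(2,3)] f[OF 2(2)] f[OF 2(3)] by simp
  qed
qed
section \<open>The two actions\<close>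

abbreviation tuples :: "nat \<Rightarrow> ('a, 'b) monoid_scheme \<Rightarrow> (nat \<Rightarrow> 'a) set" where
  "tuples n G \<equiv> {1..n} \<rightarrow>\<^sub>E carrier G"

definition hurwitz_gen :: "nat \<Rightarrow> ('a, 'b) monoid_scheme \<Rightarrow> nat \<Rightarrow> (nat \<Rightarrow> 'a) \<Rightarrow> (nat \<Rightarrow> 'a)" where
  "hurwitz_gen n G i =
     (\<lambda>g\<in>tuples n G. g(i := g (i + 1),
                       i + 1 := inv\<^bsub>G\<^esub> g (i + 1) \<otimes>\<^bsub>G\<^esub> g i \<otimes>\<^bsub>G\<^esub> g (i + 1)))"

text \<open>The product of \<^const>\<open>BijGroup\<close> is composition, so homomorphisms into it are left actions.\<close>

definition hurwitz ::
  "nat \<Rightarrow> ('a, 'b) monoid_scheme \<Rightarrow> nat word set \<Rightarrow> (nat \<Rightarrow> 'a) \<Rightarrow> (nat \<Rightarrow> 'a)" where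
  "hurwitz n G = presented_lift (BijGroup (tuples n G)) (hurwitz_gen n G)"

lemma hurwitz_gen_Bij:
  assumes "group G" "i \<in> {1..<n}"
  shows "hurwitz_gen n G i \<in> Bij (tuples n G)"
proof -
  interpret G: group G by fact
  have i: "i \<in> {1..n}" "Suc i \<in> {1..n}" using assms(2) by auto
  let ?f = "\<lambda>g. g(i := g i \<otimes>\<^bsub>G\<^esub> g (i + 1) \<otimes>\<^bsub>G\<^esub> inv\<^bsub>G\<^esub> g i, i + 1 := g i)"
  have carr: "g i \<in> carrier G" "g (Suc i) \<in> carrier G" if "g \<in> tuples n G" for g
    using that i by auto
  have cancel: "a \<otimes>\<^bsub>G\<^esub> (inv\<^bsub>G\<^esub> a \<otimes>\<^bsub>G\<^esub> b) = b" "inv\<^bsub>G\<^esub> a \<otimes>\<^bsub>G\<^esub> (a \<otimes>\<^bsub>G\<^esub> b) = b"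
    if "a \<in> carrier G" "b \<in> carrier G" for a b
    using that by (simp_all flip: G.m_assoc)
  have "bij_betw (hurwitz_gen n G i) (tuples n G) (tuples n G)"
  proof (rule bij_betw_byWitness[where f' = ?f])
    show "\<forall>g\<in>tuples n G. ?f (hurwitz_gen n G i g) = g"
      using carr by (auto simp: hurwitz_gen_def fun_eq_iff G.m_assoc cancel)
    have "hurwitz_gen n G i (?f g) = g" if g: "g \<in> tuples n G" for g
    proof -
      have "?f g \<in> tuples n G"
        using g carr[OF g] i by (auto simp: PiE_iff extensional_def)
      then show ?thesis
        using carr[OF g] by (auto simp: hurwitz_gen_def fun_eq_iff G.m_assoc cancel)
    qed
    then show "\<forall>g\<in>tuples n G. hurwitz_gen n G i (?f g) = g" by blast
    show "hurwitz_gen n G i ` tuples n G \<subseteq> tuples n G" "?f ` tuples n G \<subseteq> tuples n G"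
      using i by (auto simp: hurwitz_gen_def PiE_iff extensional_def)
  qed
  then show ?thesis by (simp add: Bij_def hurwitz_gen_def)
qed

lemma hurwitz_gen_braid_relators:
  assumes "group G" "r \<in> braid_relators n"
  shows "free_lift (BijGroup (tuples n G)) (hurwitz_gen n G) r = \<one>\<^bsub>BijGroup (tuples n G)\<^esub>"
proof (rule free_lift_braid_relators[OF group_BijGroup _ _ _ assms(2)])
  interpret G: group G by fact
  have cancel: "a \<otimes>\<^bsub>G\<^esub> (inv\<^bsub>G\<^esub> a \<otimes>\<^bsub>G\<^esub> b) = b" "inv\<^bsub>G\<^esub> a \<otimes>\<^bsub>G\<^esub> (a \<otimes>\<^bsub>G\<^esub> b) = b"
    if "a \<in> carrier G" "b \<in> carrier G" for a b
    using that by (simp_all flip: G.m_assoc)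
  note B = hurwitz_gen_Bij[OF assms(1)]
  show "hurwitz_gen n G \<in> {1..<n} \<rightarrow> carrier (BijGroup (tuples n G))"
    using B by (auto simp: BijGroup_def)
  have mem: "hurwitz_gen n G i g \<in> tuples n G" if "i \<in> {1..<n}" "g \<in> tuples n G" for i g
    using Bij_imp_funcset[OF B[OF that(1)]] that(2) by blast
  have app: "hurwitz_gen n G i g = g(i := g (i + 1),
      i + 1 := inv\<^bsub>G\<^esub> g (i + 1) \<otimes>\<^bsub>G\<^esub> g i \<otimes>\<^bsub>G\<^esub> g (i + 1))" if "g \<in> tuples n G" for i g
    using that by (simp add: hurwitz_gen_def)
  show "hurwitz_gen n G i \<otimes>\<^bsub>BijGroup (tuples n G)\<^esub> hurwitz_gen n G j
      = hurwitz_gen n G j \<otimes>\<^bsub>BijGroup (tuples n G)\<^esub> hurwitz_gen n G i"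
    if "i \<in> {1..<n}" "j \<in> {1..<n}" "i + 2 \<le> j" for i j
  proof -
    have "hurwitz_gen n G i (hurwitz_gen n G j g) = hurwitz_gen n G j (hurwitz_gen n G i g)"
      if g: "g \<in> tuples n G" for g
      unfolding app[OF mem[OF \<open>i \<in> _\<close> g]] app[OF mem[OF \<open>j \<in> _\<close> g]]
      unfolding app[OF g]
      using \<open>i + 2 \<le> j\<close> by (auto simp: fun_eq_iff)
    then show ?thesis
      using that B by (simp add: BijGroup_def compose_def cong: restrict_cong)
  qed
  show "hurwitz_gen n G i \<otimes>\<^bsub>BijGroup (tuples n G)\<^esub>
        (hurwitz_gen n G (i + 1) \<otimes>\<^bsub>BijGroup (tuples n G)\<^esub> hurwitz_gen n G i)
      = hurwitz_gen n G (i + 1) \<otimes>\<^bsub>BijGroup (tuples n G)\<^esub>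
        (hurwitz_gen n G i \<otimes>\<^bsub>BijGroup (tuples n G)\<^esub> hurwitz_gen n G (i + 1))"
    if i: "i \<in> {1..<n}" "i + 1 \<in> {1..<n}" for i
  proof -
    have "hurwitz_gen n G i (hurwitz_gen n G (i + 1) (hurwitz_gen n G i g))
        = hurwitz_gen n G (i + 1) (hurwitz_gen n G i (hurwitz_gen n G (i + 1) g))"
      if g: "g \<in> tuples n G" for g
    proof -
      have c: "g i \<in> carrier G" "g (Suc i) \<in> carrier G" "g (Suc (Suc i)) \<in> carrier G"
        using g i by auto
      show ?thesis
        unfolding app[OF mem[OF i(2) mem[OF i(1) g]]] app[OF mem[OF i(1) mem[OF i(2) g]]]
        unfolding app[OF mem[OF i(1) g]] app[OF mem[OF i(2) g]]
        unfolding app[OF g]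
        using c by (auto simp: fun_eq_iff G.m_assoc G.inv_mult_group cancel)
    qed
    then show ?thesis
      using i B by (simp add: BijGroup_def compose_Bij) (simp add: compose_def mem cong: restrict_cong)
  qed
qed

lemma hurwitz_action:
  assumes "group G"
  shows "group_action (braid_group n) (tuples n G) (hurwitz n G)"
    and "i \<in> {1..<n} \<Longrightarrow> hurwitz n G (sigma n i) = hurwitz_gen n G i"
proof -
  have f: "hurwitz_gen n G \<in> {1..<n} \<rightarrow> carrier (BijGroup (tuples n G))"
    using hurwitz_gen_Bij[OF assms] by (auto simp: BijGroup_def)
  note R = braid_relators_carrier[of n] hurwitz_gen_braid_relators[OF assms, of _ n]
  show "group_action (braid_group n) (tuples n G) (hurwitz n G)"
    unfolding group_action_def group_hom_def group_hom_axioms_def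
    using presented_lift_hom[OF group_BijGroup f R] group_braid_group group_BijGroup
    by (auto simp only: hurwitz_def braid_group_def)
  show "hurwitz n G (sigma n i) = hurwitz_gen n G i" if "i \<in> {1..<n}"
    unfolding hurwitz_def sigma_def by (rule presented_lift_gen[OF group_BijGroup f R that])
qed

definition artin_img :: "nat \<Rightarrow> nat \<Rightarrow> nat \<Rightarrow> nat word" where
  "artin_img n i j =
     (if j = i then free_gen i \<otimes>\<^bsub>free_n n\<^esub> free_gen (i + 1)
                      \<otimes>\<^bsub>free_n n\<^esub> inv\<^bsub>free_n n\<^esub> free_gen i
      else if j = i + 1 then free_gen i
      else free_gen j)"

definition artin_gen :: "nat \<Rightarrow> nat \<Rightarrow> nat word \<Rightarrow> nat word" where
  "artin_gen n i =
     (\<lambda>w\<in>carrier (free_n n). free_lift (free_n n) (artin_img n i) w)"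

definition artin :: "nat \<Rightarrow> nat word set \<Rightarrow> nat word \<Rightarrow> nat word" where
  "artin n = presented_lift (AutoGroup (free_n n)) (artin_gen n)"

lemma artin_gen_free_gen:
  assumes "i \<in> {1..<n}" "j \<in> {1..n}"
  shows "artin_gen n i (free_gen j) = artin_img n i j"
    and "artin_img n i j \<in> carrier (free_n n)"
proof -
  interpret F: group "free_n n" by (rule group_free_n)
  have g: "free_gen k \<in> carrier (free_n n)" if "k \<in> {1..n}" for k
    using that by (rule free_gen_closed_n)
  show closed: "artin_img n i j \<in> carrier (free_n n)"
    using assms g[of i] g[of "i + 1"] g[of j] by (auto simp: artin_img_def)
  show "artin_gen n i (free_gen j) = artin_img n i j"
    using g[OF assms(2)] free_lift_gen[of "free_n n" "artin_img n i" j, OF F.is_group closed] by (simp add: artin_gen_def)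
qed

lemma artin_gen_hom:
  assumes "i \<in> {1..<n}"
  shows "artin_gen n i \<in> hom (free_n n) (free_n n)"
proof -
  interpret F: group "free_n n" by (rule group_free_n)
  have "free_lift (free_n n) (artin_img n i) \<in> hom (free_n n) (free_n n)"
    using artin_gen_free_gen(2)[OF assms] by (intro free_lift_hom_n F.is_group) auto
  then show ?thesis
    by (auto simp: hom_def artin_gen_def Pi_iff F.m_closed)
qed

lemma artin_gen_auto:
  assumes i: "i \<in> {1..<n}"
  shows "artin_gen n i \<in> auto (free_n n)"
proof -
  let ?F = "free_n n"
  interpret F: group ?F by (rule group_free_n)
  let ?f = "\<lambda>j. if j = i then free_gen (i + 1)
      else if j = i + 1 then inv\<^bsub>?F\<^esub> free_gen (i + 1) \<otimes>\<^bsub>?F\<^esub> free_gen i \<otimes>\<^bsub>?F\<^esub> free_gen (i + 1)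
      else free_gen j"
  let ?h = "free_lift ?F ?f"
  have cancel: "a \<otimes>\<^bsub>?F\<^esub> (inv\<^bsub>?F\<^esub> a \<otimes>\<^bsub>?F\<^esub> b) = b" "inv\<^bsub>?F\<^esub> a \<otimes>\<^bsub>?F\<^esub> (a \<otimes>\<^bsub>?F\<^esub> b) = b"
    if "a \<in> carrier ?F" "b \<in> carrier ?F" for a b
    using that by (simp_all flip: F.m_assoc)
  have g: "free_gen k \<in> carrier ?F" if "k \<in> {1..n}" for k
    using that by (rule free_gen_closed_n)
  have gi: "free_gen i \<in> carrier ?F" "free_gen (Suc i) \<in> carrier ?F"
    using g[of i] g[of "Suc i"] i by auto
  have f: "?f \<in> {1..n} \<rightarrow> carrier ?F"
    using g gi by auto
  have h: "?h \<in> hom ?F ?F" by (intro free_lift_hom_n F.is_group f)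
  have h_gen: "?h (free_gen j) = ?f j" if "j \<in> {1..n}" for j
    by (rule free_lift_gen[OF F.is_group]) (use f that in blast)
  interpret h: group_hom ?F ?F ?h using h by unfold_locales
  note s = artin_gen_hom[OF i]
  interpret s: group_hom ?F ?F "artin_gen n i" using s by unfold_locales
  have id: "(\<lambda>w. w) \<in> hom ?F ?F" by (auto simp: hom_def)
  have ii: "i \<in> {1..n}" "Suc i \<in> {1..n}" using i by auto
  have "?h (artin_gen n i w) = w" if "w \<in> carrier ?F" for w
  proof (rule free_hom_unique_n[OF F.is_group _ id _ that])
    show "(\<lambda>w. ?h (artin_gen n i w)) \<in> hom ?F ?F"
      using hom_compose[OF s h] by (simp add: comp_def)
    show "?h (artin_gen n i (free_gen j)) = free_gen j" if "j \<in> {1..n}" for j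
      using that ii gi h_gen[OF that] h_gen[OF ii(1)] h_gen[OF ii(2)]
      by (auto simp: artin_gen_free_gen(1)[OF i] artin_img_def F.m_assoc cancel)
  qed
  moreover have "artin_gen n i (?h w) = w" if "w \<in> carrier ?F" for w
  proof (rule free_hom_unique_n[OF F.is_group _ id _ that])
    show "(\<lambda>w. artin_gen n i (?h w)) \<in> hom ?F ?F"
      using hom_compose[OF h s] by (simp add: comp_def)
    show "artin_gen n i (?h (free_gen j)) = free_gen j" if "j \<in> {1..n}" for j
      using that ii gi g[OF that] artin_gen_free_gen(1)[OF i ii(1)] artin_gen_free_gen(1)[OF i ii(2)]
        artin_gen_free_gen(1)[OF i that]
      by (auto simp: h_gen artin_img_def F.m_assoc cancel)
  qed
  ultimately have "bij_betw (artin_gen n i) (carrier ?F) (carrier ?F)"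
    by (intro bij_betw_byWitness[where f' = ?h]) auto
  then show ?thesis
    using s by (simp add: auto_def Bij_def artin_gen_def)
qed

lemma artin_gen_braid_relators:
  assumes "r \<in> braid_relators n"
  shows "free_lift (AutoGroup (free_n n)) (artin_gen n) r = \<one>\<^bsub>AutoGroup (free_n n)\<^esub>"
proof (rule free_lift_braid_relators[OF group.AutoGroup[OF group_free_n] _ _ _ assms])
  let ?F = "free_n n"
  interpret F: group ?F by (rule group_free_n)
  have cancel: "a \<otimes>\<^bsub>?F\<^esub> (inv\<^bsub>?F\<^esub> a \<otimes>\<^bsub>?F\<^esub> b) = b" "inv\<^bsub>?F\<^esub> a \<otimes>\<^bsub>?F\<^esub> (a \<otimes>\<^bsub>?F\<^esub> b) = b"
    if "a \<in> carrier ?F" "b \<in> carrier ?F" for a b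
    using that by (simp_all flip: F.m_assoc)
  have g: "free_gen k \<in> carrier ?F" if "k \<in> {1..n}" for k
    using that by (rule free_gen_closed_n)
  show "artin_gen n \<in> {1..<n} \<rightarrow> carrier (AutoGroup ?F)"
    using artin_gen_auto by (auto simp: AutoGroup_def)
  have B: "artin_gen n i \<in> Bij (carrier ?F)" if "i \<in> {1..<n}" for i
    using artin_gen_auto[OF that] by (simp add: auto_def)
  have hom: "group_hom ?F ?F (artin_gen n i)" if "i \<in> {1..<n}" for i
    using artin_gen_hom[OF that] F.is_group by (simp add: group_hom_def group_hom_axioms_def)
  have mem: "artin_gen n i w \<in> carrier ?F" if "i \<in> {1..<n}" "w \<in> carrier ?F" for i w
    using group_hom.hom_closed[OF hom[OF that(1)] that(2)] .
  show "artin_gen n i \<otimes>\<^bsub>AutoGroup ?F\<^esub> artin_gen n j = artin_gen n j \<otimes>\<^bsub>AutoGroup ?F\<^esub> artin_gen n i"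
    if i: "i \<in> {1..<n}" and j: "j \<in> {1..<n}" and ij: "i + 2 \<le> j" for i j
  proof -
    interpret i: group_hom ?F ?F "artin_gen n i" by (rule hom[OF i])
    interpret j: group_hom ?F ?F "artin_gen n j" by (rule hom[OF j])
    have k: "i \<in> {1..n}" "Suc i \<in> {1..n}" "j \<in> {1..n}" "Suc j \<in> {1..n}" using i j by auto
    have "artin_gen n i (artin_gen n j w) = artin_gen n j (artin_gen n i w)"
      if "w \<in> carrier ?F" for w
    proof (rule free_hom_unique_n[OF F.is_group _ _ _ that])
      show "(\<lambda>w. artin_gen n i (artin_gen n j w)) \<in> hom ?F ?F"
        "(\<lambda>w. artin_gen n j (artin_gen n i w)) \<in> hom ?F ?F"
        using hom_compose[OF j.homh i.homh] hom_compose[OF i.homh j.homh] by (simp_all add: comp_def)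
      show "artin_gen n i (artin_gen n j (free_gen l)) = artin_gen n j (artin_gen n i (free_gen l))"
        if l: "l \<in> {1..n}" for l
        using l ij g[OF k(1)] g[OF k(2)] g[OF k(3)] g[OF k(4)] g[OF l]
          artin_gen_free_gen(1)[OF i l] artin_gen_free_gen(1)[OF j l]
          artin_gen_free_gen(1)[OF i k(1)] artin_gen_free_gen(1)[OF i k(2)]
          artin_gen_free_gen(1)[OF i k(3)] artin_gen_free_gen(1)[OF i k(4)]
          artin_gen_free_gen(1)[OF j k(1)] artin_gen_free_gen(1)[OF j k(2)]
          artin_gen_free_gen(1)[OF j k(3)] artin_gen_free_gen(1)[OF j k(4)]
        by (auto simp: artin_img_def)
    qed
    then show ?thesis
      using B[OF i] B[OF j] by (simp add: AutoGroup_def BijGroup_def compose_def cong: restrict_cong)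
  qed
  show "artin_gen n i \<otimes>\<^bsub>AutoGroup ?F\<^esub> (artin_gen n (i + 1) \<otimes>\<^bsub>AutoGroup ?F\<^esub> artin_gen n i)
      = artin_gen n (i + 1) \<otimes>\<^bsub>AutoGroup ?F\<^esub> (artin_gen n i \<otimes>\<^bsub>AutoGroup ?F\<^esub> artin_gen n (i + 1))"
    if i: "i \<in> {1..<n}" and j: "i + 1 \<in> {1..<n}" for i
  proof -
    let ?s = "artin_gen n i" and ?t = "artin_gen n (i + 1)"
    interpret i: group_hom ?F ?F ?s by (rule hom[OF i])
    interpret j: group_hom ?F ?F ?t by (rule hom[OF j])
    interpret Suc: group_hom ?F ?F "artin_gen n (Suc i)" using j.group_hom_axioms by simp
    have k: "i \<in> {1..n}" "Suc i \<in> {1..n}" "Suc (Suc i) \<in> {1..n}" using i j by auto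
    have "?s (?t (?s w)) = ?t (?s (?t w))" if "w \<in> carrier ?F" for w
    proof (rule free_hom_unique_n[OF F.is_group _ _ _ that])
      show "(\<lambda>w. ?s (?t (?s w))) \<in> hom ?F ?F" "(\<lambda>w. ?t (?s (?t w))) \<in> hom ?F ?F"
        using hom_compose[OF i.homh hom_compose[OF j.homh i.homh]]
          hom_compose[OF j.homh hom_compose[OF i.homh j.homh]] by (simp_all add: comp_def)
      show "?s (?t (?s (free_gen l))) = ?t (?s (?t (free_gen l)))" if l: "l \<in> {1..n}" for l
        using l g[OF k(1)] g[OF k(2)] g[OF k(3)] g[OF l]
          artin_gen_free_gen(1)[OF i l] artin_gen_free_gen(1)[OF j l]
          artin_gen_free_gen(1)[OF i k(1)] artin_gen_free_gen(1)[OF i k(2)]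
          artin_gen_free_gen(1)[OF i k(3)]
          artin_gen_free_gen(1)[OF j k(1)] artin_gen_free_gen(1)[OF j k(2)]
          artin_gen_free_gen(1)[OF j k(3)]
        by (auto simp: artin_img_def F.m_assoc F.inv_mult_group cancel)
    qed
    then show ?thesis
      using B[OF i] B[OF j] by (simp add: AutoGroup_def BijGroup_def compose_Bij)
        (simp add: compose_def mem[OF i] mem[OF j, simplified] cong: restrict_cong)
  qed
qed

lemma artin_action:
  shows "artin n \<in> hom (braid_group n) (AutoGroup (free_n n))"
    and "i \<in> {1..<n} \<Longrightarrow> artin n (sigma n i) = artin_gen n i"
proof -
  have f: "artin_gen n \<in> {1..<n} \<rightarrow> carrier (AutoGroup (free_n n))"
    using artin_gen_auto by (auto simp: AutoGroup_def)
  note A = group.AutoGroup[OF group_free_n] f braid_relators_carrier[of n]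
    artin_gen_braid_relators[of _ n]
  show "artin n \<in> hom (braid_group n) (AutoGroup (free_n n))"
    unfolding artin_def braid_group_def by (rule presented_lift_hom[OF A])
  show "artin n (sigma n i) = artin_gen n i" if "i \<in> {1..<n}"
    unfolding artin_def sigma_def by (rule presented_lift_gen[OF A that])
qed

definition bullet :: "nat \<Rightarrow> nat word set \<Rightarrow> (nat \<Rightarrow> nat word) \<Rightarrow> (nat \<Rightarrow> nat word)" where
  "bullet n c t = (\<lambda>k\<in>{1..n}. artin n c (t k))"

section \<open>The procedure\<close>

definition t_triv :: "nat \<Rightarrow> nat \<Rightarrow> nat word" where
  "t_triv n = (\<lambda>k\<in>{1..n}. free_gen k)"

definition admissible ::
  "nat \<Rightarrow> (nat \<Rightarrow> 'a) \<Rightarrow> (nat \<Rightarrow> nat word) \<Rightarrow> nat \<Rightarrow> nat \<Rightarrow> int \<Rightarrow> bool" where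
  "admissible n u t i j \<eta> \<longleftrightarrow>
     i \<in> {1..n} \<and> j \<in> {1..n} \<and> \<eta> \<in> {1, -1} \<and> u i = u j \<and>
     (\<exists>k\<in>{1..n}. sublist [(i, \<eta>), (j, - \<eta>)] (t k))"

text \<open>An entry \<open>(i, j, \<gamma>)\<close> of \<open>l\<close> records the factor \<open>a\<^sub>i\<^sub>j\<^sup>\<gamma>\<close>.\<close>

type_synonym state = "(nat \<Rightarrow> nat word) \<times> (nat \<times> nat \<times> int) list"

inductive step :: "nat \<Rightarrow> (nat \<Rightarrow> 'a) \<Rightarrow> state \<Rightarrow> state \<Rightarrow> bool" for n u where
  "t \<noteq> t_triv n \<Longrightarrow> admissible n u t i j \<eta> \<Longrightarrow>
   step n u (t, l) (bullet n (bkl n i j [^]\<^bsub>braid_group n\<^esub> (- \<eta>)) t, (i, j, - \<eta>) # l)"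

definition start :: "nat \<Rightarrow> nat word set \<Rightarrow> state" where
  "start n b = (hurwitz n (free_n n) b (t_triv n), [])"

definition bkl_prod :: "nat \<Rightarrow> (nat \<times> nat \<times> int) list \<Rightarrow> nat word set" where
  "bkl_prod n l =
     foldr (\<lambda>(i, j, \<gamma>) c. bkl n i j [^]\<^bsub>braid_group n\<^esub> \<gamma> \<otimes>\<^bsub>braid_group n\<^esub> c) l \<one>\<^bsub>braid_group n\<^esub>"

end

theory Submission
  imports Defs "HOL-Algebra.Generated_Groups"
begin

text \<open>The tuple \<open>t\<close> is always \<open>c \<cdot> t\<^sub>t\<^sub>r\<^sub>i\<^sub>v = c\<^sup>-\<^sup>1 \<bullet> t\<^sub>t\<^sub>r\<^sub>i\<^sub>v\<close> for a braid \<open>c\<close> that fixes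
  \<open>u\<close>, because \<open>a\<^sub>i\<^sub>j\<close> fixes \<open>u\<close> whenever \<open>u\<^sub>i = u\<^sub>j\<close>.

  A subword exists: substituting \<open>u\<^sub>i\<close> for \<open>v\<^sub>i\<close> turns \<open>t\<close> into \<open>c \<cdot> u = u\<close>. If no cancellation
  occurs, every entry of \<open>t\<close> has length one, and since the Hurwitz action preserves the product of
  the entries, \<open>t\<close> is the trivial tuple.

  The procedure stops: \<open>F\<^sub>n\<close> carries a left-invariant cyclic order, read off from its planar
  Cayley tree, which braids preserve. Hence the chords joining \<open>g\<close> to \<open>g t\<^sub>k\<close> do not cross, since
  this holds for the trivial tuple. If some entry contains \<open>v\<^sub>i\<^sup>\<eta> v\<^sub>j\<^sup>-\<^sup>\<eta>\<close>, then no path of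
  letters crosses the corresponding chord at a vertex, and therefore \<open>a\<^sub>i\<^sub>j\<^sup>-\<^sup>\<eta>\<close> lengthens no entry
  and shortens this one.

  The factorization of \<open>b\<close> then amounts to Artin's theorem that the action of \<open>B\<^sub>n\<close> on \<open>F\<^sub>n\<close> is
  faithful, which is proved by combing: a braid on \<open>k + 1\<close> strands is a push of the last strand,
  times a braid on \<open>k\<close> strands, times a coset representative.\<close>

section \<open>Reduced words\<close>

text \<open>The inverse that links the two actions comes from their commuting: on the trivial tuple,
  sigma_i of the one acts as the inverse of sigma_i of the other, and commuting reverses products.

  The obstacle to termination is that \<open>a_ij^-eta\<close> turns one letter into up to five, so
  no count letter by letter works. Instead the word is cut at the vertices of its path, and at each
  vertex inside the region bounded by the chord a trivial factor (xy)^-1 (xy) is inserted.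
  Regrouped, every letter contributes at most one letter, provided that at no vertex the path enters
  strictly on one side of the chord and leaves strictly on the other. This is what the absence of
  crossings gives, and a path that follows the chord itself loses two letters.

  For faithfulness, combing supplies only the existence of a factorization. That its parts are
  trivial for a braid acting trivially is read off from the action: forgetting the last strand makes
  pushes invisible, and a push word can be recovered from the element by which it conjugates the
  last generator. That the pushes generate freely is thus an outcome of the argument, not an
  input.\<close>

fun bar :: "'a \<times> int \<Rightarrow> 'a \<times> int" where
  "bar (x, e) = (x, - e)"

lemma bar_bar [simp]: "bar (bar z) = z"
  by (cases z) simp

lemma bar_eq_iff: "bar y = z \<longleftrightarrow> y = bar z"
  by (cases y; cases z) auto

lemma rcons_bar: "rcons z (y # w) = (if y = bar z then w else z # y # w)"
  by (cases z; cases y) auto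

lemma reduced_Cons_Cons: "reduced (z # y # w) \<longleftrightarrow> y \<noteq> bar z \<and> reduced (y # w)"
  by (cases z; cases y) (auto simp: reduced_def)

lemma reduced_single [simp]: "reduced [z]"
  by (simp add: reduced_def)

lemma reduced_Nil [simp]: "reduced []"
  by (simp add: reduced_def)

lemma reduced_Cons: "reduced (z # w) \<longleftrightarrow> reduced w \<and> (w = [] \<or> hd w \<noteq> bar z)"
  by (cases w) (auto simp: reduced_Cons_Cons)

lemma reduced_append:
  "reduced (v @ w) \<longleftrightarrow> reduced v \<and> reduced w \<and> (v = [] \<or> w = [] \<or> hd w \<noteq> bar (last v))"
proof (induction v)
  case (Cons z v)
  then show ?case by (cases v) (auto simp: reduced_Cons)
qed simp

lemma foldr_rcons_append: "reduced (v @ w) \<Longrightarrow> foldr rcons v w = v @ w"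
proof (induction v)
  case (Cons z v)
  then show ?case using rcons_reduced[of z "v @ w"] by (auto dest: reduced_ConsD)
qed simp

lemma length_rcons: "length (rcons z w) \<le> Suc (length w)"
  by (induction z w rule: rcons.induct) auto

lemma length_foldr_rcons: "length (foldr rcons v w) \<le> length v + length w"
proof (induction v)
  case (Cons z v)
  then show ?case using length_rcons[of z "foldr rcons v w"] by simp
qed simp

lemma foldr_rcons_positive:
  "foldr (\<lambda>v w. foldr rcons v w) (map (\<lambda>k. free_gen (p k)) ks) [] = map (\<lambda>k. (p k, 1)) ks"
proof (induction ks)
  case (Cons k ks)
  then show ?case by (cases ks) (auto simp: free_gen_def)
qed simp

locale braids =
  fixes n :: nat
begin

abbreviation F :: "nat word monoid" where "F \<equiv> free_n n"
abbreviation B :: "nat word set monoid" where "B \<equiv> braid_group n"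

abbreviation fmult :: "nat word \<Rightarrow> nat word \<Rightarrow> nat word" (infixl "\<cdot>" 70) where
  "v \<cdot> w \<equiv> v \<otimes>\<^bsub>F\<^esub> w"

abbreviation finv :: "nat word \<Rightarrow> nat word" where "finv w \<equiv> inv\<^bsub>F\<^esub> w"

abbreviation bmult :: "nat word set \<Rightarrow> nat word set \<Rightarrow> nat word set" (infixl "\<star>" 70) where
  "c \<star> d \<equiv> c \<otimes>\<^bsub>B\<^esub> d"

abbreviation binv :: "nat word set \<Rightarrow> nat word set" where "binv c \<equiv> inv\<^bsub>B\<^esub> c"

sublocale F: group F by (rule group_free_n)
sublocale B: group B by (rule group_braid_group)

lemma F_carrier: "w \<in> carrier F \<longleftrightarrow> set w \<subseteq> {1..n} \<times> {1, -1} \<and> reduced w"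
  by (auto simp: free_n_def free_group_def)

lemma F_mult: "v \<cdot> w = foldr rcons v w"
  by (simp add: free_n_def free_group_def)

lemma F_one: "\<one>\<^bsub>F\<^esub> = []"
  by (simp add: free_n_def free_group_def)

lemma F_Nil_closed [simp]: "[] \<in> carrier F"
  using F.one_closed by (simp add: F_one)

lemma F_inv: "w \<in> carrier F \<Longrightarrow> finv w = rev (map bar w)"
proof -
  assume w: "w \<in> carrier F"
  have b: "bar = (\<lambda>(x, e). (x, - e))" by auto
  have "rev (map bar w) \<cdot> w = \<one>\<^bsub>F\<^esub>"
    using w by (simp add: F_mult F_one F_carrier b foldr_rcons_inverse)
  moreover have "rev (map bar w) \<in> carrier F"
    using w reduced_inverse[of w] by (auto simp: F_carrier b)
  ultimately show ?thesis using w by (metis F.inv_equality)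
qed

lemma F_append: "reduced (v @ w) \<Longrightarrow> v \<cdot> w = v @ w"
  by (simp add: F_mult foldr_rcons_append)

lemma F_Cons: "z # w \<in> carrier F \<Longrightarrow> z # w = [z] \<cdot> w"
  using F_append[of "[z]" w] by (simp add: F_carrier)

lemma F_appendD:
  assumes "v @ w \<in> carrier F"
  shows "v \<in> carrier F" "w \<in> carrier F" "v @ w = v \<cdot> w"
  using assms F_append[of v w] by (auto simp: F_carrier reduced_append)

lemma F_ConsD:
  assumes "z # w \<in> carrier F"
  shows "[z] \<in> carrier F" "w \<in> carrier F"
  using assms by (auto simp: F_carrier dest: reduced_ConsD)

lemma F_letter: "[z] \<in> carrier F \<longleftrightarrow> z \<in> {1..n} \<times> {1, -1}"
  by (auto simp: F_carrier)

lemma F_inv_letter: "[z] \<in> carrier F \<Longrightarrow> finv [z] = [bar z]"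
  by (simp add: F_inv)

lemma length_F_mult: "length (v \<cdot> w) \<le> length v + length w"
  by (simp add: F_mult length_foldr_rcons)

lemma F_cancel:
  assumes "v \<in> carrier F" "w \<in> carrier F"
  shows "v \<cdot> (finv v \<cdot> w) = w" "finv v \<cdot> (v \<cdot> w) = w"
  using assms by (simp_all flip: F.m_assoc)

lemma gen_closed: "k \<in> {1..n} \<Longrightarrow> free_gen k \<in> carrier F"
  by (rule free_gen_closed_n)

lemma F_hom_eqI:
  assumes "h \<in> hom F F" "h' \<in> hom F F"
    and "\<And>k. k \<in> {1..n} \<Longrightarrow> h (free_gen k) = h' (free_gen k)"
    and "w \<in> carrier F"
  shows "h w = h' w"
  by (rule free_hom_unique_n[OF F.is_group assms])

section \<open>The two actions on words\<close>

lemma sigma_closed: "i \<in> {1..<n} \<Longrightarrow> sigma n i \<in> carrier B"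
proof -
  assume "i \<in> {1..<n}"
  interpret P: group "free_group {1..<n}" by (rule group_free_group)
  interpret N: normal "normal_closure (free_group {1..<n}) (braid_relators n)" "free_group {1..<n}"
    by (intro normal_normal_closure group_free_group braid_relators_carrier)
  show ?thesis
    using free_gen_closed[OF \<open>i \<in> _\<close>]
    by (auto simp: sigma_def presented_gen_def braid_group_def presented_group_def carrier_FactGroup)
qed

text \<open>Both sides are homomorphisms with the same values on generators. The equality turns
  cosets into products of the \<open>sigma n i\<close>, from which generation and the defining
  relations are read off.\<close>

lemma free_lift_sigma:
  assumes "w \<in> carrier (free_group {1..<n})"
  shows "free_lift B (sigma n) w =
    normal_closure (free_group {1..<n}) (braid_relators n) #>\<^bsub>free_group {1..<n}\<^esub> w"
proof -
  let ?P = "free_group {1..<n}"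
  let ?N = "normal_closure ?P (braid_relators n)"
  interpret P: group ?P by (rule group_free_group)
  interpret N: normal ?N ?P
    by (intro normal_normal_closure group_free_group braid_relators_carrier)
  have s: "sigma n \<in> {1..<n} \<rightarrow> carrier B" using sigma_closed by blast
  have proj: "(\<lambda>w. ?N #>\<^bsub>?P\<^esub> w) \<in> hom ?P B"
    using N.r_coset_hom_Mod by (simp add: braid_group_def presented_group_def)
  show ?thesis
  proof (rule free_hom_unique[OF B.is_group free_lift_hom[OF B.is_group s] proj _ assms])
    show "free_lift B (sigma n) (free_gen i) = ?N #>\<^bsub>?P\<^esub> free_gen i" if "i \<in> {1..<n}" for i
      using that s by (subst free_lift_gen[OF B.is_group]) (auto simp: sigma_def presented_gen_def)
  qed
qed

lemma carrier_B: "carrier B = generate B (sigma n ` {1..<n})"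
proof
  let ?P = "free_group {1..<n}"
  let ?N = "normal_closure ?P (braid_relators n)"
  let ?h = "free_lift B (sigma n)"
  have s: "sigma n \<in> {1..<n} \<rightarrow> carrier B" using sigma_closed by blast
  show "generate B (sigma n ` {1..<n}) \<subseteq> carrier B"
    using s by (intro B.generate_incl) auto
  have mem: "?h w \<in> generate B (sigma n ` {1..<n})" if "set w \<subseteq> {1..<n} \<times> {1, -1}" for w
    using that
  proof (induction w)
    case Nil
    then show ?case by (simp add: free_lift_def generate.one)
  next
    case (Cons z w)
    obtain i e where z: "z = (i, e)" by fastforce
    with Cons.prems have i: "i \<in> {1..<n}" "e \<in> {1, -1}" by auto
    then have "sigma n i [^]\<^bsub>B\<^esub> e \<in> generate B (sigma n ` {1..<n})"
      using sigma_closed[OF i(1)] by (auto simp: B.int_pow_neg generate.incl generate.inv)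
    then show ?case
      using Cons by (auto simp: z free_lift_def intro: generate.eng)
  qed
  show "carrier B \<subseteq> generate B (sigma n ` {1..<n})"
  proof
    fix c assume "c \<in> carrier B"
    then obtain w where w: "w \<in> carrier ?P" "c = ?N #>\<^bsub>?P\<^esub> w"
      by (auto simp: braid_group_def presented_group_def carrier_FactGroup)
    then show "c \<in> generate B (sigma n ` {1..<n})"
      using mem[of w] free_lift_sigma[OF w(1)] by (auto simp: free_group_def)
  qed
qed

lemma free_lift_sigma_relator:
  assumes "r \<in> braid_relators n"
  shows "free_lift B (sigma n) r = \<one>\<^bsub>B\<^esub>"
proof -
  let ?P = "free_group {1..<n}"
  let ?N = "normal_closure ?P (braid_relators n)"
  interpret P: group ?P by (rule group_free_group)
  interpret N: normal ?N ?P
    by (intro normal_normal_closure group_free_group braid_relators_carrier)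
  have "r \<in> carrier ?P" using assms braid_relators_carrier by blast
  moreover have "r \<in> ?N" using assms by (auto simp: normal_closure_def)
  ultimately have "?N #>\<^bsub>?P\<^esub> r = ?N"
    using P.coset_join2[OF _ N.is_subgroup] by blast
  then show ?thesis
    using free_lift_sigma[OF \<open>r \<in> carrier ?P\<close>] by (simp add: braid_group_def presented_group_def FactGroup_def)
qed

text \<open>The case of inverses shapes later statements: they are proved for all tuples at once, or
  as equivalences, so that the hypothesis for c can be applied to an image under the inverse of
  c.\<close>

lemma braid_induct [consumes 1, case_names one sigma inv mult]:
  assumes "c \<in> carrier B"
    and "P \<one>\<^bsub>B\<^esub>" "\<And>i. i \<in> {1..<n} \<Longrightarrow> P (sigma n i)"
    and "\<And>c. c \<in> carrier B \<Longrightarrow> P c \<Longrightarrow> P (binv c)"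
    and "\<And>c d. c \<in> carrier B \<Longrightarrow> d \<in> carrier B \<Longrightarrow> P c \<Longrightarrow> P d \<Longrightarrow> P (c \<star> d)"
  shows "P c"
proof -
  have "c \<in> generate B (sigma n ` {1..<n})" using assms(1) carrier_B by blast
  then show ?thesis
  proof induction
    case (eng h1 h2)
    then show ?case using assms(5) carrier_B by blast
  next
    case (inv h)
    then obtain i where "i \<in> {1..<n}" "h = sigma n i" by auto
    then show ?case using assms(3,4) sigma_closed by blast
  qed (use assms(2,3) in auto)
qed

section \<open>The Artin action by automorphisms\<close>

lemma artin_auto: "c \<in> carrier B \<Longrightarrow> artin n c \<in> auto F"
  using artin_action(1)[of n] by (auto simp: hom_def AutoGroup_def)

lemma artin_hom: "c \<in> carrier B \<Longrightarrow> artin n c \<in> hom F F"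
  using artin_auto by (simp add: auto_def)

lemma artin_group_hom: "c \<in> carrier B \<Longrightarrow> group_hom F F (artin n c)"
  using artin_hom by unfold_locales

lemma artin_closed: "c \<in> carrier B \<Longrightarrow> w \<in> carrier F \<Longrightarrow> artin n c w \<in> carrier F"
  using artin_hom by (auto simp: hom_def)

lemma artin_F_mult: "c \<in> carrier B \<Longrightarrow> v \<in> carrier F \<Longrightarrow> w \<in> carrier F \<Longrightarrow>
    artin n c (v \<cdot> w) = artin n c v \<cdot> artin n c w"
  using artin_hom by (auto simp: hom_def)

lemma artin_F_inv: "c \<in> carrier B \<Longrightarrow> w \<in> carrier F \<Longrightarrow> artin n c (finv w) = finv (artin n c w)"
  using group_hom.hom_inv[OF artin_group_hom] .

lemma artin_Nil [simp]: "c \<in> carrier B \<Longrightarrow> artin n c [] = []"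
  using group_hom.hom_one[OF artin_group_hom] by (simp add: F_one)

lemma artin_mult:
  assumes "c \<in> carrier B" "d \<in> carrier B" "w \<in> carrier F"
  shows "artin n (c \<star> d) w = artin n c (artin n d w)"
proof -
  have "artin n (c \<star> d) = artin n c \<otimes>\<^bsub>AutoGroup F\<^esub> artin n d"
    using artin_action(1)[of n] assms by (auto simp: hom_def)
  then show ?thesis
    using assms artin_auto by (simp add: AutoGroup_def BijGroup_def auto_def compose_def)
qed

lemma artin_one: "w \<in> carrier F \<Longrightarrow> artin n \<one>\<^bsub>B\<^esub> w = w"
proof -
  assume w: "w \<in> carrier F"
  have "artin n \<one>\<^bsub>B\<^esub> = \<one>\<^bsub>AutoGroup F\<^esub>"
    by (rule hom_one[OF artin_action(1) B.is_group F.AutoGroup])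
  then show ?thesis using w by (simp add: AutoGroup_def BijGroup_def)
qed

lemma artin_inv:
  assumes "c \<in> carrier B" "w \<in> carrier F"
  shows "artin n (binv c) (artin n c w) = w" "artin n c (artin n (binv c) w) = w"
  using assms by (simp_all flip: artin_mult add: artin_one)

lemma artin_sigma:
  assumes "i \<in> {1..<n}" "k \<in> {1..n}"
  shows "artin n (sigma n i) (free_gen k) = artin_img n i k"
  using artin_action(2)[OF assms(1)] artin_gen_free_gen(1)[OF assms] by simp

lemma bullet_mult:
  assumes "c \<in> carrier B" "d \<in> carrier B" "t \<in> tuples n F"
  shows "bullet n (c \<star> d) t = bullet n c (bullet n d t)"
  using assms by (auto simp: bullet_def artin_mult PiE_iff fun_eq_iff)

lemma bullet_closed:
  assumes "c \<in> carrier B" "t \<in> tuples n F"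
  shows "bullet n c t \<in> tuples n F"
  using assms by (auto simp: bullet_def PiE_iff artin_closed)

lemma t_triv_closed: "t_triv n \<in> tuples n F"
  using gen_closed by (auto simp: t_triv_def)

subsection \<open>The Hurwitz action\<close>

lemma hurwitz_closed:
  assumes "group G" "c \<in> carrier B" "g \<in> tuples n G"
  shows "hurwitz n G c g \<in> tuples n G"
  using group_action.element_image[OF hurwitz_action(1)[OF assms(1)] assms(2,3)] by blast

lemma hurwitz_mult:
  assumes "group G" "c \<in> carrier B" "d \<in> carrier B" "g \<in> tuples n G"
  shows "hurwitz n G (c \<star> d) g = hurwitz n G c (hurwitz n G d g)"
  using group_action.composition_rule[OF hurwitz_action(1)[OF assms(1)] assms(4,2,3)] .

lemma hurwitz_one:
  assumes "group G" "g \<in> tuples n G"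
  shows "hurwitz n G \<one>\<^bsub>B\<^esub> g = g"
  using group_action.id_eq_one[OF hurwitz_action(1)[OF assms(1)]] assms(2)
  by (metis restrict_apply)

lemma hurwitz_inv:
  assumes "group G" "c \<in> carrier B" "g \<in> tuples n G"
  shows "hurwitz n G (binv c) (hurwitz n G c g) = g" "hurwitz n G c (hurwitz n G (binv c) g) = g"
  using assms by (simp_all flip: hurwitz_mult add: hurwitz_one)

lemma hurwitz_sigma:
  assumes "group G" "i \<in> {1..<n}" "g \<in> tuples n G"
  shows "hurwitz n G (sigma n i) g =
    g(i := g (i + 1), i + 1 := inv\<^bsub>G\<^esub> g (i + 1) \<otimes>\<^bsub>G\<^esub> g i \<otimes>\<^bsub>G\<^esub> g (i + 1))"
  using hurwitz_action(2)[OF assms(1,2)] assms(3) by (simp add: hurwitz_gen_def)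

lemma hurwitz_sigma_inv:
  assumes "group G" "i \<in> {1..<n}" "g \<in> tuples n G"
  shows "hurwitz n G (binv (sigma n i)) g =
    g(i := g i \<otimes>\<^bsub>G\<^esub> g (i + 1) \<otimes>\<^bsub>G\<^esub> inv\<^bsub>G\<^esub> g i, i + 1 := g i)"
proof -
  interpret G: group G by fact
  let ?g = "g(i := g i \<otimes>\<^bsub>G\<^esub> g (i + 1) \<otimes>\<^bsub>G\<^esub> inv\<^bsub>G\<^esub> g i, i + 1 := g i)"
  have c: "g i \<in> carrier G" "g (Suc i) \<in> carrier G" "i \<in> {1..n}" "Suc i \<in> {1..n}"
    using assms(2,3) by auto
  have "?g \<in> tuples n G"
    using assms(3) c by (auto simp: PiE_iff extensional_def)
  moreover from this have "hurwitz n G (sigma n i) ?g = g"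
    using c by (subst hurwitz_sigma[OF assms(1,2)])
      (auto simp: fun_eq_iff G.m_assoc G.inv_solve_left')
  ultimately show ?thesis
    using hurwitz_inv(1)[OF assms(1) sigma_closed[OF assms(2)], of ?g] by simp
qed

text \<open>The Hurwitz moves use only the group operations. This serves twice: for the substitution
  of u_i for v_i, and for the automorphism given by a braid, where it says that the two actions
  commute.\<close>

lemma hurwitz_natural:
  assumes "group G" "group H" "h \<in> hom G H" "c \<in> carrier B" "g \<in> tuples n G"
  shows "hurwitz n H c (\<lambda>k\<in>{1..n}. h (g k)) = (\<lambda>k\<in>{1..n}. h (hurwitz n G c g k))"
proof -
  interpret h: group_hom G H h using assms by (simp add: group_hom_def group_hom_axioms_def)
  have cl: "(\<lambda>k\<in>{1..n}. h (g k)) \<in> tuples n H" if "g \<in> tuples n G" for g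
    using that by (auto simp: PiE_iff)
  show ?thesis using assms(4,5)
  proof (induction arbitrary: g rule: braid_induct)
    case one
    then show ?case using cl[OF one] by (simp add: hurwitz_one assms(1,2) del: One_nat_def restrict_apply cong: restrict_cong)
  next
    case (sigma i)
    then have c: "g i \<in> carrier G" "g (Suc i) \<in> carrier G" "i \<in> {1..n}" "Suc i \<in> {1..n}" by auto
    then show ?case
      using sigma by (subst hurwitz_sigma[OF assms(2) _ cl])
        (auto simp: hurwitz_sigma[OF assms(1)] fun_eq_iff)
  next
    case (inv c)
    let ?g = "hurwitz n G (binv c) g"
    have g: "?g \<in> tuples n G" using inv by (intro hurwitz_closed assms(1)) auto
    \<comment> \<open>The hypothesis for c is applied to the tuple moved by the inverse of c; then c
      is removed from the left.\<close>
    have "hurwitz n H c (\<lambda>k\<in>{1..n}. h (?g k)) = (\<lambda>k\<in>{1..n}. h (g k))"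
      using inv.IH[OF g] by (simp only: hurwitz_inv(2)[OF assms(1) inv.hyps(1) inv.prems])
    then show ?case
      using hurwitz_inv(1)[OF assms(2) inv.hyps(1) cl[OF g]] by metis
  next
    case (mult c d)
    then show ?case
      by (simp only: hurwitz_mult[OF assms(2) mult.hyps cl] hurwitz_mult[OF assms(1) mult.hyps]
          hurwitz_closed[OF assms(1)])
  qed
qed

text \<open>For a product c d: the inverse of c gives c entrywise, the inverse of d can then be
  exchanged with it because the actions commute, and the factors come out in the right
  order.\<close>

lemma hurwitz_t_triv:
  assumes "c \<in> carrier B"
  shows "hurwitz n F (binv c) (t_triv n) = bullet n c (t_triv n)"
  using assms
proof (induction rule: braid_induct)
  have bh: "bullet n c (hurwitz n F d t) = hurwitz n F d (bullet n c t)"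
    if "c \<in> carrier B" "d \<in> carrier B" "t \<in> tuples n F" for c d t
    unfolding bullet_def
    by (rule hurwitz_natural[OF F.is_group F.is_group artin_hom, symmetric]) (use that in auto)
  {
    case one
    have "bullet n \<one>\<^bsub>B\<^esub> (t_triv n) = t_triv n"
      using t_triv_closed by (auto simp: bullet_def PiE_iff artin_one fun_eq_iff extensional_def simp del: One_nat_def)
    then show ?case using t_triv_closed by (simp add: hurwitz_one F.is_group)
  next
    case (sigma i)
    then show ?case
      by (subst hurwitz_sigma_inv[OF F.is_group _ t_triv_closed])
        (auto simp: bullet_def t_triv_def artin_sigma fun_eq_iff artin_img_def)
  next
    case (inv c)
    have "bullet n (binv c) (bullet n c (t_triv n)) = t_triv n"
      using inv t_triv_closed
      by (auto simp: bullet_def PiE_iff artin_inv fun_eq_iff extensional_def simp del: One_nat_def)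
    with inv have "hurwitz n F (binv c) (bullet n (binv c) (t_triv n)) = t_triv n"
      using t_triv_closed by (simp flip: bh)
    then show ?case
      using hurwitz_inv(2)[OF F.is_group inv(1) bullet_closed[OF _ t_triv_closed]] inv
      by (metis B.inv_closed B.inv_inv)
  next
    case (mult c d)
    then show ?case
      using t_triv_closed
      by (simp add: B.inv_mult_group hurwitz_mult bullet_mult F.is_group hurwitz_closed flip: bh)
  }
qed

text \<open>A move replaces adjacent factors x, y by y, y^-1 x y, whose product is again x
  y.\<close>

lemma hurwitz_product:
  assumes "c \<in> carrier B" "t \<in> tuples n F"
  shows "foldr (\<cdot>) (map (hurwitz n F c t) [1..<Suc n]) \<one>\<^bsub>F\<^esub> = foldr (\<cdot>) (map t [1..<Suc n]) \<one>\<^bsub>F\<^esub>"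
  using assms
proof (induction arbitrary: t rule: braid_induct)
  case one
  then show ?case by (simp add: hurwitz_one F.is_group)
next
  case (sigma i)
  obtain A C where AC: "[1..<Suc n] = A @ i # Suc i # C" "i \<notin> set A \<union> set C" "Suc i \<notin> set A \<union> set C"
    "set A \<union> set C \<subseteq> {1..n}"
  proof
    show "[1..<Suc n] = [1..<i] @ i # Suc i # [Suc (Suc i)..<Suc n]"
      using sigma upt_add_eq_append[of 1 i "Suc n - i"] upt_conv_Cons[of i "Suc n"]
        upt_conv_Cons[of "Suc i" "Suc n"] by (simp del: upt_Suc)
  qed (use sigma in auto)
  let ?t = "hurwitz n F (sigma n i) t"
  have "foldr (\<cdot>) (map t C) \<one>\<^bsub>F\<^esub> \<in> carrier F"
    using AC(4) sigma by (induction C) auto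
  moreover have "t i \<in> carrier F" "t (Suc i) \<in> carrier F" using sigma by auto
  moreover have "map ?t A = map t A" "map ?t C = map t C"
    using AC(2,3) sigma by (auto simp: hurwitz_sigma F.is_group)
  moreover have "?t i = t (Suc i)" "?t (Suc i) = finv (t (Suc i)) \<cdot> t i \<cdot> t (Suc i)"
    using sigma by (auto simp: hurwitz_sigma F.is_group)
  ultimately show ?case by (simp add: AC(1) F.m_assoc F_cancel del: upt_Suc One_nat_def map_eq_conv)
next
  case (inv c)
  then show ?case
    using inv.IH[OF hurwitz_closed[OF F.is_group _ inv.prems], of "binv c"]
    by (simp add: hurwitz_inv F.is_group del: upt_Suc One_nat_def)
next
  case (mult c d)
  then show ?case
    by (simp add: hurwitz_mult hurwitz_closed F.is_group del: upt_Suc One_nat_def)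
qed

end

section \<open>Existence of an admissible subword\<close>

lemma reduced_map:
  assumes "\<And>p y z q. w = p @ y # z # q \<Longrightarrow> g z \<noteq> bar (g y)"
  shows "reduced (map g w)"
  using assms
proof (induction w)
  case (Cons y w)
  have "reduced (map g w)"
  proof (rule Cons.IH)
    show "g z' \<noteq> bar (g y')" if "w = p @ y' # z' # q" for p y' z' q
      using Cons.prems[of "y # p"] that by simp
  qed
  moreover have "w = [] \<or> g (hd w) \<noteq> bar (g y)"
    using Cons.prems[of "[]" y "hd w" "tl w"] by (cases w) auto
  ultimately show ?case by (cases w) (auto simp: reduced_Cons)
qed simp

lemma free_lift_gens:
  assumes "\<And>i. i \<in> {1..n} \<Longrightarrow> u i = free_gen (x i) \<and> x i \<in> {1..m}"
    and "set w \<subseteq> {1..n} \<times> {1, -1}" "reduced (map (apfst x) w)"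
  shows "free_lift (free_n m) u w = map (apfst x) w"
  using assms(2,3)
proof (induction w)
  interpret M: braids m .
  case (Cons z w)
  obtain i e where z: "z = (i, e)" "i \<in> {1..n}" "e \<in> {1, -1}"
    using Cons.prems(1) by (cases z) auto
  then have "[(x i, 1)] \<in> carrier M.F" using assms(1)[of i] by (simp add: M.F_letter)
  then have "u i [^]\<^bsub>M.F\<^esub> e = [(x i, e)]"
    using z assms(1)[of i] M.F_inv_letter[of "(x i, 1)"]
    by (auto simp: free_gen_def M.F.int_pow_neg)
  moreover have "[(x i, e)] \<otimes>\<^bsub>M.F\<^esub> map (apfst x) w = (x i, e) # map (apfst x) w"
    using Cons.prems(2) z M.F_append[of "[(x i, e)]"] by simp
  moreover have "free_lift M.F u w = map (apfst x) w"
    using Cons by (auto dest: reduced_ConsD)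
  ultimately show ?case by (simp add: z free_lift_def)
qed (simp add: free_lift_def braids.F_one)

context braids
begin

text \<open>Generators are positive letters, so the product of the entries involves no cancellation.
  Since it equals v_1 ... v_n, the two words agree letter by letter.\<close>

lemma hurwitz_orbit_gens:
  assumes "c \<in> carrier B" and t: "t = hurwitz n F c (t_triv n)"
    and p: "\<And>k. k \<in> {1..n} \<Longrightarrow> t k = free_gen (p k)"
  shows "t = t_triv n"
proof -
  have F: "(\<cdot>) = (\<lambda>v w. foldr rcons v w)" by (intro ext F_mult)
  have pos: "foldr (\<cdot>) (map s [1..<Suc n]) \<one>\<^bsub>F\<^esub> = map (\<lambda>k. (q k, 1)) [1..<Suc n]"
    if "\<And>k. k \<in> {1..n} \<Longrightarrow> s k = free_gen (q k)" for s q
  proof -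
    have "map s [1..<Suc n] = map (\<lambda>k. free_gen (q k)) [1..<Suc n]"
      using that by auto
    then show ?thesis unfolding F F_one by (simp only: foldr_rcons_positive)
  qed
  have "foldr (\<cdot>) (map t [1..<Suc n]) \<one>\<^bsub>F\<^esub> = foldr (\<cdot>) (map (t_triv n) [1..<Suc n]) \<one>\<^bsub>F\<^esub>"
    unfolding t by (rule hurwitz_product[OF assms(1) t_triv_closed])
  then have "map (\<lambda>k. (p k, 1::int)) [1..<Suc n] = map (\<lambda>k. (k, 1)) [1..<Suc n]"
    using pos[of t p] pos[of "t_triv n" "\<lambda>k. k"] p by (simp add: t_triv_def del: upt_Suc)
  then have "p k = k" if "k \<in> {1..n}" for k
    using that by (simp del: upt_Suc)
  moreover have "t \<in> tuples n F"
    unfolding t by (rule hurwitz_closed[OF F.is_group assms(1) t_triv_closed])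
  ultimately show ?thesis
    using p by (auto simp: t_triv_def PiE_iff extensional_def)
qed

lemma exists_admissible:
  assumes u: "u \<in> {1..n} \<rightarrow>\<^sub>E free_gen ` {1..m}"
    and c: "c \<in> carrier B" "hurwitz n (free_n m) c u = u"
    and t: "t = hurwitz n F c (t_triv n)" "t \<noteq> t_triv n"
  shows "\<exists>i j \<eta>. admissible n u t i j \<eta>"
proof (rule ccontr)
  assume no: "\<not> ?thesis"
  interpret M: braids m .
  have "\<forall>i\<in>{1..n}. \<exists>x. u i = free_gen x \<and> x \<in> {1..m}"
    using PiE_mem[OF u] by blast
  then obtain x where x: "\<And>i. i \<in> {1..n} \<Longrightarrow> u i = free_gen (x i) \<and> x i \<in> {1..m}"
    using bchoice[of "{1..n}" "\<lambda>i x. u i = free_gen x \<and> x \<in> {1..m}"] by blast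
  have ucl: "u \<in> {1..n} \<rightarrow> carrier M.F" using x M.gen_closed by auto
  let ?\<phi> = "free_lift M.F u"
  have \<phi>: "?\<phi> \<in> hom F M.F" by (rule free_lift_hom_n[OF M.F.is_group ucl])
  have "(\<lambda>k\<in>{1..n}. ?\<phi> (t_triv n k)) = u"
  proof
    fix k
    show "(\<lambda>k\<in>{1..n}. ?\<phi> (t_triv n k)) k = u k"
    proof (cases "k \<in> {1..n}")
      case True
      then have "?\<phi> (free_gen k) = u k"
        using ucl by (intro free_lift_gen[OF M.F.is_group]) auto
      with True show ?thesis by (simp add: t_triv_def)
    qed (use u in \<open>auto simp: PiE_iff extensional_def\<close>)
  qed
  with hurwitz_natural[OF F.is_group M.F.is_group \<phi> c(1) t_triv_closed]
  have u_eq: "u = (\<lambda>k\<in>{1..n}. ?\<phi> (t k))" by (simp only: c(2) t(1))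
  have tcl: "t \<in> tuples n F"
    unfolding t by (rule hurwitz_closed[OF F.is_group c(1) t_triv_closed])
  have "t k = free_gen (fst (hd (t k)))" if k: "k \<in> {1..n}" for k
  proof -
    have tk: "set (t k) \<subseteq> {1..n} \<times> {1, -1}" using tcl k by (auto simp: PiE_iff F_carrier)
    have "reduced (map (apfst x) (t k))"
    proof (rule reduced_map)
      fix p y z q assume w: "t k = p @ y # z # q"
      obtain i e j d where yz: "y = (i, e)" "z = (j, d)" by fastforce
      have ij: "i \<in> {1..n}" "j \<in> {1..n}" "e \<in> {1, -1}" using tk by (auto simp: w yz)
      \<comment> \<open>A cancellation after the renaming comes from letters v_i^e v_j^-e with u_i =
        u_j, that is, from an admissible subword.\<close>
      show "apfst x z \<noteq> bar (apfst x y)"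
      proof
        assume "apfst x z = bar (apfst x y)"
        then have "x i = x j" "d = - e" by (auto simp: yz)
        then have "u i = u j" "sublist [(i, e), (j, - e)] (t k)"
          using x[OF ij(1)] x[OF ij(2)] sublist_appendI[of "[(i, e), (j, - e)]" p q]
          by (simp_all add: w yz)
        then have "admissible n u t i j e"
          using ij k unfolding admissible_def by blast
        with no show False by blast
      qed
    qed
    then have "?\<phi> (t k) = map (apfst x) (t k)"
      using x tk by (intro free_lift_gens[of n]) auto
    then have "map (apfst x) (t k) = free_gen (x k)"
      using u_eq x[OF k] k by (metis restrict_apply')
    \<comment> \<open>The renaming keeps length and exponents, so \<open>t k\<close> is a single
      letter with exponent 1.\<close>
    then show ?thesis by (cases "t k") (auto simp: free_gen_def)
  qed
  then have "t = t_triv n" by (rule hurwitz_orbit_gens[OF c(1) t(1)])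
  with t(2) show False by blast
qed

end

section \<open>The planar cyclic order on the free group\<close>

text \<open>The half-edges at a vertex of the Cayley tree are placed around it in the order
  base point, \<open>v\<^sub>1\<close>, \<open>v\<^sub>1\<^sup>-\<^sup>1\<close>, \<open>v\<^sub>2\<close>, \<open>v\<^sub>2\<^sup>-\<^sup>1\<close>, and so on. Three group elements are
  in cyclic order if they are so as seen from some vertex (their median in the tree).\<close>

fun pos :: "nat \<times> int \<Rightarrow> nat" where
  "pos (k, e) = (if e = 1 then 2 * k else 2 * k + 1)"

text \<open>The value 0 for the empty word is the base point: the direction in which a vertex sees
  itself. It lies below all letters because the generators are numbered from 1.\<close>

fun fpos :: "nat word \<Rightarrow> nat" where
  "fpos [] = 0"
| "fpos (z # w) = pos z"

definition cyc3 :: "nat \<Rightarrow> nat \<Rightarrow> nat \<Rightarrow> bool" where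
  "cyc3 p q r \<longleftrightarrow> p < q \<and> q < r \<or> q < r \<and> r < p \<or> r < p \<and> p < q"

lemma fpos_hd: "w \<noteq> [] \<Longrightarrow> fpos w = pos (hd w)"
  by (cases w) auto

lemma fpos_append: "v \<noteq> [] \<Longrightarrow> fpos (v @ w) = fpos v"
  by (cases v) auto

lemma fpos_butlast: "fpos (butlast w) = fpos w \<or> fpos (butlast w) = 0"
  by (cases w) auto

context braids
begin

lemma pos_inj:
  "z \<in> {1..n} \<times> {1, -1} \<Longrightarrow> y \<in> {1..n} \<times> {1, -1} \<Longrightarrow> pos z = pos y \<longleftrightarrow> z = y"
  by (cases z; cases y) (auto; presburger)

lemma pos_pos: "z \<in> {1..n} \<times> {1, -1} \<Longrightarrow> 0 < pos z"
  by (cases z) auto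

lemma carrier_hd: "w \<in> carrier F \<Longrightarrow> w \<noteq> [] \<Longrightarrow> hd w \<in> {1..n} \<times> {1, -1}"
  by (cases w) (auto simp: F_carrier)

lemma fpos_eq_iff:
  assumes "w \<in> carrier F" "z \<in> {1..n} \<times> {1, -1}"
  shows "fpos w = pos z \<longleftrightarrow> w \<noteq> [] \<and> hd w = z"
  using pos_inj[OF carrier_hd[OF assms(1)] assms(2)] pos_pos[OF assms(2)] fpos_hd[of w]
  by (cases "w = []") auto

lemma fpos_eq_0: "w \<in> carrier F \<Longrightarrow> fpos w = 0 \<longleftrightarrow> w = []"
  using pos_pos[OF carrier_hd] fpos_hd[of w] by (cases "w = []") auto

lemma bar_letter: "z \<in> {1..n} \<times> {1, -1} \<Longrightarrow> bar z \<in> {1..n} \<times> {1, -1}"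
  by (cases z) auto

lemma F_mult_letter:
  assumes "[z] \<in> carrier F" "w \<in> carrier F"
  shows "[z] \<cdot> w = (if fpos w = pos (bar z) then tl w else z # w)"
proof -
  have "fpos w = pos (bar z) \<longleftrightarrow> w \<noteq> [] \<and> hd w = bar z"
    using assms by (intro fpos_eq_iff bar_letter) (auto simp: F_letter)
  then show ?thesis by (cases w) (auto simp: F_mult rcons_bar)
qed

lemma last_letter: "w \<in> carrier F \<Longrightarrow> w \<noteq> [] \<Longrightarrow> last w \<in> {1..n} \<times> {1, -1}"
  using last_in_set[of w] by (auto simp: F_carrier)

lemma fpos_mult:
  assumes "m \<in> carrier F" "g \<in> carrier F" "m \<noteq> []" "fpos g \<noteq> pos (bar (last m))"
  shows "fpos (m \<cdot> g) = fpos m"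
proof -
  have "g = [] \<or> hd g \<noteq> bar (last m)"
    using fpos_eq_iff[OF assms(2) bar_letter[OF last_letter[OF assms(1,3)]]] assms(4) by blast
  then have "m \<cdot> g = m @ g"
    using assms by (intro F_append) (auto simp: reduced_append F_carrier)
  then show ?thesis using assms(3) by (simp add: fpos_append)
qed

lemma F_tl: "w \<in> carrier F \<Longrightarrow> tl w \<in> carrier F"
  by (cases w) (auto dest: F_ConsD)

lemma fpos_tl:
  assumes "w \<in> carrier F" "w \<noteq> []"
  shows "fpos (tl w) \<noteq> pos (bar (hd w))"
  using fpos_eq_iff[OF F_tl[OF assms(1)] bar_letter[OF carrier_hd[OF assms]]] assms
  by (cases w) (auto simp: F_carrier reduced_Cons)

text \<open>The observing vertex is m^-1: the first letter of \<open>m \<cdot> g\<close> is the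
  first edge on the path from m^-1 to g. Quantifying over m makes the relation
  left-invariant.\<close>

definition cyc :: "nat word \<Rightarrow> nat word \<Rightarrow> nat word \<Rightarrow> bool" where
  "cyc g h k \<longleftrightarrow> (\<exists>m\<in>carrier F. cyc3 (fpos (m \<cdot> g)) (fpos (m \<cdot> h)) (fpos (m \<cdot> k)))"

lemma cycI: "g \<in> carrier F \<Longrightarrow> h \<in> carrier F \<Longrightarrow> k \<in> carrier F \<Longrightarrow>
    cyc3 (fpos g) (fpos h) (fpos k) \<Longrightarrow> cyc g h k"
  unfolding cyc_def by (rule bexI[of _ "\<one>\<^bsub>F\<^esub>"]) auto

lemma cyc_left:
  assumes "a \<in> carrier F" "g \<in> carrier F" "h \<in> carrier F" "k \<in> carrier F"
  shows "cyc (a \<cdot> g) (a \<cdot> h) (a \<cdot> k) \<longleftrightarrow> cyc g h k"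
proof
  assume "cyc (a \<cdot> g) (a \<cdot> h) (a \<cdot> k)"
  then obtain m where "m \<in> carrier F"
    "cyc3 (fpos (m \<cdot> (a \<cdot> g))) (fpos (m \<cdot> (a \<cdot> h))) (fpos (m \<cdot> (a \<cdot> k)))"
    by (auto simp: cyc_def)
  then show "cyc g h k"
    using assms unfolding cyc_def by (intro bexI[of _ "m \<cdot> a"]) (auto simp: F.m_assoc)
next
  assume "cyc g h k"
  then obtain m where "m \<in> carrier F" "cyc3 (fpos (m \<cdot> g)) (fpos (m \<cdot> h)) (fpos (m \<cdot> k))"
    by (auto simp: cyc_def)
  then show "cyc (a \<cdot> g) (a \<cdot> h) (a \<cdot> k)"
    using assms unfolding cyc_def
    by (intro bexI[of _ "m \<cdot> finv a"]) (auto simp: F.m_assoc F_cancel)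
qed

text \<open>Seen from m^-1, an element x lies in the direction of 1 unless x begins with the inverse
  of the last letter of m. At most one of three elements with different first positions does so; the
  other two are seen in the same direction.\<close>

lemma median_unique:
  assumes "m \<in> carrier F" "m \<noteq> []" "g \<in> carrier F" "h \<in> carrier F" "k \<in> carrier F"
    and "distinct [fpos g, fpos h, fpos k]"
  shows "\<not> distinct [fpos (m \<cdot> g), fpos (m \<cdot> h), fpos (m \<cdot> k)]"
proof -
  have "fpos (m \<cdot> x) = fpos m \<or> fpos x = pos (bar (last m))" if "x \<in> carrier F" for x
    using fpos_mult[OF assms(1) that assms(2)] by blast
  then show ?thesis using assms(3-6) by (metis distinct_length_2_or_more)
qed

lemma cyc_antisym:
  assumes "cyc g h k" "g \<in> carrier F" "h \<in> carrier F" "k \<in> carrier F"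
  shows "\<not> cyc k h g"
proof
  assume "cyc k h g"
  then obtain m where m: "m \<in> carrier F" "cyc3 (fpos (m \<cdot> k)) (fpos (m \<cdot> h)) (fpos (m \<cdot> g))"
    by (auto simp: cyc_def)
  obtain l where l: "l \<in> carrier F" "cyc3 (fpos (l \<cdot> g)) (fpos (l \<cdot> h)) (fpos (l \<cdot> k))"
    using assms(1) by (auto simp: cyc_def)
  let ?d = "m \<cdot> finv l"
  have d: "?d \<cdot> (l \<cdot> x) = m \<cdot> x" if "x \<in> carrier F" for x
    using m l that by (simp add: F.m_assoc F_cancel)
  show False
  proof (cases "?d = []")
    case True
    then have "m = l" using m(1) l(1) by (metis F.inv_equality F.inv_inv F.inv_closed F_one)
    then show False using m l by (auto simp: cyc3_def)
  next
    case False
    have "distinct [fpos (l \<cdot> g), fpos (l \<cdot> h), fpos (l \<cdot> k)]"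
      using l(2) by (auto simp: cyc3_def)
    then have "\<not> distinct [fpos (m \<cdot> g), fpos (m \<cdot> h), fpos (m \<cdot> k)]"
      using median_unique[of ?d "l \<cdot> g" "l \<cdot> h" "l \<cdot> k"] False assms(2-) m(1) l(1)
      by (simp add: d)
    then show False using m(2) by (auto simp: cyc3_def)
  qed
qed

text \<open>Three distinct elements have a median. After translating g to 1 it is the longest common
  prefix p of the other two, and the three directions at p differ; an element that is itself the
  median is seen there at position 0.\<close>

lemma cyc_total:
  assumes "g \<in> carrier F" "h \<in> carrier F" "k \<in> carrier F" "distinct [g, h, k]"
  shows "cyc g h k \<or> cyc k h g"
proof -
  let ?a = "finv g \<cdot> h" and ?b = "finv g \<cdot> k"
  have ab: "?a \<in> carrier F" "?b \<in> carrier F" using assms by auto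
  have hk: "h = g \<cdot> ?a" "k = g \<cdot> ?b" using assms by (simp_all add: F_cancel)
  have "g \<cdot> [] = g" using F.r_one[OF assms(1)] by (simp add: F_one)
  then have ne: "?a \<noteq> ?b" "?a \<noteq> []" "?b \<noteq> []" using assms(4) hk by force+
  obtain p a b where pab: "?a = p @ a" "?b = p @ b" "a = [] \<or> b = [] \<or> hd a \<noteq> hd b"
    using longest_common_prefix[of ?a ?b] by blast
  note A = F_appendD[of p a, folded pab(1), OF ab(1)] and B = F_appendD[of p b, folded pab(2), OF ab(2)]
  let ?m = "finv p \<cdot> finv g"
  have h: "?m \<cdot> h = a" and k: "?m \<cdot> k = b" and g: "?m \<cdot> g = finv p"
    using A B assms F_cancel(2)[OF A(1,2)] F_cancel(2)[OF B(1,2)] by (simp_all add: F.m_assoc)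
  have "fpos a \<noteq> fpos b"
    using pab ne(1) A(2) B(2) fpos_eq_iff[OF B(2) carrier_hd[OF A(2)]] fpos_hd[of a] fpos_eq_0[OF A(2)]
      fpos_eq_0[OF B(2)] by (metis fpos.simps(1))
  moreover have "fpos (finv p) \<noteq> fpos x" if x: "y = p @ x" "y \<noteq> []" "y \<in> carrier F" for x y
  proof (cases "p = []")
    case True
    then show ?thesis
      using x fpos_eq_0[of x] F.inv_one by (simp add: F_one)
  next
    case False
    have "hd x \<noteq> bar (last p)" if "x \<noteq> []"
      using x False that by (auto simp: F_carrier reduced_append)
    then have "fpos x \<noteq> pos (bar (last p))"
      using fpos_eq_iff[OF _ bar_letter[OF last_letter[OF A(1) False]]] x F_appendD[of p x] by blast
    moreover have "fpos (finv p) = pos (bar (last p))"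
      using F_inv[OF A(1)] False by (subst fpos_hd) (auto simp: hd_rev last_map)
    ultimately show ?thesis by metis
  qed
  ultimately have "distinct [fpos (?m \<cdot> g), fpos (?m \<cdot> h), fpos (?m \<cdot> k)]"
    unfolding g h k using pab(1,2) ne ab by auto
  then have "cyc3 (fpos (?m \<cdot> g)) (fpos (?m \<cdot> h)) (fpos (?m \<cdot> k)) \<or>
             cyc3 (fpos (?m \<cdot> k)) (fpos (?m \<cdot> h)) (fpos (?m \<cdot> g))"
    unfolding cyc3_def by auto
  moreover have "?m \<in> carrier F" using A assms by auto
  ultimately show ?thesis unfolding cyc_def by blast
qed

subsection \<open>Invariance under braids\<close>

text \<open>The second letter is tracked for the sake of the induction: it decides what remains
  after v_i cancels. An image starts with v_i^-1, v_{i+1} or v_{i+1}^-1 only if the word starts with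
  v_{i+1}^-1.\<close>

lemma sigma_first_letters:
  assumes i: "i \<in> {1..<n}" and w: "w \<in> carrier F"
  defines "s \<equiv> artin n (sigma n i) w"
  shows "(fpos w = 2 * i \<longrightarrow> fpos s = 2 * i \<and> fpos (tl s) = 2 * i + 2) \<and>
    (fpos w = 2 * i + 1 \<longrightarrow> fpos s = 2 * i \<and> fpos (tl s) = 2 * i + 3) \<and>
    (fpos w = 2 * i + 2 \<longrightarrow> fpos s = 2 * i \<and> fpos (tl s) \<notin> {2 * i + 1, 2 * i + 2, 2 * i + 3}) \<and>
    (fpos w = 2 * i + 3 \<longrightarrow> fpos s \<in> {2 * i + 1, 2 * i + 2, 2 * i + 3}) \<and>
    (fpos w \<notin> {2 * i, 2 * i + 1, 2 * i + 2, 2 * i + 3} \<longrightarrow> fpos s = fpos w)"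
  using w unfolding s_def
proof (induction w)
  case Nil
  then show ?case using i sigma_closed[OF i] by simp
next
  case (Cons z w)
  let ?\<sigma> = "artin n (sigma n i)"
  have zw: "[z] \<in> carrier F" "w \<in> carrier F" using Cons.prems F_ConsD by auto
  have \<sigma>w: "?\<sigma> w \<in> carrier F" using zw sigma_closed[OF i] by (simp add: artin_closed)
  have eq: "?\<sigma> (z # w) = ?\<sigma> [z] \<cdot> ?\<sigma> w"
    using F_Cons[OF Cons.prems] artin_F_mult[OF sigma_closed[OF i] zw] by simp
  have let1: "[(i, 1)] \<in> carrier F" "[(i, -1)] \<in> carrier F"
    "[(i + 1, 1)] \<in> carrier F" "[(i + 1, -1)] \<in> carrier F"
    using i by (auto simp: F_letter)
  have tlw: "fpos (?\<sigma> w) = 2 * i \<Longrightarrow> fpos (tl (?\<sigma> w)) \<noteq> 2 * i + 1"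
    using fpos_tl[OF \<sigma>w] fpos_eq_iff[OF \<sigma>w, of "(i, 1)"] i by auto
  have zc: "fpos w \<noteq> pos (bar z)"
    using fpos_tl[OF Cons.prems] by simp
  note IH = Cons.IH[OF zw(2)]
  note ml = F_mult_letter[OF let1(1)] F_mult_letter[OF let1(2)] F_mult_letter[OF let1(3)] F_mult_letter[OF let1(4)]
  have inv: "?\<sigma> [(k, -1)] = finv (?\<sigma> [(k, 1)])" if "k \<in> {1..n}" for k
    using that artin_F_inv[OF sigma_closed[OF i], of "[(k, 1)]"] F_inv_letter[of "(k, 1)"]
    by (simp add: F_letter)
  have gen: "?\<sigma> [(i, 1)] = [(i, 1)] \<cdot> ([(i + 1, 1)] \<cdot> [(i, -1)])" "?\<sigma> [(i + 1, 1)] = [(i, 1)]"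
    using artin_sigma[OF i, of i] artin_sigma[OF i, of "i + 1"] i let1 F_inv_letter[OF let1(1)]
    by (auto simp: artin_img_def free_gen_def F.m_assoc)
  have gen': "?\<sigma> [(i, -1)] = [(i, 1)] \<cdot> ([(i + 1, -1)] \<cdot> [(i, -1)])" "?\<sigma> [(i + 1, -1)] = [(i, -1)]"
    using inv[of i] inv[of "i + 1"] gen let1 i F_inv_letter[OF let1(1)] F_inv_letter[OF let1(2)]
      F_inv_letter[OF let1(3)] by (simp_all add: F.inv_mult_group F.m_assoc)
  obtain k e where z: "z = (k, e)" "k \<in> {1..n}" "e \<in> {1, -1}"
    using zw(1) by (cases z) (auto simp: F_letter)
  consider "z = (i, 1)" | "z = (i, -1)" | "z = (i + 1, 1)" | "z = (i + 1, -1)"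
    | "k \<noteq> i" "k \<noteq> i + 1" using z by auto
  then show ?case
  proof cases
    case 1
    let ?x = "[(i, -1)] \<cdot> ?\<sigma> w"
    have x: "?x \<in> carrier F" using let1 \<sigma>w by simp
    have "?\<sigma> (z # w) = [(i, 1)] \<cdot> ([(i + 1, 1)] \<cdot> ?x)"
      using eq gen let1 \<sigma>w by (simp add: 1 F.m_assoc)
    moreover have "fpos ?x \<noteq> 2 * i + 3"
      using IH zc by (auto simp: ml[OF \<sigma>w] 1)
    then have "[(i + 1, 1)] \<cdot> ?x = (i + 1, 1) # ?x" by (subst ml(3)[OF x]) simp
    moreover have "[(i, 1)] \<cdot> ((i + 1, 1) # ?x) = (i, 1) # (i + 1, 1) # ?x"
      using calculation(2) let1 x ml(1)[of "(i + 1, 1) # ?x"] F.m_closed[OF let1(3) x] by simp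
    ultimately show ?thesis by (simp add: 1)
  next
    case 2
    let ?x = "[(i, -1)] \<cdot> ?\<sigma> w"
    have x: "?x \<in> carrier F" using let1 \<sigma>w by simp
    have "?\<sigma> (z # w) = [(i, 1)] \<cdot> ([(i + 1, -1)] \<cdot> ?x)"
      using eq gen' let1 \<sigma>w by (simp add: 2 F.m_assoc)
    moreover have "fpos ?x \<noteq> 2 * i + 2"
      using IH zc by (auto simp: ml[OF \<sigma>w] 2)
    then have "[(i + 1, -1)] \<cdot> ?x = (i + 1, -1) # ?x" by (subst ml(4)[OF x]) simp
    moreover have "[(i, 1)] \<cdot> ((i + 1, -1) # ?x) = (i, 1) # (i + 1, -1) # ?x"
      using calculation(2) let1 x ml(1)[of "(i + 1, -1) # ?x"] F.m_closed[OF let1(4) x] by simp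
    ultimately show ?thesis by (simp add: 2)
  next
    case 3
    have "?\<sigma> (z # w) = [(i, 1)] \<cdot> ?\<sigma> w" using eq gen by (simp add: 3)
    moreover have c: "fpos (?\<sigma> w) \<notin> {2 * i + 1, 2 * i + 2, 2 * i + 3}" using IH zc by (auto simp: 3)
    then have "[(i, 1)] \<cdot> ?\<sigma> w = (i, 1) # ?\<sigma> w" by (simp add: ml[OF \<sigma>w])
    ultimately show ?thesis using c by (simp add: 3)
  next
    case 4
    have "?\<sigma> (z # w) = [(i, -1)] \<cdot> ?\<sigma> w" using eq gen' by (simp add: 4)
    then show ?thesis using IH zc by (auto simp: 4 ml[OF \<sigma>w])
  next
    case 5
    have "?\<sigma> [(k, 1)] = [(k, 1)]"
      using artin_sigma[OF i z(2)] 5 by (simp add: artin_img_def free_gen_def)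
    then have "?\<sigma> [z] = [z]"
      using z inv[OF z(2)] F_inv_letter[of "(k, 1)"] by (auto simp: F_letter)
    then have eq5: "?\<sigma> (z # w) = [z] \<cdot> ?\<sigma> w" using eq by simp
    have "pos (bar z) \<notin> {2 * i, 2 * i + 1, 2 * i + 2, 2 * i + 3}"
      "pos z \<notin> {2 * i, 2 * i + 1, 2 * i + 2, 2 * i + 3}"
      using 5 z by (auto; presburger)+
    note p = this
    have "fpos (?\<sigma> w) \<in> {2 * i, 2 * i + 1, 2 * i + 2, 2 * i + 3} \<or> fpos (?\<sigma> w) = fpos w"
      using IH by blast
    then have "fpos (?\<sigma> w) \<noteq> pos (bar z)" using zc p(1) by metis
    then have "?\<sigma> (z # w) = z # ?\<sigma> w"
      unfolding eq5 by (simp add: F_mult_letter[OF zw(1) \<sigma>w])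
    then show ?thesis using p(2) by simp
  qed
qed

text \<open>Here \<open>c\<close>, \<open>a\<close> and \<open>b\<close> are the positions of \<open>w\<close>, \<open>\<sigma>\<^sub>i w\<close> and \<open>v\<^sub>i\<^sup>-\<^sup>1 (\<sigma>\<^sub>i w)\<close>.\<close>

definition sigma_shape :: "nat \<Rightarrow> nat \<Rightarrow> nat \<Rightarrow> nat \<Rightarrow> bool" where
  "sigma_shape i c a b \<longleftrightarrow> (c = 2 * i \<and> a = 2 * i \<and> b = 2 * i + 2) \<or>
    (c = 2 * i + 1 \<and> a = 2 * i \<and> b = 2 * i + 3) \<or>
    (c = 2 * i + 2 \<and> a = 2 * i \<and> (b < 2 * i + 1 \<or> 2 * i + 3 < b)) \<or>
    (c = 2 * i + 3 \<and> 2 * i < a \<and> a < 2 * i + 4 \<and> b = 2 * i + 1) \<or>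
    ((c < 2 * i \<or> 2 * i + 3 < c) \<and> a = c \<and> b = 2 * i + 1)"

text \<open>Words starting with v_i, v_i^-1 or v_{i+1} all have images starting with v_i. If at
  least two of the three words are of this kind, their order shows from the vertex v_i; otherwise it
  still shows from 1. Thus the median moves by at most one edge.\<close>

lemma sigma_shape_less:
  assumes "p < q" "q < r" "sigma_shape i p p1 p2" "sigma_shape i q q1 q2" "sigma_shape i r r1 r2"
  shows "cyc3 p1 q1 r1 \<or> cyc3 p2 q2 r2"
  using assms unfolding sigma_shape_def cyc3_def
  by (elim disjE conjE) (simp; fail | linarith)+

lemma cyc3_sigma:
  assumes "cyc3 p q r" "sigma_shape i p p1 p2" "sigma_shape i q q1 q2" "sigma_shape i r r1 r2"
  shows "cyc3 p1 q1 r1 \<or> cyc3 p2 q2 r2"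
proof -
  have rot: "cyc3 p q r \<longleftrightarrow> cyc3 q r p" for p q r by (auto simp: cyc3_def)
  consider "p < q" "q < r" | "q < r" "r < p" | "r < p" "p < q"
    using assms(1) by (auto simp: cyc3_def)
  then show ?thesis
    by cases (use sigma_shape_less assms(2-4) rot in metis)+
qed

lemma cyc_sigma:
  assumes i: "i \<in> {1..<n}" and w: "g \<in> carrier F" "h \<in> carrier F" "k \<in> carrier F"
    and c: "cyc g h k"
  shows "cyc (artin n (sigma n i) g) (artin n (sigma n i) h) (artin n (sigma n i) k)"
proof -
  let ?\<sigma> = "artin n (sigma n i)"
  have \<sigma>: "?\<sigma> x \<in> carrier F" if "x \<in> carrier F" for x
    using artin_closed[OF sigma_closed[OF i] that] .
  obtain m where m: "m \<in> carrier F" and c3: "cyc3 (fpos (m \<cdot> g)) (fpos (m \<cdot> h)) (fpos (m \<cdot> k))"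
    using c by (auto simp: cyc_def)
  have ai: "[(i, -1)] \<in> carrier F" using i by (simp add: F_letter)
  have shape: "sigma_shape i (fpos w) (fpos (?\<sigma> w)) (fpos ([(i, -1)] \<cdot> ?\<sigma> w))"
    if w: "w \<in> carrier F" for w
  proof -
    note L = sigma_first_letters[OF i w] and ml = F_mult_letter[OF ai \<sigma>[OF w]]
    consider "fpos w = 2 * i" | "fpos w = 2 * i + 1" | "fpos w = 2 * i + 2" | "fpos w = 2 * i + 3"
      | "fpos w < 2 * i \<or> 2 * i + 3 < fpos w" by linarith
    then show ?thesis
    proof cases
      case 3
      then have "fpos (?\<sigma> w) = 2 * i"
        "fpos (tl (?\<sigma> w)) \<noteq> 2 * i + 1" "fpos (tl (?\<sigma> w)) \<noteq> 2 * i + 2" "fpos (tl (?\<sigma> w)) \<noteq> 2 * i + 3"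
        using L by blast+
      then have "fpos (tl (?\<sigma> w)) < 2 * i + 1 \<or> 2 * i + 3 < fpos (tl (?\<sigma> w))" by linarith
      then show ?thesis using 3 \<open>fpos (?\<sigma> w) = 2 * i\<close> unfolding sigma_shape_def ml by simp
    next
      case 4
      then have "fpos (?\<sigma> w) \<in> {2 * i + 1, 2 * i + 2, 2 * i + 3}" using L by blast
      then have "2 * i < fpos (?\<sigma> w)" "fpos (?\<sigma> w) < 2 * i + 4" by auto
      then show ?thesis using 4 unfolding sigma_shape_def ml by simp
    next
      case 5
      then have "fpos w \<notin> {2 * i, 2 * i + 1, 2 * i + 2, 2 * i + 3}" by auto
      then have "fpos (?\<sigma> w) = fpos w" using L by blast
      then show ?thesis using 5 unfolding sigma_shape_def ml by auto
    qed (use L in \<open>simp_all add: sigma_shape_def ml\<close>)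
  qed
  have mw: "m \<cdot> g \<in> carrier F" "m \<cdot> h \<in> carrier F" "m \<cdot> k \<in> carrier F" using m w by auto
  have "cyc (?\<sigma> (m \<cdot> g)) (?\<sigma> (m \<cdot> h)) (?\<sigma> (m \<cdot> k))"
    using cyc3_sigma[OF c3 shape[OF mw(1)] shape[OF mw(2)] shape[OF mw(3)]]
  proof
    assume "cyc3 (fpos (?\<sigma> (m \<cdot> g))) (fpos (?\<sigma> (m \<cdot> h))) (fpos (?\<sigma> (m \<cdot> k)))"
    then show ?thesis by (intro cycI \<sigma> mw)
  qed (use ai in \<open>auto simp: cyc_def\<close>)
  then show ?thesis
    using cyc_left[OF \<sigma>[OF m] \<sigma>[OF w(1)] \<sigma>[OF w(2)] \<sigma>[OF w(3)]] w m
    by (simp add: artin_F_mult[OF sigma_closed[OF i]])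
qed

text \<open>The equivalence is what passes to inverse braids. For a generator, the converse follows
  from totality and antisymmetry.\<close>

lemma cyc_artin:
  assumes "c \<in> carrier B" "g \<in> carrier F" "h \<in> carrier F" "k \<in> carrier F"
  shows "cyc (artin n c g) (artin n c h) (artin n c k) \<longleftrightarrow> cyc g h k"
  using assms
proof (induction arbitrary: g h k rule: braid_induct)
  case one
  then show ?case by (simp add: artin_one)
next
  case (sigma i)
  let ?\<sigma> = "artin n (sigma n i)"
  have \<sigma>: "?\<sigma> x \<in> carrier F" if "x \<in> carrier F" for x
    using artin_closed[OF sigma_closed[OF sigma(1)] that] .
  show ?case
  proof
    assume c: "cyc (?\<sigma> g) (?\<sigma> h) (?\<sigma> k)"
    have "distinct [g, h, k]" using c by (auto simp: cyc_def cyc3_def)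
    then have "cyc g h k \<or> cyc k h g" using cyc_total sigma by blast
    then show "cyc g h k"
      using cyc_sigma[OF sigma(1,4,3,2)] cyc_antisym[OF c \<sigma> \<sigma> \<sigma>] sigma by blast
  qed (use cyc_sigma sigma in blast)
next
  case (inv c)
  then show ?case
    using inv.IH[of "artin n (binv c) g" "artin n (binv c) h" "artin n (binv c) k"]
    by (simp add: artin_closed artin_inv)
next
  case (mult c d)
  then show ?case by (simp add: artin_mult artin_closed)
qed

subsection \<open>Unlinked chords\<close>

lemma mult_gen:
  assumes "h \<in> carrier F" "l \<in> {1..n}"
  shows "h \<cdot> [(l, 1)] = h @ [(l, 1)] \<or> h \<noteq> [] \<and> h \<cdot> [(l, 1)] = butlast h"
proof (cases "h \<noteq> [] \<and> last h = (l, -1)")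
  case True
  then have h: "h = butlast h @ [(l, -1)]" by (metis append_butlast_last_id)
  then have "h = butlast h \<cdot> [(l, -1)]" "butlast h \<in> carrier F"
    using F_appendD[of "butlast h" "[(l, -1)]"] assms(1) by metis+
  then have "h \<cdot> [(l, 1)] = butlast h \<cdot> ([(l, -1)] \<cdot> [(l, 1)])"
    using assms F.m_assoc[of "butlast h" "[(l, -1)]" "[(l, 1)]"] by (simp add: F_letter)
  also have "[(l, -1)] \<cdot> [(l, 1)] = \<one>\<^bsub>F\<^esub>" by (simp add: F_mult F_one)
  finally show ?thesis using True \<open>butlast h \<in> carrier F\<close> by simp
next
  case False
  then have "h = [] \<or> bar (last h) \<noteq> (l, 1)" by (auto simp: bar_eq_iff)
  then have "h \<cdot> [(l, 1)] = h @ [(l, 1)]"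
    using assms by (intro F_append) (auto simp: reduced_append F_carrier)
  then show ?thesis by blast
qed

lemma fpos_mult_gen:
  assumes "h \<in> carrier F" "l \<in> {1..n}" "h \<noteq> []"
  shows "fpos (h \<cdot> [(l, 1)]) = fpos h \<or> fpos (h \<cdot> [(l, 1)]) = 0"
  using mult_gen[OF assms(1,2)] assms(3) fpos_butlast[of h] by (auto simp: fpos_append)

text \<open>The vertex is m^-1, so the conclusion names the two ends of the edge from 1 to v_k. From
  every other vertex both ends are seen in the same direction.\<close>

lemma median_gen:
  assumes k: "k \<in> {1..n}" and m: "m \<in> carrier F" "fpos m \<noteq> fpos (m \<cdot> [(k, 1)])"
  shows "m = [] \<or> m = [(k, -1)]"
  using mult_gen[OF m(1) k]
proof
  assume "m \<cdot> [(k, 1)] = m @ [(k, 1)]"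
  then show ?thesis using m(2) by (cases "m = []") (auto simp: fpos_append)
next
  assume b: "m \<noteq> [] \<and> m \<cdot> [(k, 1)] = butlast m"
  then have e: "butlast m = []" using m(2) fpos_append[of "butlast m" "[last m]"] by force
  then obtain z where z: "m = [z]" using b by (cases m) (auto split: if_splits)
  then have "\<one>\<^bsub>F\<^esub> = [z] \<cdot> [(k, 1)]" using b by (simp add: F_one)
  then have "[z] = finv [(k, 1)]"
    using F.inv_equality[of "[z]" "[(k, 1)]"] m(1) k by (simp add: z F_letter)
  then show ?thesis using k F_inv_letter[of "(k, 1)"] by (simp add: z F_letter)
qed

lemma fpos_inv_gen:
  assumes "k \<in> {1..n}" "h \<in> carrier F"
  shows "(fpos h \<noteq> 2 * k \<and> fpos ([(k, -1)] \<cdot> h) = 2 * k + 1) \<or>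
    (\<exists>h'. h = (k, 1) # h' \<and> fpos ([(k, -1)] \<cdot> h) = fpos h')"
proof -
  have "[(k, -1)] \<in> carrier F" using assms(1) by (simp add: F_letter)
  note ml = F_mult_letter[OF this assms(2)]
  show ?thesis
  proof (cases "fpos h = 2 * k")
    case True
    then have "h \<noteq> []" "hd h = (k, 1)" using fpos_eq_iff[OF assms(2), of "(k, 1)"] assms(1) by auto
    then have "h = (k, 1) # tl h" by (metis list.collapse)
    then show ?thesis using True ml by auto
  qed (use ml in auto)
qed

text \<open>The alternatives correspond to the ends 1 and v_k as observing vertices. Seen from v_k,
  that end has position 0 and the edge back to 1 has position 2k + 1.\<close>

lemma cyc_before_gen:
  assumes k: "k \<in> {1..n}" and h: "h \<in> carrier F" and c: "cyc [] h [(k, 1)]"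
  shows "(0 < fpos h \<and> fpos h < 2 * k) \<or> (\<exists>h'. h = (k, 1) # h' \<and> 2 * k + 1 < fpos h')"
proof -
  obtain m where m: "m \<in> carrier F" "cyc3 (fpos (m \<cdot> [])) (fpos (m \<cdot> h)) (fpos (m \<cdot> [(k, 1)]))"
    using c by (auto simp: cyc_def)
  moreover have "m \<cdot> [] = m" using F.r_one[OF m(1)] by (simp add: F_one)
  moreover from calculation have "m = [] \<or> m = [(k, -1)]"
    using median_gen[OF k m(1)] by (auto simp: cyc3_def)
  moreover have "[(k, -1)] \<cdot> [(k, 1)] = []" by (simp add: F_mult)
  moreover have "[] \<cdot> h = h" "[] \<cdot> [(k, 1)] = [(k, 1)]"
    using F.l_one[OF h] by (simp_all add: F_one F_mult)
  ultimately show ?thesis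
    using fpos_inv_gen[OF k h] by (auto simp: cyc3_def)
qed

lemma cyc_after_gen:
  assumes k: "k \<in> {1..n}" and h: "h \<in> carrier F" and c: "cyc [(k, 1)] h []"
  shows "2 * k < fpos h \<or> (\<exists>h'. h = (k, 1) # h' \<and> 0 < fpos h' \<and> fpos h' < 2 * k + 1)"
proof -
  obtain m where m: "m \<in> carrier F" "cyc3 (fpos (m \<cdot> [(k, 1)])) (fpos (m \<cdot> h)) (fpos (m \<cdot> []))"
    using c by (auto simp: cyc_def)
  moreover have "m \<cdot> [] = m" using F.r_one[OF m(1)] by (simp add: F_one)
  moreover from calculation have "m = [] \<or> m = [(k, -1)]"
    using median_gen[OF k m(1)] by (auto simp: cyc3_def)
  moreover have "[(k, -1)] \<cdot> [(k, 1)] = []" by (simp add: F_mult)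
  moreover have "[] \<cdot> h = h" "[] \<cdot> [(k, 1)] = [(k, 1)]"
    using F.l_one[OF h] by (simp_all add: F_one F_mult)
  ultimately show ?thesis
    using fpos_inv_gen[OF k h] by (auto simp: cyc3_def)
qed

text \<open>Right multiplication by a generator changes only the end of h. Hence h and h v_l leave
  the vertex 1, or v_k, by the same half-edge, unless one of them is that vertex itself, which lies
  strictly on neither side.\<close>

lemma unlinked_base:
  assumes kl: "k \<in> {1..n}" "l \<in> {1..n}" and h: "h \<in> carrier F"
  shows "\<not> (cyc [] h [(k, 1)] \<and> cyc [(k, 1)] (h \<cdot> [(l, 1)]) [])"
    and "\<not> (cyc [] (h \<cdot> [(l, 1)]) [(k, 1)] \<and> cyc [(k, 1)] h [])"
proof -
  have hl: "h \<cdot> [(l, 1)] \<in> carrier F" using kl h by (simp add: F_letter)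
  have tail: "fpos g' = fpos h' \<or> fpos g' = 0"
    if "h = (k, 1) # h'" "fpos h' \<noteq> 0" "h \<cdot> [(l, 1)] = (k, 1) # g'" for g' h'
  proof -
    have "h' \<noteq> []" using that(2) by auto
    then show ?thesis
      using mult_gen[OF h kl(2)] that fpos_butlast[of h'] fpos_append[of h' "[(l, 1)]"] by auto
  qed
  note fh = fpos_mult_gen[OF h kl(2)]
  show "\<not> (cyc [] h [(k, 1)] \<and> cyc [(k, 1)] (h \<cdot> [(l, 1)]) [])"
  proof (rule notI, elim conjE)
    assume c: "cyc [] h [(k, 1)]" "cyc [(k, 1)] (h \<cdot> [(l, 1)]) []"
    have "h \<noteq> []" using cyc_before_gen[OF kl(1) h c(1)] by auto
    note f = fh[OF this]
    show False using cyc_before_gen[OF kl(1) h c(1)]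
    proof (elim disjE exE conjE)
      assume "0 < fpos h" "fpos h < 2 * k"
      then show False using cyc_after_gen[OF kl(1) hl c(2)] f by fastforce
    next
      fix h' assume h': "h = (k, 1) # h'" "2 * k + 1 < fpos h'"
      then have "fpos h' \<noteq> 0" "fpos h = 2 * k" by simp_all
      then show False using cyc_after_gen[OF kl(1) hl c(2)] f tail[OF h'(1)] h'(2) by fastforce
    qed
  qed
  show "\<not> (cyc [] (h \<cdot> [(l, 1)]) [(k, 1)] \<and> cyc [(k, 1)] h [])"
  proof (rule notI, elim conjE)
    assume c: "cyc [] (h \<cdot> [(l, 1)]) [(k, 1)]" "cyc [(k, 1)] h []"
    have "h \<noteq> []" using cyc_after_gen[OF kl(1) h c(2)] by auto
    note f = fh[OF this]
    show False using cyc_after_gen[OF kl(1) h c(2)]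
    proof (elim disjE exE conjE)
      assume "2 * k < fpos h"
      then show False using cyc_before_gen[OF kl(1) hl c(1)] f kl(1) by fastforce
    next
      fix h' assume h': "h = (k, 1) # h'" "0 < fpos h'" "fpos h' < 2 * k + 1"
      then have "fpos h' \<noteq> 0" "fpos h = 2 * k" by simp_all
      then show False using cyc_before_gen[OF kl(1) hl c(1)] f tail[OF h'(1)] h'(3) by fastforce
    qed
  qed
qed

text \<open>Both chords are images under d of edges of the tree. Undoing d and a translation, which
  keep the cyclic order, leaves two edges, one of them from 1 to v_k.\<close>

lemma unlinked:
  assumes d: "d \<in> carrier B" and kl: "k \<in> {1..n}" "l \<in> {1..n}"
    and gh: "g \<in> carrier F" "h \<in> carrier F"
  defines "T \<equiv> \<lambda>k. artin n d (free_gen k)"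
  shows "\<not> (cyc g h (g \<cdot> T k) \<and> cyc (g \<cdot> T k) (h \<cdot> T l) g)"
    and "\<not> (cyc g (h \<cdot> T l) (g \<cdot> T k) \<and> cyc (g \<cdot> T k) h g)"
proof -
  define g0 h0 where "g0 = artin n (binv d) g" and "h0 = artin n (binv d) h"
  define f where "f = finv g0 \<cdot> h0"
  have c0: "g0 \<in> carrier F" "h0 \<in> carrier F" "f \<in> carrier F"
    using d gh by (simp_all add: g0_def h0_def f_def artin_closed)
  have v: "[(k, 1)] \<in> carrier F" "[(l, 1)] \<in> carrier F" using kl by (auto simp: F_letter)
  have gg: "g = artin n d (g0 \<cdot> [])" "h = artin n d (g0 \<cdot> f)"
    "g \<cdot> T k = artin n d (g0 \<cdot> [(k, 1)])" "h \<cdot> T l = artin n d (g0 \<cdot> (f \<cdot> [(l, 1)]))"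
    using d gh v c0 F.r_one[OF c0(1)]
    by (simp_all add: F_one artin_F_mult artin_inv g0_def h0_def f_def T_def free_gen_def F_cancel F.m_assoc
        artin_closed)
  have *: "cyc (artin n d (g0 \<cdot> x)) (artin n d (g0 \<cdot> y)) (artin n d (g0 \<cdot> z)) \<longleftrightarrow> cyc x y z"
    if "x \<in> carrier F" "y \<in> carrier F" "z \<in> carrier F" for x y z
    using that c0 d by (simp add: cyc_artin cyc_left)
  have fl: "f \<cdot> [(l, 1)] \<in> carrier F" using c0 v by simp
  show "\<not> (cyc g h (g \<cdot> T k) \<and> cyc (g \<cdot> T k) (h \<cdot> T l) g)"
    using unlinked_base(1)[OF kl c0(3)] unfolding gg(3,4) unfolding gg(1,2) by (simp only: * F_Nil_closed c0 v fl simp_thms)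
  show "\<not> (cyc g (h \<cdot> T l) (g \<cdot> T k) \<and> cyc (g \<cdot> T k) h g)"
    using unlinked_base(2)[OF kl c0(3)] unfolding gg(3,4) unfolding gg(1,2) by (simp only: * F_Nil_closed c0 v fl simp_thms)
qed

text \<open>With starting points p^-1 and p'^-1, the paths of the two words pass through 1 exactly
  at the cuts. If they crossed there, the order read from 1 would make the chords cross.\<close>

lemma unlinked_subwords:
  assumes d: "d \<in> carrier B" and kl: "k \<in> {1..n}" "l \<in> {1..n}"
    and k: "artin n d (free_gen k) = p @ q" and l: "artin n d (free_gen l) = p' @ q'"
  shows "\<not> (cyc3 (fpos (finv p)) (fpos (finv p')) (fpos q) \<and> cyc3 (fpos q) (fpos q') (fpos (finv p)))"
    and "\<not> (cyc3 (fpos (finv p)) (fpos q') (fpos q) \<and> cyc3 (fpos q) (fpos (finv p')) (fpos (finv p)))"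
proof -
  have "p @ q \<in> carrier F" "p' @ q' \<in> carrier F"
    using artin_closed[OF d gen_closed[OF kl(1)]] artin_closed[OF d gen_closed[OF kl(2)]] by (simp_all add: k l)
  note c = F_appendD[OF this(1)] F_appendD[OF this(2)]
  have q: "finv p \<cdot> (p @ q) = q" "finv p' \<cdot> (p' @ q') = q'"
    using c by (simp_all add: F_cancel)
  note u = unlinked[OF d kl, of "finv p" "finv p'", unfolded k l q]
  show "\<not> (cyc3 (fpos (finv p)) (fpos (finv p')) (fpos q) \<and> cyc3 (fpos q) (fpos q') (fpos (finv p)))"
    using u(1) c cycI by auto
  show "\<not> (cyc3 (fpos (finv p)) (fpos q') (fpos q) \<and> cyc3 (fpos q) (fpos (finv p')) (fpos (finv p)))"
    using u(2) c cycI by auto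
qed

end

section \<open>The band generators shorten the tuple\<close>

text \<open>One set of data for both signs: x, y are v_i^-1, v_j when f is the inverse of
  \<open>a_ij\<close>, and v_j, v_i^-1 when f is \<open>a_ij\<close>. The subword to be shortened is
  x^-1 y^-1 or its inverse y x. Either way the path uses the half-edges x and y^-1 at the vertex in
  the middle; \<open>lo\<close> and \<open>hi\<close> are their positions.\<close>

locale slide = braids +
  fixes f :: "nat word \<Rightarrow> nat word" and x y :: "nat \<times> int" and lo hi :: nat
  assumes f_hom: "f \<in> hom (free_n n) (free_n n)"
    and x_closed: "[x] \<in> carrier (free_n n)" and y_closed: "[y] \<in> carrier (free_n n)"
    and lo_pos: "0 < lo"
    and chord: "lo = pos x \<and> hi = pos (bar y) \<or> lo = pos (bar y) \<and> hi = pos x"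
    and y_inside: "lo < pos y" "pos y < hi"
    and x_outside: "\<not> (lo \<le> pos (bar x) \<and> pos (bar x) \<le> hi)"
    and f_x: "f [x] = inv\<^bsub>free_n n\<^esub> [y]"
    and f_y: "f [y] = inv\<^bsub>free_n n\<^esub> [y] \<otimes>\<^bsub>free_n n\<^esub> (inv\<^bsub>free_n n\<^esub> [x] \<otimes>\<^bsub>free_n n\<^esub> [y])"
    and f_inside: "[z] \<in> carrier (free_n n) \<Longrightarrow> z \<notin> {x, y, bar x, bar y} \<Longrightarrow> lo < pos z \<and> pos z < hi \<Longrightarrow>
      f [z] = inv\<^bsub>free_n n\<^esub> [y] \<otimes>\<^bsub>free_n n\<^esub> (inv\<^bsub>free_n n\<^esub> [x] \<otimes>\<^bsub>free_n n\<^esub>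
        ([z] \<otimes>\<^bsub>free_n n\<^esub> ([x] \<otimes>\<^bsub>free_n n\<^esub> [y])))"
    and f_outside: "[z] \<in> carrier (free_n n) \<Longrightarrow> z \<notin> {x, y, bar x, bar y} \<Longrightarrow>
      \<not> (lo < pos z \<and> pos z < hi) \<Longrightarrow> f [z] = [z]"
    and sides: "[z] \<in> carrier (free_n n) \<Longrightarrow> z \<notin> {x, y, bar x, bar y} \<Longrightarrow>
      (lo < pos z \<and> pos z < hi \<and> lo < pos (bar z) \<and> pos (bar z) < hi) \<or>
      (\<not> (lo \<le> pos z \<and> pos z \<le> hi) \<and> \<not> (lo \<le> pos (bar z) \<and> pos (bar z) \<le> hi))"
begin

abbreviation inside :: "nat \<Rightarrow> bool" where "inside r \<equiv> lo < r \<and> r < hi"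
abbreviation closed_inside :: "nat \<Rightarrow> bool" where "closed_inside r \<equiv> lo \<le> r \<and> r \<le> hi"

text \<open>The chord joining the half-edges \<open>x\<close> and \<open>y\<^sup>-\<^sup>1\<close> cuts off a region. Conjugating what lies in
  this region by \<open>xy\<close> turns the letterwise image under \<open>f\<close> into a word of the same length.\<close>

definition gauge :: "bool \<Rightarrow> nat word" where
  "gauge s = (if s then [x] \<cdot> [y] else \<one>\<^bsub>F\<^esub>)"

text \<open>A half-edge on the chord itself has no side of its own; there the other half-edge at the
  cut decides. If both are on the chord, the cut counts as outside.\<close>

definition state :: "nat word \<Rightarrow> nat word \<Rightarrow> bool" where
  "state p q \<longleftrightarrow> inside (fpos (finv p)) \<or> inside (fpos q)"

text \<open>The mixture of open and closed bounds lets a path pass from a half-edge of the chord to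
  either side and forbids only a proper crossing at a vertex.\<close>

definition planar :: "nat word \<Rightarrow> bool" where
  "planar w \<longleftrightarrow> (\<forall>p q. w = p @ q \<longrightarrow>
     (inside (fpos (finv p)) \<longrightarrow> closed_inside (fpos q)) \<and>
     (inside (fpos q) \<longrightarrow> closed_inside (fpos (finv p))))"

lemma planarD:
  assumes "planar w" "w = p @ q"
  shows "inside (fpos (finv p)) \<longrightarrow> closed_inside (fpos q)"
    and "inside (fpos q) \<longrightarrow> closed_inside (fpos (finv p))"
  using assms unfolding planar_def by blast+

sublocale f: group_hom "free_n n" "free_n n" f
  using f_hom by unfold_locales

lemma gauge_closed [simp]: "gauge s \<in> carrier F"
  using x_closed y_closed by (simp add: gauge_def)

text \<open>For letters other than x, y and their inverses the states at both ends agree, and the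
  gauge undoes the conjugation or is absent. Only along x and y may the state change: f x = y^-1,
  for instance, becomes x if the letter starts inside and stays y^-1 otherwise.\<close>

lemma gauge_letter:
  assumes z: "[z] \<in> carrier F"
    and s: "s \<Longrightarrow> closed_inside (pos z)" "\<not> s \<Longrightarrow> \<not> inside (pos z)"
    and s': "s' \<Longrightarrow> closed_inside (pos (bar z))" "\<not> s' \<Longrightarrow> \<not> inside (pos (bar z))"
  shows "length (gauge s \<cdot> f [z] \<cdot> finv (gauge s')) \<le> 1"
proof -
  note cl = x_closed y_closed
  have fb: "f [bar x] = [y]" "f [bar y] = finv [y] \<cdot> ([x] \<cdot> [y])"
    using f.hom_inv[of "[x]"] f.hom_inv[of "[y]"] cl f_x f_y
    by (simp_all add: F_inv_letter[symmetric] F.inv_mult_group F.m_assoc)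
  note simps = gauge_def F.inv_mult_group F.m_assoc F_cancel cl
  consider "z = x" | "z = bar x" | "z = y" | "z = bar y" | "z \<notin> {x, y, bar x, bar y}" by blast
  then show ?thesis
  proof cases
    case 1
    then have "\<not> s'" using s' x_outside by blast
    then show ?thesis using cl by (cases s) (simp_all add: 1 f_x simps, (simp_all add: F_inv_letter cl)?)
  next
    case 2
    then have "\<not> s" using s x_outside by blast
    then show ?thesis using cl
      by (cases s') (simp_all add: 2 fb simps, (simp_all add: F_inv_letter cl)?)
  next
    case 3
    then have "s" using s y_inside by blast
    then show ?thesis using cl
      by (cases s') (simp_all add: 3 f_y simps, (simp_all add: F_inv_letter cl)?)
  next
    case 4
    then have "s'" using s'(2) y_inside by force
    then show ?thesis using cl
      by (cases s) (simp_all add: 4 fb simps, (simp_all add: F_inv_letter cl)?)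
  next
    case 5
    then show ?thesis
    proof (cases "inside (pos z)")
      case True
      then have "s" "s'" using s s' sides[OF z 5] by auto
      moreover have "[z] \<in> carrier F" by fact
      ultimately show ?thesis using f_inside[OF z 5 True] by (simp add: simps)
    next
      case False
      then have "\<not> s" "\<not> s'" using s s' sides[OF z 5] by auto
      then show ?thesis using f_outside[OF z 5 False] z by (simp add: simps)
    qed
  qed
qed

lemma fpos_inv_snoc: "p @ [z] \<in> carrier F \<Longrightarrow> fpos (finv (p @ [z])) = pos (bar z)"
  by (simp add: F_inv)

lemma state_letter:
  assumes w: "p @ z # q \<in> carrier F" "planar (p @ z # q)"
  shows "length (gauge (state p (z # q)) \<cdot> f [z] \<cdot> finv (gauge (state (p @ [z]) q))) \<le> 1"
proof (rule gauge_letter)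
  have "p @ [z] \<in> carrier F" using F_appendD[of "p @ [z]" q] w(1) by simp
  note inv = fpos_inv_snoc[OF this]
  show "[z] \<in> carrier F" using F_appendD(2)[OF w(1)] F_ConsD by blast
  have 1: "inside (fpos (finv p)) \<longrightarrow> closed_inside (pos z)"
    using planarD(1)[OF w(2), of p "z # q"] by simp
  have 2: "inside (fpos q) \<longrightarrow> closed_inside (pos (bar z))"
    using planarD(2)[OF w(2), of "p @ [z]" q] by (simp add: inv)
  show "state p (z # q) \<Longrightarrow> closed_inside (pos z)" "\<not> state p (z # q) \<Longrightarrow> \<not> inside (pos z)"
    using 1 by (auto simp: state_def)
  show "state (p @ [z]) q \<Longrightarrow> closed_inside (pos (bar z))"
    "\<not> state (p @ [z]) q \<Longrightarrow> \<not> inside (pos (bar z))"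
    using 2 by (auto simp: state_def inv)
qed

text \<open>Gauges at interior cuts cancel in pairs, which leaves one factor of length at most one
  per letter. At the end of the word the half-edge is the base point, whose position 0 is below
  \<open>lo\<close>, so the last gauge is trivial.\<close>

lemma length_suffix:
  "p @ q \<in> carrier F \<Longrightarrow> planar (p @ q) \<Longrightarrow> length (gauge (state p q) \<cdot> f q) \<le> length q"
proof (induction q arbitrary: p)
  case Nil
  have "\<not> inside (fpos (finv p))"
    using planarD(1)[OF Nil(2), of p "[]"] lo_pos by simp
  then have "\<not> state p []" using lo_pos by (simp add: state_def)
  then show ?case using f.hom_one by (simp add: gauge_def F_one F_mult)
next
  case (Cons z q)
  let ?s = "state p (z # q)" and ?s' = "state (p @ [z]) q"
  note c = F_appendD(2)[OF Cons.prems(1)]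
  note zc = F_ConsD[OF c]
  have "f (z # q) = f [z] \<cdot> f q" using F_Cons[OF c] zc by (metis f.hom_mult)
  then have "gauge ?s \<cdot> f (z # q) = (gauge ?s \<cdot> f [z] \<cdot> finv (gauge ?s')) \<cdot> (gauge ?s' \<cdot> f q)"
    using zc by (simp add: F.m_assoc F_cancel)
  moreover have "length (gauge ?s' \<cdot> f q) \<le> length q"
    using Cons.IH[of "p @ [z]"] Cons.prems by simp
  ultimately show ?case
    using state_letter[OF Cons.prems]
      length_F_mult[of "gauge ?s \<cdot> f [z] \<cdot> finv (gauge ?s')" "gauge ?s' \<cdot> f q"] by simp
qed

lemma length_prefix:
  "p @ q \<in> carrier F \<Longrightarrow> planar (p @ q) \<Longrightarrow> length (f p \<cdot> finv (gauge (state p q))) \<le> length p"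
proof (induction p arbitrary: q rule: rev_induct)
  case Nil
  have "\<not> inside (fpos q)"
    using planarD(2)[OF Nil(2), of "[]" q] lo_pos F.inv_one by (simp add: F_one)
  then have "\<not> state [] q" using lo_pos F.inv_one by (simp add: state_def F_one)
  then show ?case using f.hom_one F.inv_one by (simp add: gauge_def F_one F_mult)
next
  case (snoc z p)
  let ?s = "state p (z # q)" and ?s' = "state (p @ [z]) q"
  note c = F_appendD[OF F_appendD(1)[OF snoc.prems(1)]]
  have "f (p @ [z]) = f p \<cdot> f [z]" using c by (metis f.hom_mult)
  then have "f (p @ [z]) \<cdot> finv (gauge ?s') =
    (f p \<cdot> finv (gauge ?s)) \<cdot> (gauge ?s \<cdot> f [z] \<cdot> finv (gauge ?s'))"
    using c by (simp add: F.m_assoc F_cancel)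
  moreover have "length (f p \<cdot> finv (gauge ?s)) \<le> length p"
    using snoc.IH[of "z # q"] snoc.prems by simp
  moreover have "length (gauge ?s \<cdot> f [z] \<cdot> finv (gauge ?s')) \<le> 1"
    using state_letter[of p z q] snoc.prems by simp
  ultimately show ?case
    using length_F_mult[of "f p \<cdot> finv (gauge ?s)" "gauge ?s \<cdot> f [z] \<cdot> finv (gauge ?s')"] by simp
qed

lemma length_f:
  assumes "w \<in> carrier F" "planar w"
  shows "length (f w) \<le> length w"
proof -
  have "length (f w \<cdot> finv (gauge (state w []))) \<le> length w"
    using length_prefix[of w "[]"] assms by simp
  moreover have "\<not> inside (fpos (finv w))"
    using planarD(1)[OF assms(2), of w "[]"] lo_pos by simp
  then have "\<not> state w []" using lo_pos by (simp add: state_def)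
  ultimately show ?thesis using assms(1) by (simp add: gauge_def)
qed

text \<open>Between z and z' the path follows the chord, so the state before z differs from the
  state after z'. Taken together, the gauged images of these two letters cancel.\<close>

lemma length_f_less:
  assumes w: "w = p @ z # z' # q" "w \<in> carrier F" "planar w"
    and z: "z = bar x \<and> z' = bar y \<or> z = y \<and> z' = x"
  shows "length (f w) < length w"
proof -
  let ?s = "state p (z # z' # q)" and ?s' = "state (p @ [z, z']) q"
  have wc: "p @ z # z' # q \<in> carrier F" using w by simp
  note c1 = F_appendD[OF wc]
  note c2 = F_ConsD[OF c1(2)]
  note c3 = F_ConsD[OF c2(2)]
  have eq: "w = p \<cdot> ([z] \<cdot> ([z'] \<cdot> q))"
    using w(1) c1(3) F_Cons[OF c1(2)] F_Cons[OF c2(2)] by simp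
  have pq: "p \<in> carrier F" "q \<in> carrier F" "[z] \<in> carrier F" "[z'] \<in> carrier F"
    using c1 c2 c3 by blast+
  have pz: "p @ [z, z'] \<in> carrier F" "p @ [z] \<in> carrier F"
    using F_appendD(1)[of "p @ [z, z']" q] F_appendD(1)[of "p @ [z]" "z' # q"] wc by simp_all
  have inv: "fpos (finv (p @ [z, z'])) = pos (bar z')"
    using fpos_inv_snoc[of "p @ [z]" z'] pz by simp
  have st: "inside (fpos (finv p)) \<longrightarrow> closed_inside (pos z)"
    "inside (fpos q) \<longrightarrow> closed_inside (pos (bar z'))"
    using planarD(1)[OF w(3,1)] planarD(2)[OF w(3), of "p @ [z, z']" q] w(1) by (simp_all add: inv)
  note simps = gauge_def F.inv_mult_group F.m_assoc F_cancel x_closed y_closed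
  have fb: "f [bar x] = [y]" "f [bar y] = finv [y] \<cdot> ([x] \<cdot> [y])"
    using f.hom_inv[of "[x]"] f.hom_inv[of "[y]"] x_closed y_closed f_x f_y
    by (simp_all add: F_inv_letter[symmetric] F.inv_mult_group F.m_assoc)
  \<comment> \<open>The product is y . y^-1 x y . (x y)^-1 in the first case and x y . y^-1 x^-1 y .
    y^-1 in the second.\<close>
  have mid: "gauge ?s \<cdot> f [z] \<cdot> f [z'] \<cdot> finv (gauge ?s') = \<one>\<^bsub>F\<^esub>"
    using z
  proof
    assume z: "z = bar x \<and> z' = bar y"
    have "\<not> ?s" "?s'"
      using st x_outside y_inside chord z unfolding state_def inv by auto
    then show ?thesis
      using z by (simp add: simps fb)
  next
    assume z: "z = y \<and> z' = x"
    have "?s" "\<not> ?s'"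
      using st x_outside y_inside chord z unfolding state_def inv by auto
    then show ?thesis
      using z by (simp add: simps f_x f_y)
  qed
  have "f w = f p \<cdot> (f [z] \<cdot> (f [z'] \<cdot> f q))"
    unfolding eq using pq by simp
  also have "\<dots> = (f p \<cdot> finv (gauge ?s)) \<cdot> ((gauge ?s \<cdot> f [z] \<cdot> f [z'] \<cdot> finv (gauge ?s')) \<cdot> (gauge ?s' \<cdot> f q))"
    using pq by (simp add: F.m_assoc F_cancel)
  also have "\<dots> = (f p \<cdot> finv (gauge ?s)) \<cdot> (gauge ?s' \<cdot> f q)"
    unfolding mid using pq by simp
  finally have "length (f w) \<le> length (f p \<cdot> finv (gauge ?s)) + length (gauge ?s' \<cdot> f q)"
    by (simp add: length_F_mult)
  also have "\<dots> \<le> length p + length q"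
    using length_prefix[of p "z # z' # q"] length_suffix[of "p @ [z, z']" q] w by simp
  finally show ?thesis by (simp add: w(1))
qed

lemma slide_decreases:
  assumes d: "d \<in> carrier B" and k: "k \<in> {1..n}"
    and w: "artin n d (free_gen k) = p @ z # z' # q"
    and z: "z = bar x \<and> z' = bar y \<or> z = y \<and> z' = x"
  shows "l \<in> {1..n} \<Longrightarrow> length (f (artin n d (free_gen l))) \<le> length (artin n d (free_gen l))"
    and "length (f (artin n d (free_gen k))) < length (artin n d (free_gen k))"
proof -
  let ?T = "\<lambda>k. artin n d (free_gen k)"
  have T: "?T l \<in> carrier F" if "l \<in> {1..n}" for l using artin_closed[OF d gen_closed[OF that]] .
  \<comment> \<open>At this cut the half-edges of the k-th entry are the two ends of the chord; not
    crossing this entry is therefore planarity.\<close>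
  have w': "?T k = (p @ [z]) @ z' # q" using w by simp
  have "p @ [z] \<in> carrier F" using F_appendD(1)[of "p @ [z]" "z' # q"] T[OF k] w' by simp
  note inv = fpos_inv_snoc[OF this]
  have pl: "planar (?T l)" if l: "l \<in> {1..n}" for l
    unfolding planar_def
  proof (intro allI impI)
    fix p' q' assume "?T l = p' @ q'"
    note u = unlinked_subwords[OF d k l w' this, unfolded inv fpos.simps]
    have "lo < hi" using y_inside by simp
    moreover have "pos (bar z) = lo \<and> pos z' = hi \<or> pos (bar z) = hi \<and> pos z' = lo"
      using z chord by auto
    ultimately show "(inside (fpos (finv p')) \<longrightarrow> closed_inside (fpos q')) \<and>
        (inside (fpos q') \<longrightarrow> closed_inside (fpos (finv p')))"
      using u unfolding cyc3_def by auto
  qed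
  show "length (f (?T l)) \<le> length (?T l)" if "l \<in> {1..n}"
    using length_f T pl that by blast
  show "length (f (?T k)) < length (?T k)"
    using length_f_less[OF w T[OF k] pl[OF k] z] .
qed

end

subsection \<open>The action of the band generators\<close>

context braids
begin

lemma bkl_sym: "bkl n i j = bkl n j i"
  by (simp add: bkl_def min.commute max.commute)

lemma bkl_adjacent:
  assumes "i \<in> {1..<n}"
  shows "bkl n i (i + 1) = sigma n i"
  using sigma_closed[OF assms] by (simp add: bkl_def)

lemma sigma_prod_closed:
  "set ks \<subseteq> {1..<n} \<Longrightarrow> foldr (\<lambda>k h. sigma n k \<star> h) ks \<one>\<^bsub>B\<^esub> \<in> carrier B"
  by (induction ks) (auto simp: sigma_closed)

lemma bkl_step:
  assumes "1 \<le> i" "i + 1 < j" "j \<le> n"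
  shows "bkl n i j = sigma n i \<star> bkl n (i + 1) j \<star> binv (sigma n i)"
proof -
  let ?c = "foldr (\<lambda>k h. sigma n k \<star> h) [i + 1..<j - 1] \<one>\<^bsub>B\<^esub>"
  have c: "?c \<in> carrier B" "sigma n i \<in> carrier B" "sigma n (j - 1) \<in> carrier B"
    using assms by (auto intro!: sigma_prod_closed sigma_closed)
  have "foldr (\<lambda>k h. sigma n k \<star> h) [i..<j - 1] \<one>\<^bsub>B\<^esub> = sigma n i \<star> ?c"
    using assms by (subst upt_conv_Cons) auto
  then have "bkl n i j = (sigma n i \<star> ?c) \<star> sigma n (j - 1) \<star> binv (sigma n i \<star> ?c)"
    using assms unfolding bkl_def Let_def by simp
  also have "\<dots> = sigma n i \<star> (?c \<star> sigma n (j - 1) \<star> binv ?c) \<star> binv (sigma n i)"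
    using c by (simp add: B.inv_mult_group B.m_assoc)
  also have "?c \<star> sigma n (j - 1) \<star> binv ?c = bkl n (i + 1) j"
    using assms unfolding bkl_def Let_def by simp
  finally show ?thesis .
qed

lemma bkl_closed':
  "1 \<le> i \<Longrightarrow> i < j \<Longrightarrow> j \<le> n \<Longrightarrow> bkl n i j \<in> carrier B"
proof (induction "j - i" arbitrary: i rule: less_induct)
  case less
  show ?case
  proof (cases "j = i + 1")
    case True
    then show ?thesis using less.prems bkl_adjacent[of i] sigma_closed[of i] by simp
  next
    case False
    then show ?thesis
      using less.hyps[of "i + 1"] less.prems sigma_closed[of i] by (subst bkl_step) auto
  qed
qed

lemma bkl_closed:
  "i \<in> {1..n} \<Longrightarrow> j \<in> {1..n} \<Longrightarrow> i \<noteq> j \<Longrightarrow> bkl n i j \<in> carrier B"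
  using bkl_closed'[of i j] bkl_closed'[of j i] bkl_sym[of i j] by (cases "i < j") auto

text \<open>The inverse of sigma_i carries u_i unchanged to place i + 1, which reduces the pair i, j
  to i + 1, j. For adjacent places, sigma_i replaces x, x by x, x^-1 x x.\<close>

lemma hurwitz_bkl':
  assumes "group G"
  shows "1 \<le> i \<Longrightarrow> i < j \<Longrightarrow> j \<le> n \<Longrightarrow> u \<in> tuples n G \<Longrightarrow> u i = u j \<Longrightarrow>
    hurwitz n G (bkl n i j) u = u"
proof (induction "j - i" arbitrary: i u rule: less_induct)
  case less
  interpret G: group G by fact
  have i: "i \<in> {1..<n}" using less.prems by auto
  show ?case
  proof (cases "j = i + 1")
    case True
    have "u i \<in> carrier G" using less.prems i by auto
    then show ?thesis
      using True less.prems i bkl_adjacent[OF i] hurwitz_sigma[OF assms i less.prems(4)]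
      by (auto simp: fun_eq_iff)
  next
    case False
    let ?u = "hurwitz n G (binv (sigma n i)) u"
    note cl = sigma_closed[OF i] bkl_closed'[of "i + 1" j]
    have u: "?u \<in> tuples n G" using hurwitz_closed[OF assms _ less.prems(4)] cl(1) by blast
    have "?u (i + 1) = ?u j"
      using hurwitz_sigma_inv[OF assms i less.prems(4)] False less.prems by simp
    then have fixed: "hurwitz n G (bkl n (i + 1) j) ?u = ?u"
      using less.hyps[of "i + 1" ?u] less.prems False u by simp
    have "bkl n (i + 1) j \<in> carrier B" using cl(2) less.prems False by simp
    then have "hurwitz n G (bkl n i j) u = hurwitz n G (sigma n i) (hurwitz n G (bkl n (i + 1) j) ?u)"
      using False less.prems cl(1) u hurwitz_closed[OF assms _ less.prems(4)]
      by (subst bkl_step) (auto simp: hurwitz_mult[OF assms] simp del: One_nat_def)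
    then show ?thesis
      unfolding fixed using hurwitz_inv(2)[OF assms cl(1) less.prems(4)] by simp
  qed
qed

lemma hurwitz_bkl:
  assumes "group G" "i \<in> {1..n}" "j \<in> {1..n}" "i \<noteq> j" "u \<in> tuples n G" "u i = u j"
  shows "hurwitz n G (bkl n i j) u = u"
  using hurwitz_bkl'[OF assms(1), of i j u] hurwitz_bkl'[OF assms(1), of j i u] assms bkl_sym[of i j]
  by (cases "i < j") auto

abbreviation v :: "nat \<Rightarrow> nat word" where "v \<equiv> free_gen"

lemma artin_bkl:
  assumes "1 \<le> i" "i < j" "j \<le> n" "k \<in> {1..n}"
  shows "artin n (bkl n i j) (v k) =
    (if k = i then v i \<cdot> (v j \<cdot> finv (v i)) else if k = j then v i
     else if i < k \<and> k < j then v i \<cdot> (finv (v j) \<cdot> (v k \<cdot> (v j \<cdot> finv (v i)))) else v k)"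
  using assms
proof (induction "j - i" arbitrary: i k rule: less_induct)
  case less
  have i: "i \<in> {1..<n}" using less.prems by auto
  have g: "v l \<in> carrier F" if "1 \<le> l" "l \<le> n" for l using gen_closed[of l] that by simp
  show ?case
  proof (cases "j = i + 1")
    case True
    then show ?thesis
      using bkl_adjacent[OF i] artin_sigma[OF i less.prems(4)] g[of i] g[of "i + 1"] less.prems
      by (auto simp: artin_img_def F.m_assoc)
  next
    case False
    define im where "im i = (\<lambda>k. if k = i then v i \<cdot> (v j \<cdot> finv (v i)) else if k = j then v i
     else if i < k \<and> k < j then v i \<cdot> (finv (v j) \<cdot> (v k \<cdot> (v j \<cdot> finv (v i)))) else v k)" for i
    note cl = sigma_closed[OF i] bkl_closed'[of "i + 1" j]
    have b: "bkl n (i + 1) j \<in> carrier B" using cl(2) less.prems False by simp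
    let ?\<sigma> = "artin n (sigma n i)" and ?\<beta> = "artin n (bkl n (i + 1) j)"
    define \<alpha> where "\<alpha> = free_lift F (im i)"
    have IH: "?\<beta> (v k) = im (i + 1) k" if "k \<in> {1..n}" for k
      using less.hyps[of "i + 1" k] less.prems False that unfolding im_def by simp
    have im: "im i \<in> {1..n} \<rightarrow> carrier F"
      using less.prems g by (auto simp: im_def)
    have \<alpha>h: "\<alpha> \<in> hom F F" unfolding \<alpha>_def by (rule free_lift_hom_n[OF F.is_group im])
    interpret \<alpha>: group_hom F F \<alpha> using \<alpha>h by unfold_locales
    interpret \<sigma>: group_hom F F ?\<sigma> using artin_hom[OF cl(1)] by unfold_locales
    interpret \<beta>: group_hom F F ?\<beta> using artin_hom[OF b] by unfold_locales
    have \<alpha>g: "\<alpha> (v k) = im i k" if "k \<in> {1..n}" for k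
      unfolding \<alpha>_def by (rule free_lift_gen[OF F.is_group]) (use im that in auto)
    \<comment> \<open>As \<open>a_ij\<close> is sigma_i beta sigma_i^-1, it suffices to compare
      alpha sigma_i with sigma_i beta on generators; this avoids computing images under
      sigma_i^-1.\<close>
    have eq: "\<alpha> (?\<sigma> w) = ?\<sigma> (?\<beta> w)" if "w \<in> carrier F" for w
    proof (rule F_hom_eqI[OF _ _ _ that])
      show "(\<lambda>w. \<alpha> (?\<sigma> w)) \<in> hom F F" "(\<lambda>w. ?\<sigma> (?\<beta> w)) \<in> hom F F"
        using hom_compose[OF \<sigma>.homh \<alpha>.homh] hom_compose[OF \<beta>.homh \<sigma>.homh] by (simp_all add: comp_def)
      fix k assume k: "k \<in> {1..n}"
      have r: "i \<in> {1..n}" "Suc i \<in> {1..n}" "j \<in> {1..n}" using less.prems by auto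
      note S = artin_sigma[OF i k] artin_sigma[OF i r(1)] artin_sigma[OF i r(2)] artin_sigma[OF i r(3)]
      have gs: "v i \<in> carrier F" "v (Suc i) \<in> carrier F" "v j \<in> carrier F" "v k \<in> carrier F"
        using r k gen_closed by auto
      show "\<alpha> (?\<sigma> (v k)) = ?\<sigma> (?\<beta> (v k))"
        unfolding IH[OF k] S
        using False less.prems k r gs
        by (auto simp: im_def artin_img_def \<alpha>g S F.m_assoc F_cancel F.inv_mult_group)
    qed
    have k: "v k \<in> carrier F" using less.prems gen_closed by blast
    have "artin n (bkl n i j) (v k) = ?\<sigma> (?\<beta> (artin n (binv (sigma n i)) (v k)))"
      using False less.prems cl(1) b k by (subst bkl_step) (auto simp: artin_mult artin_closed)
    also have "\<dots> = \<alpha> (v k)"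
      using eq[of "artin n (binv (sigma n i)) (v k)"] k cl(1) by (simp add: artin_closed artin_inv)
    finally show ?thesis using \<alpha>g[OF less.prems(4)] by (simp add: im_def)
  qed
qed

lemma artin_bkl_inv:
  assumes "1 \<le> i" "i < j" "j \<le> n" "k \<in> {1..n}"
  shows "artin n (binv (bkl n i j)) (v k) =
    (if k = i then v j else if k = j then finv (v j) \<cdot> (v i \<cdot> v j)
     else if i < k \<and> k < j then finv (v j) \<cdot> (v i \<cdot> (v k \<cdot> (finv (v i) \<cdot> v j))) else v k)"
    (is "_ = ?w")
proof -
  note b = bkl_closed'[OF assms(1-3)]
  interpret \<alpha>: group_hom F F "artin n (bkl n i j)" using artin_hom[OF b] by unfold_locales
  have r: "i \<in> {1..n}" "j \<in> {1..n}" using assms by auto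
  have gs: "v i \<in> carrier F" "v j \<in> carrier F" "v k \<in> carrier F"
    using r assms gen_closed by auto
  note S = artin_bkl[OF assms(1-3)]
  \<comment> \<open>The claimed preimage is verified by applying \<open>a_ij\<close> to it.\<close>
  have e: "artin n (bkl n i j) ?w = v k"
    using assms gs r by (auto simp: S F.m_assoc F_cancel F.inv_mult_group)
  have "?w \<in> carrier F" using gs by auto
  from artin_inv(1)[OF b this] show ?thesis unfolding e .
qed


section \<open>The two signs of a band generator as slides\<close>

lemma letter_cases:
  assumes "[z] \<in> carrier F" "z \<notin> {(i, 1), (i, -1), (j, 1), (j, -1)}"
  obtains k e where "z = (k, e)" "k \<in> {1..n}" "e = 1 \<or> e = -1" "k \<noteq> i" "k \<noteq> j"
  using assms by (cases z) (auto simp: F_letter)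

lemma slide_bkl_inv:
  assumes "1 \<le> i" "i < j" "j \<le> n"
  shows "slide n (artin n (binv (bkl n i j))) (i, -1) (j, 1) (2 * i + 1) (2 * j + 1)"
proof -
  have b: "binv (bkl n i j) \<in> carrier B" using bkl_closed'[OF assms] by simp
  let ?f = "artin n (binv (bkl n i j))"
  note S = artin_bkl_inv[OF assms, unfolded free_gen_def]
  have ij: "i \<in> {1..n}" "j \<in> {1..n}" using assms by auto
  have cl: "[(k, e)] \<in> carrier F" if "k \<in> {1..n}" "e = 1 \<or> e = -1" for k e
    using that by (auto simp: F_letter)
  have inv: "finv [(k, 1)] = [(k, -1)]" "finv [(k, -1)] = [(k, 1)]" if "k \<in> {1..n}" for k
    using that by (simp_all add: F_inv_letter F_letter)
  have f_neg: "?f [(k, -1)] = finv (?f [(k, 1)])" if "k \<in> {1..n}" for k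
    using artin_F_inv[OF b cl[OF that, of 1]] inv[OF that] by simp
  have f_in: "?f [(k, e)] = finv [(j, 1)] \<cdot> ([(i, 1)] \<cdot> ([(k, e)] \<cdot> ([(i, -1)] \<cdot> [(j, 1)])))"
    if k: "k \<in> {1..n}" "e = 1 \<or> e = -1" "i < k" "k < j" for k e
  proof -
    have 1: "?f [(k, 1)] = finv [(j, 1)] \<cdot> ([(i, 1)] \<cdot> ([(k, 1)] \<cdot> ([(i, -1)] \<cdot> [(j, 1)])))"
      using S[OF k(1)] k inv[OF ij(1)] by simp
    then have "?f [(k, -1)] = finv [(j, 1)] \<cdot> ([(i, 1)] \<cdot> ([(k, -1)] \<cdot> ([(i, -1)] \<cdot> [(j, 1)])))"
      unfolding f_neg[OF k(1)] 1 using cl[OF ij(1)] cl[OF ij(2)] cl[OF k(1)]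
      by (simp add: F.inv_mult_group F.m_assoc inv[OF ij(1)] inv[OF k(1)])
    with 1 k(2) show ?thesis by blast
  qed
  have f_out: "?f [(k, e)] = [(k, e)]"
    if k: "k \<in> {1..n}" "e = 1 \<or> e = -1" "k < i \<or> j < k" for k e
    using S[OF k(1)] f_neg[OF k(1)] inv[OF k(1)] k assms by auto
  have f_i: "?f [(i, 1)] = [(j, 1)]" and f_j: "?f [(j, 1)] = finv [(j, 1)] \<cdot> ([(i, 1)] \<cdot> [(j, 1)])"
    using S[OF ij(1)] S[OF ij(2)] assms by simp_all
  show ?thesis
  proof
    show "?f \<in> hom F F" by (rule artin_hom[OF b])
    show "[(i, -1)] \<in> carrier F" "[(j, 1)] \<in> carrier F" using cl ij by auto
    show "?f [(i, -1)] = finv [(j, 1)]" by (simp only: f_neg[OF ij(1)] f_i)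
    show "?f [(j, 1)] = finv [(j, 1)] \<cdot> (finv [(i, -1)] \<cdot> [(j, 1)])"
      by (simp only: f_j inv[OF ij(1)])
    fix z assume z: "[z] \<in> carrier F" "z \<notin> {(i, -1), (j, 1), bar (i, -1), bar (j, 1)}"
    then have "z \<notin> {(i, 1), (i, -1), (j, 1), (j, -1)}" by simp
    then obtain k e where k: "z = (k, e)" "k \<in> {1..n}" "e = 1 \<or> e = -1" "k \<noteq> i" "k \<noteq> j"
      using letter_cases[OF z(1)] by metis
    \<comment> \<open>The positions 2k and 2k + 1 of v_k and v_k^-1 are adjacent, so for k other
      than i and j both lie on the same side of the chord.\<close>
    have pos: "(2 * i + 1 < pos z \<longleftrightarrow> i < k)" "(pos z < 2 * j + 1 \<longleftrightarrow> k < j)"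
      "(2 * i + 1 \<le> pos z \<longleftrightarrow> i < k)" "(pos z \<le> 2 * j + 1 \<longleftrightarrow> k < j)"
      "(2 * i + 1 < pos (bar z) \<longleftrightarrow> i < k)" "(pos (bar z) < 2 * j + 1 \<longleftrightarrow> k < j)"
      "(2 * i + 1 \<le> pos (bar z) \<longleftrightarrow> i < k)" "(pos (bar z) \<le> 2 * j + 1 \<longleftrightarrow> k < j)"
      using k by auto
    show "?f [z] = finv [(j, 1)] \<cdot> (finv [(i, -1)] \<cdot> ([z] \<cdot> ([(i, -1)] \<cdot> [(j, 1)])))"
      if "2 * i + 1 < pos z \<and> pos z < 2 * j + 1"
      using that f_in[OF k(2,3)] unfolding pos unfolding inv[OF ij(1)] k(1) by blast
    show "?f [z] = [z]" if "\<not> (2 * i + 1 < pos z \<and> pos z < 2 * j + 1)"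
      using that f_out[OF k(2,3)] k(4,5) unfolding pos unfolding k(1) by linarith
    show "(2 * i + 1 < pos z \<and> pos z < 2 * j + 1 \<and> 2 * i + 1 < pos (bar z) \<and> pos (bar z) < 2 * j + 1) \<or>
      (\<not> (2 * i + 1 \<le> pos z \<and> pos z \<le> 2 * j + 1) \<and>
       \<not> (2 * i + 1 \<le> pos (bar z) \<and> pos (bar z) \<le> 2 * j + 1))"
      unfolding pos by blast
  qed (use assms in auto)
qed

lemma slide_bkl:
  assumes "1 \<le> i" "i < j" "j \<le> n"
  shows "slide n (artin n (bkl n i j)) (j, 1) (i, -1) (2 * i) (2 * j)"
proof -
  have b: "bkl n i j \<in> carrier B" using bkl_closed'[OF assms] by simp
  let ?f = "artin n (bkl n i j)"
  note S = artin_bkl[OF assms, unfolded free_gen_def]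
  have ij: "i \<in> {1..n}" "j \<in> {1..n}" using assms by auto
  have cl: "[(k, e)] \<in> carrier F" if "k \<in> {1..n}" "e = 1 \<or> e = -1" for k e
    using that by (auto simp: F_letter)
  have inv: "finv [(k, 1)] = [(k, -1)]" "finv [(k, -1)] = [(k, 1)]" if "k \<in> {1..n}" for k
    using that by (simp_all add: F_inv_letter F_letter)
  have f_neg: "?f [(k, -1)] = finv (?f [(k, 1)])" if "k \<in> {1..n}" for k
    using artin_F_inv[OF b cl[OF that, of 1]] inv[OF that] by simp
  have f_in: "?f [(k, e)] = [(i, 1)] \<cdot> (finv [(j, 1)] \<cdot> ([(k, e)] \<cdot> ([(j, 1)] \<cdot> [(i, -1)])))"
    if k: "k \<in> {1..n}" "e = 1 \<or> e = -1" "i < k" "k < j" for k e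
  proof -
    have 1: "?f [(k, 1)] = [(i, 1)] \<cdot> (finv [(j, 1)] \<cdot> ([(k, 1)] \<cdot> ([(j, 1)] \<cdot> [(i, -1)])))"
      using S[OF k(1)] k inv[OF ij(1)] by simp
    then have "?f [(k, -1)] = [(i, 1)] \<cdot> (finv [(j, 1)] \<cdot> ([(k, -1)] \<cdot> ([(j, 1)] \<cdot> [(i, -1)])))"
      unfolding f_neg[OF k(1)] 1 using cl[OF ij(1)] cl[OF ij(2)] cl[OF k(1)]
      by (simp add: F.inv_mult_group F.m_assoc inv[OF ij(1)] inv[OF k(1)])
    with 1 k(2) show ?thesis by blast
  qed
  have f_out: "?f [(k, e)] = [(k, e)]"
    if k: "k \<in> {1..n}" "e = 1 \<or> e = -1" "k < i \<or> j < k" for k e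
    using S[OF k(1)] f_neg[OF k(1)] inv[OF k(1)] k assms by auto
  have f_j: "?f [(j, 1)] = [(i, 1)]" and f_i: "?f [(i, 1)] = [(i, 1)] \<cdot> ([(j, 1)] \<cdot> [(i, -1)])"
    using S[OF ij(1)] S[OF ij(2)] assms inv[OF ij(1)] by simp_all
  show ?thesis
  proof
    show "?f \<in> hom F F" by (rule artin_hom[OF b])
    show "[(j, 1)] \<in> carrier F" "[(i, -1)] \<in> carrier F" using cl ij by auto
    show "?f [(j, 1)] = finv [(i, -1)]" by (simp only: f_j inv[OF ij(1)])
    show "?f [(i, -1)] = finv [(i, -1)] \<cdot> (finv [(j, 1)] \<cdot> [(i, -1)])"
      unfolding f_neg[OF ij(1)] f_i using cl[OF ij(1)] cl[OF ij(2)]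
      by (simp add: F.inv_mult_group F.m_assoc inv[OF ij(1)])
    fix z assume z: "[z] \<in> carrier F" "z \<notin> {(j, 1), (i, -1), bar (j, 1), bar (i, -1)}"
    then have "z \<notin> {(i, 1), (i, -1), (j, 1), (j, -1)}" by simp
    then obtain k e where k: "z = (k, e)" "k \<in> {1..n}" "e = 1 \<or> e = -1" "k \<noteq> i" "k \<noteq> j"
      using letter_cases[OF z(1)] by metis
    have pos: "(2 * i < pos z \<longleftrightarrow> i < k)" "(pos z < 2 * j \<longleftrightarrow> k < j)"
      "(2 * i \<le> pos z \<longleftrightarrow> i < k)" "(pos z \<le> 2 * j \<longleftrightarrow> k < j)"
      "(2 * i < pos (bar z) \<longleftrightarrow> i < k)" "(pos (bar z) < 2 * j \<longleftrightarrow> k < j)"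
      "(2 * i \<le> pos (bar z) \<longleftrightarrow> i < k)" "(pos (bar z) \<le> 2 * j \<longleftrightarrow> k < j)"
      using k by auto
    show "?f [z] = finv [(i, -1)] \<cdot> (finv [(j, 1)] \<cdot> ([z] \<cdot> ([(j, 1)] \<cdot> [(i, -1)])))"
      if "2 * i < pos z \<and> pos z < 2 * j"
      using that f_in[OF k(2,3)] unfolding pos unfolding inv[OF ij(1)] k(1) by blast
    show "?f [z] = [z]" if "\<not> (2 * i < pos z \<and> pos z < 2 * j)"
      using that f_out[OF k(2,3)] k(4,5) unfolding pos unfolding k(1) by linarith
    show "(2 * i < pos z \<and> pos z < 2 * j \<and> 2 * i < pos (bar z) \<and> pos (bar z) < 2 * j) \<or>
      (\<not> (2 * i \<le> pos z \<and> pos z \<le> 2 * j) \<and>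
       \<not> (2 * i \<le> pos (bar z) \<and> pos (bar z) \<le> 2 * j))"
      unfolding pos by blast
  qed (use assms in auto)
qed

text \<open>Here i < j is fixed, whereas an admissible pair comes in either order; hence the two
  forms of the subword.\<close>

lemma bkl_decreases':
  assumes d: "d \<in> carrier B" and ij: "1 \<le> i" "i < j" "j \<le> n" and k: "k \<in> {1..n}"
    and \<eta>: "\<eta> = 1 \<or> \<eta> = -1"
    and w: "artin n d (free_gen k) = p @ z # z' # q"
    and z: "z = (i, \<eta>) \<and> z' = (j, - \<eta>) \<or> z = (j, \<eta>) \<and> z' = (i, - \<eta>)"
  defines "f \<equiv> artin n (bkl n i j [^]\<^bsub>B\<^esub> (- \<eta>))"
  shows "l \<in> {1..n} \<Longrightarrow> length (f (artin n d (free_gen l))) \<le> length (artin n d (free_gen l))"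
    and "length (f (artin n d (free_gen k))) < length (artin n d (free_gen k))"
proof -
  note b = bkl_closed'[OF ij]
  have "(l \<in> {1..n} \<longrightarrow> length (f (artin n d (free_gen l))) \<le> length (artin n d (free_gen l))) \<and>
    length (f (artin n d (free_gen k))) < length (artin n d (free_gen k))" for l
  proof (cases "\<eta> = 1")
    case True
    interpret slide n "artin n (binv (bkl n i j))" "(i, -1)" "(j, 1)" "2 * i + 1" "2 * j + 1"
      by (rule slide_bkl_inv[OF ij])
    have "f = artin n (binv (bkl n i j))" using b by (simp add: f_def True B.int_pow_neg)
    then show ?thesis using slide_decreases[OF d k w] z True by simp
  next
    case False
    interpret slide n "artin n (bkl n i j)" "(j, 1)" "(i, -1)" "2 * i" "2 * j"
      by (rule slide_bkl[OF ij])
    have "f = artin n (bkl n i j)" using b \<eta> False by (simp add: f_def)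
    then show ?thesis using slide_decreases[OF d k w] z False \<eta> by auto
  qed
  then show "l \<in> {1..n} \<Longrightarrow> length (f (artin n d (free_gen l))) \<le> length (artin n d (free_gen l))"
    "length (f (artin n d (free_gen k))) < length (artin n d (free_gen k))" by blast+
qed

lemma bkl_decreases:
  assumes d: "d \<in> carrier B" and t: "t = bullet n d (t_triv n)"
    and a: "admissible n u t i j \<eta>" and ij: "i \<noteq> j"
  shows "(\<Sum>k\<in>{1..n}. length (bullet n (bkl n i j [^]\<^bsub>B\<^esub> (- \<eta>)) t k)) < (\<Sum>k\<in>{1..n}. length (t k))"
proof -
  from a obtain k p q where k: "k \<in> {1..n}" and w: "t k = p @ (i, \<eta>) # (j, - \<eta>) # q"
    and ij': "i \<in> {1..n}" "j \<in> {1..n}" "\<eta> = 1 \<or> \<eta> = -1"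
    by (auto simp: admissible_def sublist_def)
  have tl: "t l = artin n d (free_gen l)" if "l \<in> {1..n}" for l
    using that by (simp add: t bullet_def t_triv_def)
  let ?f = "artin n (bkl n i j [^]\<^bsub>B\<^esub> (- \<eta>))"
  have *: "(l \<in> {1..n} \<longrightarrow> length (?f (t l)) \<le> length (t l)) \<and> length (?f (t k)) < length (t k)" for l
  proof (cases "i < j")
    case True
    then show ?thesis
      using bkl_decreases'[OF d _ True _ k ij'(3) w[unfolded tl[OF k]]] ij' tl k by simp
  next
    case False
    then have "j < i" using ij by simp
    then show ?thesis
      using bkl_decreases'[OF d _ \<open>j < i\<close> _ k ij'(3) w[unfolded tl[OF k]]] ij' tl k bkl_sym[of i j] by simp
  qed
  show ?thesis
  proof (rule sum_strict_mono_ex1)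
    show "\<exists>l\<in>{1..n}. length (bullet n (bkl n i j [^]\<^bsub>B\<^esub> (- \<eta>)) t l) < length (t l)"
      using * k by (intro bexI[of _ k]) (auto simp: bullet_def)
  qed (use * in \<open>auto simp: bullet_def\<close>)
qed

end

section \<open>Combing braids\<close>

text \<open>Combing uses nothing but the braid relations, so it is done in any group containing such
  elements. It yields factorizations without any claim of uniqueness.\<close>

locale braid_relations = group G for G (structure) +
  fixes s :: "nat \<Rightarrow> 'a" and n :: nat
  assumes s_closed: "i \<in> {1..<n} \<Longrightarrow> s i \<in> carrier G"
    and s_comm: "\<lbrakk>i \<in> {1..<n}; j \<in> {1..<n}; i + 2 \<le> j\<rbrakk> \<Longrightarrow> s i \<otimes> s j = s j \<otimes> s i"
    and s_braid: "\<lbrakk>i \<in> {1..<n}; i + 1 \<in> {1..<n}\<rbrakk> \<Longrightarrow>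
      s i \<otimes> (s (i + 1) \<otimes> s i) = s (i + 1) \<otimes> (s i \<otimes> s (i + 1))"
begin

definition H :: "nat \<Rightarrow> 'a set" where
  "H k = generate G (s ` {1..<k})"

text \<open>\<open>transversal k j\<close> is \<open>s\<^sub>k\<^sup>-\<^sup>1 \<cdots> s\<^sub>j\<^sup>-\<^sup>1\<close>; it carries strand \<open>j\<close> to the place \<open>k + 1\<close>.\<close>

definition transversal :: "nat \<Rightarrow> nat \<Rightarrow> 'a" where
  "transversal k j = foldr (\<lambda>i h. h \<otimes> inv (s i)) [j..<Suc k] \<one>"

text \<open>A form of the pure braid generator A_{j,k+1}: strand k + 1 runs once around strand
  j.\<close>

definition push :: "nat \<Rightarrow> nat \<Rightarrow> 'a" where
  "push k j = transversal k (Suc j) \<otimes> (s j \<otimes> s j) \<otimes> inv (transversal k (Suc j))"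

definition U :: "nat \<Rightarrow> 'a set" where
  "U k = generate G (push k ` {1..k})"

lemma cancel:
  assumes "a \<in> carrier G" "b \<in> carrier G"
  shows "a \<otimes> (inv a \<otimes> b) = b" "inv a \<otimes> (a \<otimes> b) = b"
  using assms by (simp_all flip: m_assoc)

lemma transversal_top [simp]: "transversal k (Suc k) = \<one>"
  by (simp add: transversal_def)

lemma transversal_step: "j \<le> k \<Longrightarrow> transversal k j = transversal k (Suc j) \<otimes> inv (s j)"
  by (simp add: transversal_def upt_conv_Cons del: upt_Suc)

lemma transversal_closed:
  assumes "k < n" "1 \<le> j"
  shows "transversal k j \<in> carrier G"
proof -
  have "foldr (\<lambda>i h. h \<otimes> inv (s i)) is \<one> \<in> carrier G" if "set is \<subseteq> {1..<n}" for "is"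
    using that s_closed by (induction "is") auto
  from this[of "[j..<Suc k]"] show ?thesis using assms unfolding transversal_def by fastforce
qed

lemma push_closed: "k < n \<Longrightarrow> j \<in> {1..k} \<Longrightarrow> push k j \<in> carrier G"
  using transversal_closed[of k "Suc j"] s_closed[of j] by (simp add: push_def)

lemma U_subgroup: "k < n \<Longrightarrow> subgroup (U k) G"
  unfolding U_def by (rule generate_is_subgroup) (use push_closed in auto)

lemma H_subgroup: "k \<le> n \<Longrightarrow> subgroup (H k) G"
  unfolding H_def by (rule generate_is_subgroup) (use s_closed in auto)

lemma push_in_U: "j \<in> {1..k} \<Longrightarrow> push k j \<in> U k"
  unfolding U_def by (intro generate.incl imageI)

lemma s_in_H: "i \<in> {1..<k} \<Longrightarrow> s i \<in> H k"
  unfolding H_def by (intro generate.incl imageI)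

lemma comm_conj:
  assumes "a \<in> carrier G" "b \<in> carrier G" "a \<otimes> b = b \<otimes> a"
  shows "a \<otimes> inv b = inv b \<otimes> a"
  using assms by (metis inv_closed inv_solve_left inv_solve_right m_assoc m_closed)

lemma transversal_comm:
  assumes "k < n" "1 \<le> i" "i + 1 < j" "j \<le> Suc k"
  shows "s i \<otimes> transversal k j = transversal k j \<otimes> s i"
  using assms(4,3)
proof (induction rule: inc_induct)
  case base
  then show ?case using s_closed[of i] assms by simp
next
  case (step j)
  have c: "s i \<in> carrier G" "s j \<in> carrier G" "transversal k (Suc j) \<in> carrier G"
    using step assms s_closed transversal_closed by auto
  have "s i \<otimes> inv (s j) = inv (s j) \<otimes> s i"
    using s_comm[of i j] step assms by (intro comm_conj c) auto
  then have e: "inv (s j) \<otimes> s i = s i \<otimes> inv (s j)" ..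
  have "s i \<otimes> transversal k (Suc j) = transversal k (Suc j) \<otimes> s i" using step by simp
  then have "s i \<otimes> transversal k j = transversal k (Suc j) \<otimes> s i \<otimes> inv (s j)"
    using step c by (simp add: transversal_step flip: m_assoc)
  also have "\<dots> = transversal k j \<otimes> s i"
    using step c e by (simp add: transversal_step m_assoc)
  finally show ?case .
qed

lemma braid_conj:
  assumes "i \<in> {1..<n}" "i + 1 \<in> {1..<n}"
  shows "s i \<otimes> (inv (s (i + 1)) \<otimes> inv (s i)) = inv (s (i + 1)) \<otimes> (inv (s i) \<otimes> s (i + 1))"
    and "s i \<otimes> (s (i + 1) \<otimes> inv (s i)) = inv (s (i + 1)) \<otimes> (s i \<otimes> s (i + 1))"
proof -
  have c: "s i \<in> carrier G" "s (i + 1) \<in> carrier G" using assms s_closed by auto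
  note b = s_braid[OF assms]
  have "s (i + 1) \<otimes> (s i \<otimes> (s (i + 1) \<otimes> inv (s i))) = s (i + 1) \<otimes> (s i \<otimes> s (i + 1)) \<otimes> inv (s i)"
    using c by (simp add: m_assoc)
  also have "\<dots> = s i \<otimes> s (i + 1)" unfolding b[symmetric] using c by (simp add: m_assoc)
  finally show 2: "s i \<otimes> (s (i + 1) \<otimes> inv (s i)) = inv (s (i + 1)) \<otimes> (s i \<otimes> s (i + 1))"
    using c by (subst inv_solve_left) auto
  have "inv (s i \<otimes> (s (i + 1) \<otimes> inv (s i))) = inv (inv (s (i + 1)) \<otimes> (s i \<otimes> s (i + 1)))"
    by (simp only: 2)
  then show "s i \<otimes> (inv (s (i + 1)) \<otimes> inv (s i)) = inv (s (i + 1)) \<otimes> (inv (s i) \<otimes> s (i + 1))"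
    using c by (simp add: inv_mult_group m_assoc)
qed

text \<open>The factors s_{i+1}^-1 s_i^-1 of the transversal turn s_i into s_{i+1} by the braid
  relation. Those to their left commute with s_i, those to their right with s_{i+1}.\<close>

lemma transversal_shift:
  assumes "k < n" "i < k" "j \<le> i" "1 \<le> j"
  shows "s i \<otimes> transversal k j = transversal k j \<otimes> s (Suc i)"
  using assms(3,4)
proof (induction rule: inc_induct)
  case base
  let ?r = "transversal k (Suc (Suc i))"
  have c: "s i \<in> carrier G" "s (Suc i) \<in> carrier G" "?r \<in> carrier G"
    using base assms s_closed transversal_closed by auto
  have "transversal k i = ?r \<otimes> inv (s (Suc i)) \<otimes> inv (s i)"
    using base assms by (simp add: transversal_step)
  moreover have "s i \<otimes> ?r = ?r \<otimes> s i" using base assms by (intro transversal_comm) auto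
  then have "s i \<otimes> (?r \<otimes> inv (s (Suc i)) \<otimes> inv (s i)) = ?r \<otimes> (s i \<otimes> (inv (s (Suc i)) \<otimes> inv (s i)))"
    using c by (simp flip: m_assoc)
  ultimately show ?case
    using braid_conj(1)[of i] base assms c by (simp add: m_assoc)
next
  case (step j)
  have c: "s i \<in> carrier G" "s (Suc i) \<in> carrier G" "s j \<in> carrier G" "transversal k (Suc j) \<in> carrier G"
    using step assms s_closed transversal_closed by auto
  have "s (Suc i) \<otimes> inv (s j) = inv (s j) \<otimes> s (Suc i)"
    using s_comm[of j "Suc i"] step assms by (intro comm_conj c) auto
  moreover have "s i \<otimes> transversal k (Suc j) = transversal k (Suc j) \<otimes> s (Suc i)" using step by simp
  then have "s i \<otimes> transversal k j = transversal k (Suc j) \<otimes> s (Suc i) \<otimes> inv (s j)"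
    using step assms c by (simp add: transversal_step flip: m_assoc)
  ultimately show ?case
    using step assms c by (simp add: transversal_step m_assoc)
qed

section \<open>Conjugation of the pushes by braids on fewer strands\<close>

lemma conj_hom:
  assumes "g \<in> carrier G" "a \<in> carrier G" "b \<in> carrier G"
  shows "g \<otimes> (a \<otimes> b) \<otimes> inv g = (g \<otimes> a \<otimes> inv g) \<otimes> (g \<otimes> b \<otimes> inv g)"
  using assms by (simp add: m_assoc cancel)

text \<open>Conjugation by \<open>s\<^sub>i\<close> fixes all push generators but two; on these two it acts as on a pair of
  free generators.\<close>

lemma push_conj_far:
  assumes k: "k < n" and i: "i \<in> {1..<k}" and j: "j \<in> {1..k}" "j \<noteq> i" "j \<noteq> Suc i"
  shows "s i \<otimes> push k j \<otimes> inv (s i) = push k j"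
proof -
  let ?r = "transversal k (Suc j)"
  have c: "s i \<in> carrier G" "s j \<in> carrier G" "?r \<in> carrier G" "s (Suc i) \<in> carrier G"
    using assms s_closed transversal_closed by auto
  \<comment> \<open>Moved through the transversal, s_i stays s_i or becomes s_{i+1}; in both cases
    the result commutes with s_j.\<close>
  obtain x where x: "x \<in> carrier G" "s i \<otimes> ?r = ?r \<otimes> x" "x \<otimes> s j = s j \<otimes> x"
  proof (cases "i < j")
    case True
    then have "s i \<otimes> ?r = ?r \<otimes> s i" using assms by (intro transversal_comm) auto
    moreover have "s i \<otimes> s j = s j \<otimes> s i" using s_comm[of i j] True assms by simp
    ultimately show thesis using that c by blast
  next
    case False
    then have "s i \<otimes> ?r = ?r \<otimes> s (Suc i)" using assms by (intro transversal_shift) auto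
    moreover have "s (Suc i) \<otimes> s j = s j \<otimes> s (Suc i)" using s_comm[of j "Suc i"] False assms by simp
    ultimately show thesis using that c by blast
  qed
  have "s i \<otimes> push k j = (s i \<otimes> ?r) \<otimes> ((s j \<otimes> s j) \<otimes> inv ?r)"
    unfolding push_def using c by (simp add: m_assoc)
  also have "\<dots> = ?r \<otimes> ((x \<otimes> s j \<otimes> s j) \<otimes> inv ?r)" unfolding x(2) using c x(1) by (simp add: m_assoc)
  also have "x \<otimes> s j \<otimes> s j = s j \<otimes> (x \<otimes> s j)"
    using m_assoc[OF c(2) x(1) c(2)] by (simp only: x(3))
  also have "\<dots> = s j \<otimes> s j \<otimes> x"
    unfolding x(3) using x(1) c by (simp add: m_assoc)
  also have "?r \<otimes> (s j \<otimes> s j \<otimes> x \<otimes> inv ?r) = ?r \<otimes> (s j \<otimes> s j) \<otimes> inv ?r \<otimes> (?r \<otimes> x \<otimes> inv ?r)"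
    using c x(1) by (simp add: m_assoc cancel)
  also have "?r \<otimes> x \<otimes> inv ?r = s i"
    unfolding x(2)[symmetric] using c by (simp add: m_assoc)
  finally show ?thesis using c push_closed[OF k j(1)] unfolding push_def[symmetric]
    by (simp add: m_assoc)
qed

lemma push_conj_Suc:
  assumes k: "k < n" and i: "i \<in> {1..<k}"
  shows "s i \<otimes> push k (Suc i) \<otimes> inv (s i) = push k i"
    and "s i \<otimes> push k i \<otimes> inv (s i) = inv (push k i) \<otimes> push k (Suc i) \<otimes> push k i"
proof -
  let ?r = "transversal k (Suc (Suc i))" and ?a = "s i" and ?b = "s (Suc i)"
  let ?X = "inv ?b \<otimes> (?a \<otimes> ?a) \<otimes> ?b" and ?Y = "?b \<otimes> ?b"
  have c: "?a \<in> carrier G" "?b \<in> carrier G" "?r \<in> carrier G"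
    using assms s_closed transversal_closed by auto
  have r: "?a \<otimes> ?r = ?r \<otimes> ?a" using assms by (intro transversal_comm) auto
  have "transversal k (Suc i) = ?r \<otimes> inv ?b" using assms by (simp add: transversal_step)
  then have pX: "push k i = ?r \<otimes> ?X \<otimes> inv ?r"
    using c by (simp add: push_def m_assoc inv_mult_group)
  have pY: "push k (Suc i) = ?r \<otimes> ?Y \<otimes> inv ?r" by (simp add: push_def)
  have conj: "?a \<otimes> (?r \<otimes> x \<otimes> inv ?r) \<otimes> inv ?a = ?r \<otimes> (?a \<otimes> x \<otimes> inv ?a) \<otimes> inv ?r"
    if x: "x \<in> carrier G" for x
  proof -
    have "?a \<otimes> (?r \<otimes> x \<otimes> inv ?r) \<otimes> inv ?a = (?a \<otimes> ?r) \<otimes> x \<otimes> inv (?a \<otimes> ?r)"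
      using c x by (simp add: m_assoc inv_mult_group)
    also have "\<dots> = ?r \<otimes> (?a \<otimes> x \<otimes> inv ?a) \<otimes> inv ?r"
      unfolding r using c x by (simp add: m_assoc inv_mult_group)
    finally show ?thesis .
  qed
  have ab: "?a \<otimes> ?b \<otimes> inv ?a = inv ?b \<otimes> (?a \<otimes> ?b)"
    using braid_conj(2)[of i] assms c by (simp add: m_assoc)
  have Y: "?a \<otimes> ?Y \<otimes> inv ?a = ?X"
    unfolding conj_hom[OF c(1,2,2)] ab using c by (simp add: m_assoc cancel)
  \<comment> \<open>Y X = b a^2 b commutes with a by the braid relation. Conjugation by a sends Y to
    X and fixes Y X, which determines the image of X.\<close>
  have "?Y \<otimes> ?X = ?b \<otimes> (?a \<otimes> ?a) \<otimes> ?b" using c by (simp add: m_assoc cancel)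
  have aba: "?a \<otimes> (?b \<otimes> ?a) = ?b \<otimes> (?a \<otimes> ?b)" using s_braid[of i] assms by simp
  have "?a \<otimes> (?b \<otimes> (?a \<otimes> ?a) \<otimes> ?b) = (?a \<otimes> (?b \<otimes> ?a)) \<otimes> (?a \<otimes> ?b)" using c by (simp add: m_assoc)
  also have "\<dots> = ?b \<otimes> (?a \<otimes> (?b \<otimes> (?a \<otimes> ?b)))" unfolding aba using c by (simp add: m_assoc)
  also have "\<dots> = (?b \<otimes> (?a \<otimes> ?a) \<otimes> ?b) \<otimes> ?a" unfolding aba[symmetric] using c by (simp add: m_assoc)
  finally have "?a \<otimes> (?Y \<otimes> ?X) = (?Y \<otimes> ?X) \<otimes> ?a" using c by (simp add: m_assoc cancel)
  then have YX: "?a \<otimes> (?Y \<otimes> ?X) \<otimes> inv ?a = ?Y \<otimes> ?X" using c by (simp add: m_assoc)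
  have "?X \<otimes> (?a \<otimes> ?X \<otimes> inv ?a) = ?Y \<otimes> ?X"
    using YX conj_hom[of ?a ?Y ?X] c by (simp only: Y m_closed inv_closed)
  then have X: "?a \<otimes> ?X \<otimes> inv ?a = inv ?X \<otimes> (?Y \<otimes> ?X)"
    using c inv_solve_left[of "?a \<otimes> ?X \<otimes> inv ?a" ?X "?Y \<otimes> ?X"] by simp
  show "s i \<otimes> push k (Suc i) \<otimes> inv (s i) = push k i"
    unfolding pX pY conj[OF m_closed[OF c(2,2)]] Y ..
  have "s i \<otimes> push k i \<otimes> inv (s i) = ?r \<otimes> (inv ?X \<otimes> (?Y \<otimes> ?X)) \<otimes> inv ?r"
    unfolding pX using conj[of ?X] c unfolding X by simp
  also have "\<dots> = inv (push k i) \<otimes> push k (Suc i) \<otimes> push k i"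
    unfolding pX pY using c by (simp add: m_assoc inv_mult_group cancel)
  finally show "s i \<otimes> push k i \<otimes> inv (s i) = inv (push k i) \<otimes> push k (Suc i) \<otimes> push k i" .
qed

lemma generate_conj:
  assumes "g \<in> carrier G" "X \<subseteq> carrier G" "\<And>x. x \<in> X \<Longrightarrow> g \<otimes> x \<otimes> inv g \<in> generate G X"
    and "y \<in> generate G X"
  shows "g \<otimes> y \<otimes> inv g \<in> generate G X"
  using assms(4)
proof induction
  case one
  then show ?case using assms(1) by (simp add: generate.one)
next
  case (incl x)
  then show ?case by (rule assms(3))
next
  case (inv x)
  then have "g \<otimes> inv x \<otimes> inv g = inv (g \<otimes> x \<otimes> inv g)"
    using assms(1,2) by (auto simp: inv_mult_group m_assoc)
  then show ?case using generate_m_inv_closed[OF assms(2) assms(3)[OF inv]] by simp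
next
  case (eng x y)
  then show ?case
    using assms(1) generate_in_carrier[OF assms(2)] by (auto simp: conj_hom intro: generate.eng)
qed

text \<open>That conjugation by s_i maps U into itself does not yet give the same for its inverse;
  explicit preimages of the push generators do.\<close>

lemma U_conj_s:
  assumes k: "k < n" and i: "i \<in> {1..<k}" and u: "u \<in> U k"
  shows "s i \<otimes> u \<otimes> inv (s i) \<in> U k" "inv (s i) \<otimes> u \<otimes> s i \<in> U k"
proof -
  interpret U: subgroup "U k" G by (rule U_subgroup[OF k])
  have c: "s i \<in> carrier G" using assms s_closed by auto
  have P: "push k j \<in> carrier G" if "j \<in> {1..k}" for j using push_closed[OF k that] .
  have ii: "i \<in> {1..k}" "Suc i \<in> {1..k}" using i by auto
  note pc = P[OF ii(1)] P[OF ii(2)] and pu = push_in_U[OF ii(1)] push_in_U[OF ii(2)]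
  note far = push_conj_far[OF k i] and Su = push_conj_Suc[OF k i]
  have X: "push k ` {1..k} \<subseteq> carrier G" using P by auto
  have 1: "s i \<otimes> x \<otimes> inv (s i) \<in> U k" if x: "x \<in> push k ` {1..k}" for x
  proof -
    obtain j where j: "j \<in> {1..k}" "x = push k j" using x by blast
    consider "j = i" | "j = Suc i" | "j \<noteq> i" "j \<noteq> Suc i" by blast
    then show ?thesis using j far[OF j(1)] Su pu push_in_U by cases auto
  qed
  show "s i \<otimes> u \<otimes> inv (s i) \<in> U k"
    using generate_conj[OF c X] 1 u unfolding U_def by blast
  have unconj: "inv (s i) \<otimes> y \<otimes> s i = x" if "s i \<otimes> x \<otimes> inv (s i) = y" "x \<in> carrier G" for x y
    using that c by (auto simp: m_assoc cancel)
  have 2: "inv (s i) \<otimes> x \<otimes> inv (inv (s i)) \<in> U k" if x: "x \<in> push k ` {1..k}" for x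
  proof -
    obtain j where j: "j \<in> {1..k}" "x = push k j" using x by blast
    consider "j = i" | "j = Suc i" | "j \<noteq> i" "j \<noteq> Suc i" by blast
    then show ?thesis
    proof cases
      case 1
      then show ?thesis using unconj[OF Su(1) pc(2)] j pu c by simp
    next
      case 2
      \<comment> \<open>Conjugation by s_i sends push i + 1 to push i and push i to its own
        conjugate of push i + 1; undoing that conjugation requires the preimage push i + 1 of push
        i.\<close>
      let ?x = "push k (Suc i) \<otimes> push k i \<otimes> inv (push k (Suc i))"
      have "s i \<otimes> ?x \<otimes> inv (s i) = (s i \<otimes> push k (Suc i) \<otimes> inv (s i)) \<otimes> (s i \<otimes> push k i \<otimes> inv (s i)) \<otimes>
        inv (s i \<otimes> push k (Suc i) \<otimes> inv (s i))"
        using c pc by (simp add: m_assoc inv_mult_group cancel)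
      also have "\<dots> = push k (Suc i)" unfolding Su using pc by (simp add: m_assoc cancel)
      finally have "inv (s i) \<otimes> push k (Suc i) \<otimes> s i = ?x" by (rule unconj) (use pc in simp)
      then show ?thesis using j 2 pu c by simp
    next
      case 3
      then show ?thesis using unconj[OF far[OF j(1) 3] P[OF j(1)]] j push_in_U c by simp
    qed
  qed
  have "inv (s i) \<otimes> u \<otimes> inv (inv (s i)) \<in> U k"
    using generate_conj[OF inv_closed[OF c] X] 2 u unfolding U_def by blast
  then show "inv (s i) \<otimes> u \<otimes> s i \<in> U k" using c by simp
qed

lemma U_conj_H:
  assumes k: "k < n" and c: "c \<in> H k" and u: "u \<in> U k"
  shows "c \<otimes> u \<otimes> inv c \<in> U k"
  using c u unfolding H_def
proof (induction arbitrary: u)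
  interpret U: subgroup "U k" G by (rule U_subgroup[OF k])
  {
    case one
    then show ?case by simp
  next
    case (incl h)
    then show ?case using U_conj_s(1)[OF k] by blast
  next
    case (inv h)
    then obtain i where "i \<in> {1..<k}" "h = s i" by auto
    moreover from this have "s i \<in> carrier G" using s_closed k by auto
    ultimately show ?case using U_conj_s(2)[OF k _ inv(2)] by simp
  next
    case (eng a b)
    have "s ` {1..<k} \<subseteq> carrier G" using s_closed k by auto
    then have c: "a \<in> carrier G" "b \<in> carrier G" using eng generate_in_carrier by blast+
    have "a \<otimes> b \<otimes> u \<otimes> inv (a \<otimes> b) = a \<otimes> (b \<otimes> u \<otimes> inv b) \<otimes> inv a"
      using c U.mem_carrier[OF eng.prems] by (simp add: m_assoc inv_mult_group)
    then show ?case using eng by simp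
  }
qed

section \<open>The combed form of a braid on k + 1 strands\<close>

definition combed :: "nat \<Rightarrow> 'a set" where
  "combed k = {u \<otimes> c \<otimes> transversal k j | u c j. u \<in> U k \<and> c \<in> H k \<and> j \<in> {1..Suc k}}"

text \<open>If r g = a h r' for the transversal elements r and r', then u c r g = u (c a c^-1) . c h
  . r', and H normalizes U.\<close>

lemma combed_mult:
  assumes k: "k < n" and t: "t \<in> combed k" and g: "g \<in> carrier G"
    and step: "\<And>j. j \<in> {1..Suc k} \<Longrightarrow> \<exists>a\<in>U k. \<exists>h\<in>H k. \<exists>j'\<in>{1..Suc k}.
      transversal k j \<otimes> g = a \<otimes> h \<otimes> transversal k j'"
  shows "t \<otimes> g \<in> combed k"
proof -
  interpret U: subgroup "U k" G by (rule U_subgroup[OF k])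
  interpret H: subgroup "H k" G by (rule H_subgroup) (use k in simp)
  obtain u c j where t: "t = u \<otimes> c \<otimes> transversal k j" "u \<in> U k" "c \<in> H k" "j \<in> {1..Suc k}"
    using t by (auto simp: combed_def)
  obtain a h j' where s: "a \<in> U k" "h \<in> H k" "j' \<in> {1..Suc k}"
    "transversal k j \<otimes> g = a \<otimes> h \<otimes> transversal k j'"
    using step[OF t(4)] by blast
  have r: "transversal k j \<in> carrier G" "transversal k j' \<in> carrier G"
    using transversal_closed[OF k] t s by auto
  note cl = U.mem_carrier[OF t(2)] H.mem_carrier[OF t(3)] U.mem_carrier[OF s(1)] H.mem_carrier[OF s(2)]
  have "t \<otimes> g = u \<otimes> c \<otimes> (transversal k j \<otimes> g)" using t r g cl by (simp add: m_assoc)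
  also have "\<dots> = (u \<otimes> (c \<otimes> a \<otimes> inv c)) \<otimes> (c \<otimes> h) \<otimes> transversal k j'"
    unfolding s(4) using r cl by (simp add: m_assoc cancel)
  finally show ?thesis
    unfolding combed_def using U_conj_H[OF k t(3) s(1)] t s by blast
qed

lemma combed_mult_s:
  assumes k: "k < n" and t: "t \<in> combed k" and i: "i \<in> {1..k}"
  shows "t \<otimes> s i \<in> combed k" "t \<otimes> inv (s i) \<in> combed k"
proof -
  interpret U: subgroup "U k" G by (rule U_subgroup[OF k])
  interpret H: subgroup "H k" G by (rule H_subgroup) (use k in simp)
  have si: "s i \<in> carrier G" using s_closed i k by simp
  have *: "(\<exists>a\<in>U k. \<exists>h\<in>H k. \<exists>j'\<in>{1..Suc k}. transversal k j \<otimes> s i = a \<otimes> h \<otimes> transversal k j') \<and>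
    (\<exists>a\<in>U k. \<exists>h\<in>H k. \<exists>j'\<in>{1..Suc k}. transversal k j \<otimes> inv (s i) = a \<otimes> h \<otimes> transversal k j')"
    if j: "j \<in> {1..Suc k}" for j
  proof -
    have r: "transversal k j \<in> carrier G" using transversal_closed[OF k] j by auto
    have move: ?thesis if h: "h \<in> H k" "h \<otimes> transversal k j = transversal k j \<otimes> s i" for h
    proof
      have hc: "h \<in> carrier G" using h H.mem_carrier by blast
      show "\<exists>a\<in>U k. \<exists>h\<in>H k. \<exists>j'\<in>{1..Suc k}. transversal k j \<otimes> s i = a \<otimes> h \<otimes> transversal k j'"
        using h hc r j by (intro bexI[of _ \<one>] bexI[of _ h] bexI[of _ j]) auto
      have "inv h \<otimes> (h \<otimes> transversal k j) \<otimes> inv (s i) = inv h \<otimes> (transversal k j \<otimes> s i) \<otimes> inv (s i)"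
        by (simp only: h(2))
      then have "transversal k j \<otimes> inv (s i) = inv h \<otimes> transversal k j"
        using hc r si by (simp add: m_assoc cancel)
      then show "\<exists>a\<in>U k. \<exists>h\<in>H k. \<exists>j'\<in>{1..Suc k}. transversal k j \<otimes> inv (s i) = a \<otimes> h \<otimes> transversal k j'"
        using h hc r j by (intro bexI[of _ \<one>] bexI[of _ "inv h"] bexI[of _ j]) auto
    qed
    \<comment> \<open>Away from j the generator passes through the transversal, as s_i for j > i + 1
      and as s_{i-1} for j < i. For j = i + 1 and j = i it changes the transversal, and for one of
      the two signs a push or its inverse splits off.\<close>
    consider "i + 1 < j" | "j = Suc i" | "j = i" | "j < i" by linarith
    then show ?thesis
    proof cases
      case 1
      then show ?thesis using move[of "s i"] s_in_H[of i k] transversal_comm[of k i j] i j k by auto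
    next
      case 2
      have e: "transversal k i = transversal k (Suc i) \<otimes> inv (s i)" using transversal_step[of i k] i by simp
      have "transversal k (Suc i) \<otimes> s i = push k i \<otimes> transversal k i"
        unfolding e push_def using r 2 si by (simp add: m_assoc cancel)
      moreover have "push k i \<in> U k" "push k i \<in> carrier G" using push_in_U i push_closed k by auto
      moreover have "transversal k i \<in> carrier G" using transversal_closed[OF k] i by auto
      ultimately have "transversal k j \<otimes> s i = push k i \<otimes> \<one> \<otimes> transversal k i"
        "transversal k j \<otimes> inv (s i) = \<one> \<otimes> \<one> \<otimes> transversal k i"
        using 2 e by auto
      moreover have "i \<in> {1..Suc k}" using i by simp
      ultimately show ?thesis using \<open>push k i \<in> U k\<close> U.one_closed H.one_closed by blast
    next
      case 3
      have e: "transversal k i = transversal k (Suc i) \<otimes> inv (s i)" using transversal_step[of i k] i by simp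
      have r': "transversal k (Suc i) \<in> carrier G" using transversal_closed[OF k] by auto
      have p: "push k i \<in> U k" "push k i \<in> carrier G" using push_in_U i push_closed k by auto
      have "inv (push k i) \<otimes> transversal k (Suc i) = transversal k i \<otimes> inv (s i)"
        unfolding e push_def using r' si by (simp add: m_assoc inv_mult_group)
      then have "transversal k j \<otimes> inv (s i) = inv (push k i) \<otimes> \<one> \<otimes> transversal k (Suc i)"
        using 3 p by simp
      moreover have "transversal k j \<otimes> s i = \<one> \<otimes> \<one> \<otimes> transversal k (Suc i)"
        using 3 e r' si by (simp add: m_assoc)
      moreover have "Suc i \<in> {1..Suc k}" using i by simp
      ultimately show ?thesis using p(1) U.one_closed H.one_closed U.m_inv_closed by blast
    next
      case 4
      then obtain l where l: "i = Suc l" "j \<le> l" by (cases i) auto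
      then have "s l \<otimes> transversal k j = transversal k j \<otimes> s i"
        using transversal_shift[OF k, of l j] i j by simp
      moreover have "s l \<in> H k" using s_in_H l i j by auto
      ultimately show ?thesis using move by blast
    qed
  qed
  show "t \<otimes> s i \<in> combed k" "t \<otimes> inv (s i) \<in> combed k"
    using combed_mult[OF k t] si * by auto
qed

lemma H_Suc_combed:
  assumes k: "k < n" and g: "g \<in> H (Suc k)"
  obtains u c j where "g = u \<otimes> c \<otimes> transversal k j" "u \<in> U k" "c \<in> H k" "j \<in> {1..Suc k}"
proof -
  interpret U: subgroup "U k" G by (rule U_subgroup[OF k])
  interpret H: subgroup "H k" G by (rule H_subgroup) (use k in simp)
  have S: "s ` {1..<Suc k} \<subseteq> carrier G" using s_closed k by auto
  have cc: "t \<in> carrier G" if "t \<in> combed k" for t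
    using that transversal_closed[OF k] by (auto simp: combed_def)
  have "t \<otimes> g \<in> combed k" if "t \<in> combed k" for t
    using g that unfolding H_def
  proof (induction arbitrary: t)
    case one
    then show ?case using cc by simp
  next
    case (incl h)
    then show ?case using combed_mult_s(1)[OF k] by auto
  next
    case (inv h)
    then show ?case using combed_mult_s(2)[OF k] by auto
  next
    case (eng a b)
    then have "t \<otimes> (a \<otimes> b) = t \<otimes> a \<otimes> b"
      using cc generate_in_carrier[OF S] by (simp add: m_assoc)
    then show ?case using eng by simp
  qed
  moreover have "\<one> \<otimes> \<one> \<otimes> transversal k (Suc k) \<in> combed k"
    unfolding combed_def using U.one_closed H.one_closed by fastforce
  moreover have "g \<in> carrier G" using g generate_in_carrier[OF S] unfolding H_def by blast
  ultimately have "g \<in> combed k" by fastforce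
  then show thesis using that by (auto simp: combed_def)
qed

end

section \<open>Faithfulness of the Artin action\<close>

lemma reduced_rev: "reduced w \<Longrightarrow> reduced (rev w)"
proof (induction w)
  case (Cons z w)
  then show ?case
    by (cases w) (auto simp: reduced_append reduced_Cons bar_eq_iff)
qed simp

context braids
begin

lemma braid_group_relations: "braid_relations B (sigma n) n"
proof (intro braid_relations.intro braid_relations_axioms.intro)
  show "group B" by (rule B.is_group)
  show "sigma n i \<in> carrier B" if "i \<in> {1..<n}" for i using that by (rule sigma_closed)
  show "sigma n i \<star> sigma n j = sigma n j \<star> sigma n i"
    if ij: "i \<in> {1..<n}" "j \<in> {1..<n}" "i + 2 \<le> j" for i j
  proof -
    note c = sigma_closed[OF ij(1)] sigma_closed[OF ij(2)]
    have "[(i, 1), (j, 1), (i, -1), (j, -1)] \<in> braid_relators n"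
      using ij unfolding braid_relators_def by blast
    then have "(sigma n i \<star> sigma n j) \<star> binv (sigma n j \<star> sigma n i) = \<one>\<^bsub>B\<^esub>"
      using free_lift_sigma_relator c
      by (fastforce simp: free_lift_def B.int_pow_neg B.inv_mult_group B.m_assoc)
    then show ?thesis using c B.inv_solve_right'[of "\<one>\<^bsub>B\<^esub>"] by simp
  qed
  show "sigma n i \<star> (sigma n (i + 1) \<star> sigma n i) = sigma n (i + 1) \<star> (sigma n i \<star> sigma n (i + 1))"
    if ij: "i \<in> {1..<n}" "i + 1 \<in> {1..<n}" for i
  proof -
    note c = sigma_closed[OF ij(1)] sigma_closed[OF ij(2)]
    have "[(i, 1), (i + 1, 1), (i, 1), (i + 1, -1), (i, -1), (i + 1, -1)] \<in> braid_relators n"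
      using ij unfolding braid_relators_def by blast
    from free_lift_sigma_relator[OF this]
    have "(sigma n i \<star> (sigma n (i + 1) \<star> sigma n i)) \<star>
      binv (sigma n (i + 1) \<star> (sigma n i \<star> sigma n (i + 1))) = \<one>\<^bsub>B\<^esub>"
      using c by (simp add: free_lift_def B.int_pow_neg B.inv_mult_group B.m_assoc)
    then show ?thesis using c B.inv_solve_right'[of "\<one>\<^bsub>B\<^esub>"] by simp
  qed
qed

sublocale BR: braid_relations B "sigma n" n
  by (rule braid_group_relations)

text \<open>This forgets strand i: v_i is killed and later generators are renumbered. The target
  remains F_n so that braids on n strands can still act after forgetting.\<close>

definition shift :: "nat \<Rightarrow> nat word \<Rightarrow> nat word" where
  "shift i = free_lift F (\<lambda>l. if l < i then v l else if l = i then \<one>\<^bsub>F\<^esub> else v (l - 1))"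

lemma shift_img_closed:
  assumes "1 \<le> i"
  shows "(\<lambda>l. if l < i then v l else if l = i then \<one>\<^bsub>F\<^esub> else v (l - 1)) \<in> {1..n} \<rightarrow> carrier F"
proof
  fix l assume l: "l \<in> {1..n}"
  have "v (l - 1) \<in> carrier F" if "i < l"
    by (rule gen_closed) (use assms l that in auto)
  then show "(if l < i then v l else if l = i then \<one>\<^bsub>F\<^esub> else v (l - 1)) \<in> carrier F"
    using gen_closed[OF l] by simp
qed

lemma shift_hom: "1 \<le> i \<Longrightarrow> shift i \<in> hom F F"
  unfolding shift_def by (rule free_lift_hom_n[OF F.is_group shift_img_closed])

lemma shift_gen:
  "1 \<le> i \<Longrightarrow> l \<in> {1..n} \<Longrightarrow> shift i (v l) = (if l < i then v l else if l = i then \<one>\<^bsub>F\<^esub> else v (l - 1))"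
  unfolding shift_def using shift_img_closed by (intro free_lift_gen[OF F.is_group]) blast

lemma shift_group_hom: "1 \<le> i \<Longrightarrow> group_hom F F (shift i)"
  using shift_hom by unfold_locales

lemma shift_closed: "1 \<le> i \<Longrightarrow> w \<in> carrier F \<Longrightarrow> shift i w \<in> carrier F"
  using shift_hom by (auto simp: hom_def)

lemma hom_comp: "f \<in> hom F F \<Longrightarrow> g \<in> hom F F \<Longrightarrow> (\<lambda>w. f (g w)) \<in> hom F F"
  using hom_compose[of g F F f F] by (simp add: comp_def)

text \<open>Once one of the two crossing strands is forgotten, all that remains of sigma_i is the
  change of its place.\<close>

lemma shift_sigma:
  assumes i: "i \<in> {1..<n}" and w: "w \<in> carrier F"
  shows "shift i (artin n (sigma n i) w) = shift (Suc i) w"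
    and "shift (Suc i) (artin n (sigma n i) w) = shift i w"
proof -
  have i1: "1 \<le> i" "1 \<le> Suc i" "i \<in> {1..n}" "Suc i \<in> {1..n}" using i by auto
  interpret A: group_hom F F "shift i" by (rule shift_group_hom[OF i1(1)])
  interpret C: group_hom F F "shift (Suc i)" by (rule shift_group_hom[OF i1(2)])
  note hom = hom_comp[OF shift_hom artin_hom[OF sigma_closed[OF i]]]
  show "shift i (artin n (sigma n i) w) = shift (Suc i) w"
  proof (rule F_hom_eqI[OF hom[OF i1(1)] shift_hom[OF i1(2)] _ w])
    fix k assume k: "k \<in> {1..n}"
    show "shift i (artin n (sigma n i) (v k)) = shift (Suc i) (v k)"
      using k i1 gen_closed[OF i1(3)] gen_closed[OF i1(4)]
      by (auto simp: artin_sigma[OF i k] artin_img_def shift_gen[OF i1(1)] shift_gen[OF i1(2)])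
  qed
  show "shift (Suc i) (artin n (sigma n i) w) = shift i w"
  proof (rule F_hom_eqI[OF hom[OF i1(2)] shift_hom[OF i1(1)] _ w])
    fix k assume k: "k \<in> {1..n}"
    show "shift (Suc i) (artin n (sigma n i) (v k)) = shift i (v k)"
      using k i1 gen_closed[OF i1(3)] gen_closed[OF i1(4)]
      by (auto simp: artin_sigma[OF i k] artin_img_def shift_gen[OF i1(1)] shift_gen[OF i1(2)])
  qed
qed

lemma shift_sigma_far:
  assumes i: "i \<in> {1..<n}" and m: "i + 1 < m" and w: "w \<in> carrier F"
  shows "shift m (artin n (sigma n i) w) = artin n (sigma n i) (shift m w)"
proof -
  have i1: "1 \<le> m" "i \<in> {1..n}" "Suc i \<in> {1..n}" using i m by auto
  note s = sigma_closed[OF i]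
  interpret A: group_hom F F "shift m" by (rule shift_group_hom[OF i1(1)])
  interpret C: group_hom F F "artin n (sigma n i)" by (rule artin_group_hom[OF s])
  show ?thesis
  proof (rule F_hom_eqI[OF hom_comp[OF shift_hom artin_hom] hom_comp[OF artin_hom shift_hom] _ w])
    fix k assume k: "k \<in> {1..n}"
    have k1: "k > m \<Longrightarrow> k - 1 \<in> {1..n}" using i m k by auto
    show "shift m (artin n (sigma n i) (v k)) = artin n (sigma n i) (shift m (v k))"
      using k k1 m i1 gen_closed[OF i1(2)] gen_closed[OF i1(3)] artin_sigma[OF i k1]
      by (auto simp: artin_sigma[OF i k] artin_img_def shift_gen[OF i1(1)])
  qed (use i1 s in auto)
qed

lemma H_carrier: "k \<le> n \<Longrightarrow> c \<in> BR.H k \<Longrightarrow> c \<in> carrier B"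
  using subgroup.mem_carrier[OF BR.H_subgroup] .

lemma U_carrier: "k < n \<Longrightarrow> c \<in> BR.U k \<Longrightarrow> c \<in> carrier B"
  using subgroup.mem_carrier[OF BR.U_subgroup] .

lemma H_action:
  assumes k: "k < n" and c: "c \<in> BR.H k"
  shows "\<And>w. w \<in> carrier F \<Longrightarrow> shift (Suc k) (artin n c w) = artin n c (shift (Suc k) w)"
    and "\<And>l. l \<in> {Suc k..n} \<Longrightarrow> artin n c (v l) = v l"
proof -
  let ?P = "\<lambda>c. c \<in> carrier B \<and>
    (\<forall>w\<in>carrier F. shift (Suc k) (artin n c w) = artin n c (shift (Suc k) w)) \<and>
    (\<forall>l\<in>{Suc k..n}. artin n c (v l) = v l)"
  have sh: "shift (Suc k) w \<in> carrier F" if "w \<in> carrier F" for w using shift_closed that by simp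
  have g: "v l \<in> carrier F" if "l \<in> {Suc k..n}" for l using gen_closed that by auto
  have S: "?P (sigma n i)" if i: "i \<in> {1..<k}" for i
  proof -
    have i': "i \<in> {1..<n}" using i k by auto
    then show ?thesis
      using i sigma_closed[OF i'] shift_sigma_far[OF i', of "Suc k"] artin_sigma[OF i']
      by (auto simp: artin_img_def)
  qed
  have "?P c"
    using c unfolding BR.H_def
  proof induction
    case one
    then show ?case using sh g by (auto simp: artin_one)
  next
    case (incl h)
    then show ?case using S by blast
  next
    case (inv h)
    then have h: "?P h" using S by blast
    have "shift (Suc k) (artin n (binv h) w) = artin n (binv h) (shift (Suc k) w)"
      if w: "w \<in> carrier F" for w
    proof -
      have x: "artin n (binv h) w \<in> carrier F" using h w by (simp add: artin_closed)
      have "artin n h (shift (Suc k) (artin n (binv h) w)) = shift (Suc k) w"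
        using h x w by (metis artin_inv(2))
      then show ?thesis using h sh[OF x] by (metis artin_inv(1))
    qed
    moreover have "artin n (binv h) (v l) = v l" if "l \<in> {Suc k..n}" for l
      using h that g[OF that] by (metis artin_inv(1))
    ultimately show ?case using h by blast
  next
    case (eng a b)
    then show ?case using sh g by (auto simp: artin_mult artin_closed)
  qed
  then show "\<And>w. w \<in> carrier F \<Longrightarrow> shift (Suc k) (artin n c w) = artin n c (shift (Suc k) w)"
    "\<And>l. l \<in> {Suc k..n} \<Longrightarrow> artin n c (v l) = v l" by auto
qed

lemma transversal_action:
  assumes k: "k < n" and j: "1 \<le> j" "j \<le> Suc k"
  defines "r \<equiv> BR.transversal k j"
  shows "\<And>w. w \<in> carrier F \<Longrightarrow> shift (Suc k) (artin n r w) = shift j w"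
    and "artin n r (v j) = v (Suc k)"
    and "\<And>l. 1 \<le> l \<Longrightarrow> l < j \<Longrightarrow> artin n r (v l) = v l"
proof -
  have "(\<forall>w\<in>carrier F. shift (Suc k) (artin n (BR.transversal k j) w) = shift j w) \<and>
    artin n (BR.transversal k j) (v j) = v (Suc k) \<and>
    (\<forall>l. 1 \<le> l \<longrightarrow> l < j \<longrightarrow> artin n (BR.transversal k j) (v l) = v l)"
    using j(2,1)
  proof (induction rule: inc_induct)
    case base
    then show ?case using k gen_closed by (auto simp: artin_one)
  next
    case (step j)
    have jn: "j \<in> {1..<n}" "j \<in> {1..n}" "Suc j \<in> {1..n}" using step k by auto
    note s = sigma_closed[OF jn(1)]
    let ?r = "BR.transversal k (Suc j)" and ?t = "artin n (binv (sigma n j))"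
    have r: "?r \<in> carrier B" using BR.transversal_closed[OF k] by simp
    have e: "artin n (BR.transversal k j) w = artin n ?r (?t w)" if "w \<in> carrier F" for w
      using step that s r by (simp add: BR.transversal_step artin_mult)
    have t: "?t w \<in> carrier F" if "w \<in> carrier F" for w using that s by (simp add: artin_closed)
    note IH = step.IH[OF le_SucI[OF step.prems]]
    have "shift (Suc k) (artin n (BR.transversal k j) w) = shift j w" if w: "w \<in> carrier F" for w
    proof -
      have "shift (Suc k) (artin n (BR.transversal k j) w) = shift (Suc j) (?t w)"
        using IH e[OF w] t[OF w] by simp
      also have "\<dots> = shift j (artin n (sigma n j) (?t w))"
        using shift_sigma(1)[OF jn(1) t[OF w]] by simp
      finally show ?thesis using artin_inv(2)[OF s w] by simp
    qed
    moreover have "artin n (sigma n j) (v (Suc j)) = v j"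
      using artin_sigma[OF jn(1,3)] by (simp add: artin_img_def)
    then have "?t (v j) = v (Suc j)"
      using artin_inv(1)[OF s gen_closed[OF jn(3)]] by simp
    then have "artin n (BR.transversal k j) (v j) = v (Suc k)"
      using IH e[OF gen_closed[OF jn(2)]] by simp
    moreover have "artin n (BR.transversal k j) (v l) = v l" if l: "1 \<le> l" "l < j" for l
    proof -
      have ln: "l \<in> {1..n}" using l jn by auto
      have "artin n (sigma n j) (v l) = v l"
        using artin_sigma[OF jn(1) ln] l by (simp add: artin_img_def)
      then have "?t (v l) = v l" using artin_inv(1)[OF s gen_closed[OF ln]] by simp
      then show ?thesis using IH e[OF gen_closed[OF ln]] l by simp
    qed
    ultimately show ?case by blast
  qed
  then show "\<And>w. w \<in> carrier F \<Longrightarrow> shift (Suc k) (artin n r w) = shift j w"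
    "artin n r (v j) = v (Suc k)" "\<And>l. 1 \<le> l \<Longrightarrow> l < j \<Longrightarrow> artin n r (v l) = v l"
    by (auto simp: r_def)
qed

text \<open>The two factors sigma_j take \<open>shift (Suc j)\<close> to \<open>shift j\<close> and
  back, so nothing of the push is left after forgetting strand k + 1. What it does shows in the
  conjugation of v_{k+1}.\<close>

lemma push_action:
  assumes k: "k < n" and j: "j \<in> {1..k}"
  shows "\<And>w. w \<in> carrier F \<Longrightarrow> shift (Suc k) (artin n (BR.push k j) w) = shift (Suc k) w"
    and "artin n (BR.push k j) (v (Suc k)) = v j \<cdot> v (Suc k) \<cdot> finv (v j)"
proof -
  let ?r = "BR.transversal k (Suc j)" and ?s = "sigma n j"
  have jn: "j \<in> {1..<n}" "j \<in> {1..n}" "Suc j \<in> {1..n}" "Suc k \<in> {1..n}" using j k by auto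
  have r: "?r \<in> carrier B" using BR.transversal_closed[OF k] by simp
  note s = sigma_closed[OF jn(1)]
  have le: "1 \<le> Suc j" "Suc j \<le> Suc k" using j by auto
  note T = transversal_action[OF k le]
  have e: "artin n (BR.push k j) w = artin n ?r (artin n ?s (artin n ?s (artin n (binv ?r) w)))"
    if "w \<in> carrier F" for w
    using that r s by (simp add: BR.push_def artin_mult artin_closed)
  have cl: "artin n ?s w \<in> carrier F" "artin n (binv ?r) w \<in> carrier F" if "w \<in> carrier F" for w
    using that r s by (simp_all add: artin_closed)
  show "shift (Suc k) (artin n (BR.push k j) w) = shift (Suc k) w" if w: "w \<in> carrier F" for w
  proof -
    have "shift (Suc k) (artin n (BR.push k j) w) = shift (Suc j) (artin n (binv ?r) w)"
      using w by (simp add: e T(1) cl shift_sigma[OF jn(1)])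
    also have "\<dots> = shift (Suc k) (artin n ?r (artin n (binv ?r) w))"
      using w by (simp add: T(1) cl)
    finally show ?thesis using artin_inv(2)[OF r w] by simp
  qed
  have "artin n (binv ?r) (v (Suc k)) = v (Suc j)"
    using artin_inv(1)[OF r gen_closed[OF jn(3)]] T(2) by simp
  then have "artin n (BR.push k j) (v (Suc k)) = artin n ?r (artin n ?s (artin n ?s (v (Suc j))))"
    using e[OF gen_closed[OF jn(4)]] by simp
  also have "artin n ?s (artin n ?s (v (Suc j))) = v j \<cdot> v (Suc j) \<cdot> finv (v j)"
    using artin_sigma[OF jn(1,3)] artin_sigma[OF jn(1,2)] by (simp add: artin_img_def)
  also have "artin n ?r (v j \<cdot> v (Suc j) \<cdot> finv (v j)) = v j \<cdot> v (Suc k) \<cdot> finv (v j)"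
    using T(2) T(3)[of j] j gen_closed[OF jn(2)] gen_closed[OF jn(3)] r
    by (simp add: artin_F_mult artin_F_inv)
  finally show "artin n (BR.push k j) (v (Suc k)) = v j \<cdot> v (Suc k) \<cdot> finv (v j)" .
qed

lemma U_action:
  assumes k: "k < n" and u: "u \<in> BR.U k" and w: "w \<in> carrier F"
  shows "shift (Suc k) (artin n u w) = shift (Suc k) w"
proof -
  have c: "BR.push k ` {1..k} \<subseteq> carrier B" using BR.push_closed[OF k] by auto
  show ?thesis using u w unfolding BR.U_def
  proof (induction arbitrary: w)
    case one
    then show ?case by (simp add: artin_one)
  next
    case (incl h)
    then show ?case using push_action(1)[OF k] by auto
  next
    case (inv h)
    then have h: "h \<in> carrier B" using c by blast
    have "shift (Suc k) (artin n h (artin n (binv h) w)) = shift (Suc k) (artin n (binv h) w)"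
      using inv push_action(1)[OF k] artin_closed[of "binv h" w] h by auto
    then show ?case using artin_inv(2)[OF h inv(2)] by simp
  next
    case (eng a b)
    then have "a \<in> carrier B" "b \<in> carrier B" using B.generate_in_carrier[OF c] by auto
    then show ?case using eng by (simp add: artin_mult artin_closed)
  qed
qed

text \<open>This recovers w from its effect on v_{k+1}. A further push on the left acts on the old
  conjugator, which is invisible after forgetting, and multiplies it on the right by the conjugator
  of one letter; hence the reversal.\<close>

lemma push_word_action:
  assumes k: "k < n" and w: "set w \<subseteq> {1..k} \<times> {1, -1}" "reduced w"
  shows "\<exists>\<omega>\<in>carrier F. artin n (free_lift B (BR.push k) w) (v (Suc k)) = \<omega> \<cdot> v (Suc k) \<cdot> finv \<omega> \<and>
    shift (Suc k) \<omega> = rev w"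
  using w
proof (induction w)
  case Nil
  have vk: "v (Suc k) \<in> carrier F" using gen_closed k by auto
  have "shift (Suc k) [] = []"
    using group_hom.hom_one[OF shift_group_hom] by (simp add: F_one)
  moreover have "v (Suc k) = [] \<cdot> v (Suc k) \<cdot> finv []"
    using vk F.inv_one by (simp flip: F_one)
  moreover have "artin n (free_lift B (BR.push k) []) (v (Suc k)) = v (Suc k)"
    using vk by (simp add: free_lift_def artin_one)
  ultimately show ?case by (intro bexI[of _ "[]"]) simp_all
next
  case (Cons z w)
  obtain j e where z: "z = (j, e)" "j \<in> {1..k}" "e = 1 \<or> e = -1" using Cons.prems by (cases z) auto
  have vk: "v (Suc k) \<in> carrier F" and vj: "v j \<in> carrier F" using gen_closed k z by auto
  interpret S: group_hom F F "shift (Suc k)" by (rule shift_group_hom) simp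
  obtain \<omega> where \<omega>: "\<omega> \<in> carrier F" "shift (Suc k) \<omega> = rev w"
    "artin n (free_lift B (BR.push k) w) (v (Suc k)) = \<omega> \<cdot> v (Suc k) \<cdot> finv \<omega>"
    using Cons by (auto dest: reduced_ConsD)
  let ?A = "BR.push k j" and ?E = "BR.push k j [^]\<^bsub>B\<^esub> e"
  have A: "?A \<in> carrier B" "?E \<in> carrier B" using BR.push_closed[OF k z(2)] by simp_all
  have W: "free_lift B (BR.push k) w \<in> carrier B"
    by (rule free_lift_closed[of _ _ "{1..k}"]) (use B.is_group BR.push_closed[OF k] Cons.prems in auto)
  note P = push_action[OF k z(2)]
  have sj: "shift (Suc k) (v j) = [(j, 1)]"
    using shift_gen[of "Suc k" j] z k by (auto simp: free_gen_def)
  have jl: "[(j, 1)] \<in> carrier F" using vj by (simp add: free_gen_def)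
  obtain \<zeta> where \<zeta>: "\<zeta> \<in> carrier F" "artin n ?E (v (Suc k)) = \<zeta> \<cdot> v (Suc k) \<cdot> finv \<zeta>"
    "shift (Suc k) \<zeta> = [(j, e)]"
  proof (cases "e = 1")
    case True
    then show thesis using that[of "v j"] P(2) vj sj A by simp
  next
    case False
    \<comment> \<open>Applying A^-1 to A(v_{k+1}) = v_j v_{k+1} v_j^-1 and solving shows that A^-1
      conjugates v_{k+1} by x^-1; after forgetting, x is v_j again.\<close>
    let ?x = "artin n (binv ?A) (v j)"
    have x: "?x \<in> carrier F" using vj A by (simp add: artin_closed)
    have y: "artin n (binv ?A) (v (Suc k)) \<in> carrier F" using vk A by (simp add: artin_closed)
    have "v (Suc k) = artin n (binv ?A) (v j \<cdot> v (Suc k) \<cdot> finv (v j))"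
      using artin_inv(1)[OF A(1) vk] P(2) by simp
    also have "\<dots> = ?x \<cdot> artin n (binv ?A) (v (Suc k)) \<cdot> finv ?x"
      using A vj vk by (simp add: artin_F_mult artin_F_inv)
    finally have "finv ?x \<cdot> v (Suc k) \<cdot> ?x = finv ?x \<cdot> (?x \<cdot> artin n (binv ?A) (v (Suc k)) \<cdot> finv ?x) \<cdot> ?x"
      by simp
    also have "\<dots> = artin n (binv ?A) (v (Suc k))"
      using x y by (simp add: F.m_assoc F_cancel)
    finally have "artin n (binv ?A) (v (Suc k)) = finv ?x \<cdot> v (Suc k) \<cdot> finv (finv ?x)"
      using x by simp
    moreover have "shift (Suc k) ?x = [(j, 1)]"
      using P(1)[OF x] artin_inv(2)[OF A(1) vj] sj by simp
    then have "shift (Suc k) (finv ?x) = [(j, -1)]"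
      using S.hom_inv[OF x] F_inv_letter[OF jl] by simp
    moreover have e: "e = -1" using False z(3) by blast
    moreover from e have "?E = binv ?A" using A by (simp add: B.int_pow_neg)
    ultimately show thesis using that[of "finv ?x"] x by simp
  qed
  let ?\<omega> = "artin n ?E \<omega> \<cdot> \<zeta>"
  have E\<omega>: "artin n ?E \<omega> \<in> carrier F" using \<omega> A by (simp add: artin_closed)
  have "artin n (free_lift B (BR.push k) (z # w)) (v (Suc k)) = artin n ?E (\<omega> \<cdot> v (Suc k) \<cdot> finv \<omega>)"
    using W A vk \<omega>(3) by (simp add: z(1) free_lift_def artin_mult)
  also have "\<dots> = artin n ?E \<omega> \<cdot> (\<zeta> \<cdot> v (Suc k) \<cdot> finv \<zeta>) \<cdot> finv (artin n ?E \<omega>)"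
    using A \<omega>(1) vk by (simp add: artin_F_mult artin_F_inv \<zeta>(2))
  also have "\<dots> = ?\<omega> \<cdot> v (Suc k) \<cdot> finv ?\<omega>"
    using E\<omega> \<zeta>(1) vk by (simp add: F.m_assoc F.inv_mult_group)
  finally have 1: "artin n (free_lift B (BR.push k) (z # w)) (v (Suc k)) = ?\<omega> \<cdot> v (Suc k) \<cdot> finv ?\<omega>" .
  have "?E \<in> BR.U k"
    using z(2,3) BR.push_in_U[OF z(2)] A subgroup.m_inv_closed[OF BR.U_subgroup[OF k]]
    by (auto simp: B.int_pow_neg)
  then have "shift (Suc k) ?\<omega> = rev w \<cdot> [(j, e)]"
    using U_action[OF k _ \<omega>(1)] E\<omega> \<zeta> \<omega>(2) by simp
  also have "\<dots> = rev (z # w)"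
    using reduced_rev[OF Cons.prems(2)] F_append[of "rev w" "[(j, e)]"] z by simp
  finally show ?case using 1 E\<omega> \<zeta>(1) by blast
qed

text \<open>The centralizer of v_m consists of its powers, and h kills these. Comparing first
  letters in w v_m = v_m w shows that w starts with v_m or its inverse, a letter that can be
  removed.\<close>

lemma gen_centralizer:
  assumes m: "m \<in> {1..n}" and h: "h \<in> hom F F" "h (v m) = []"
    and w: "w \<in> carrier F" "w \<cdot> v m = v m \<cdot> w"
  shows "h w = []"
  using w
proof (induction w)
  interpret h: group_hom F F h using h(1) by unfold_locales
  {
    case Nil
    then show ?case using h.hom_one by (simp add: F_one)
  next
    case (Cons z w)
    note zw = F_ConsD[OF Cons.prems(1)]
    note eq = F_Cons[OF Cons.prems(1)]
    have vm: "v m \<in> carrier F" using gen_closed[OF m] .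
    have inv: "finv (v m) = [(m, -1)]" using vm F_inv_letter[of "(m, 1)"] by (simp add: free_gen_def)
    have "fst z = m"
    proof (rule ccontr)
      assume ne: "fst z \<noteq> m"
      have "fpos (z # w) \<noteq> pos (m, -1)"
        using zw(1) ne m pos_inj[of z "(m, -1)"] by (auto simp: F_letter)
      then have "v m \<cdot> (z # w) = (m, 1) # z # w"
        using F_mult_letter[of "(m, 1)", OF _ Cons.prems(1)] vm by (simp add: free_gen_def)
      then have e: "(z # w) \<cdot> v m = (m, 1) # z # w" by (simp only: Cons.prems(2))
      have "(z # w) \<cdot> v m = (z # w) @ [(m, 1)] \<or> (z # w) \<cdot> v m = butlast (z # w)"
        using mult_gen[OF Cons.prems(1) m] by (auto simp: free_gen_def)
      then show False
      proof
        assume "(z # w) \<cdot> v m = (z # w) @ [(m, 1)]"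
        then have "z = (m, 1)" unfolding e by simp
        then show False using ne by simp
      next
        assume "(z # w) \<cdot> v m = butlast (z # w)"
        then have "length ((m, 1::int) # z # w) = length (butlast (z # w))" unfolding e by (rule arg_cong)
        then show False by (simp del: butlast.simps)
      qed
    qed
    then have z: "[z] = v m \<or> [z] = finv (v m)"
      using zw(1) inv by (cases z) (auto simp: F_letter free_gen_def)
    then have "h [z] = []" using h(2) h.hom_inv[OF vm] F.inv_one by (auto simp: F_one)
    have comm: "[z] \<cdot> v m = v m \<cdot> [z]" using z vm by auto
    have "[z] \<cdot> (w \<cdot> v m) = [z] \<cdot> (v m \<cdot> w)"
      using Cons.prems(2) zw vm comm unfolding eq by (simp flip: F.m_assoc)
    then have "w \<cdot> v m = v m \<cdot> w"
      using zw vm by (metis F.m_closed F_cancel(2))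
    then have "h w = []" using Cons.IH zw by blast
    then show ?case
      unfolding eq using h.hom_mult[OF zw] \<open>h [z] = []\<close> F.l_one[of "[]"] by (simp add: F_one)
  }
qed

lemma artin_faithful_H:
  assumes "k \<le> n" "g \<in> BR.H k" "\<And>w. w \<in> carrier F \<Longrightarrow> artin n g w = w"
  shows "g = \<one>\<^bsub>B\<^esub>"
  using assms
proof (induction k arbitrary: g)
  case 0
  then have "g \<in> generate B {}" by (simp add: BR.H_def)
  then show ?case using B.generate_empty by blast
next
  case (Suc k)
  then have k: "k < n" by simp
  let ?\<rho> = "shift (Suc k)"
  interpret S: group_hom F F ?\<rho> by (rule shift_group_hom) simp
  obtain u c j where g: "g = u \<star> c \<star> BR.transversal k j" and ucj: "u \<in> BR.U k" "c \<in> BR.H k" "j \<in> {1..Suc k}"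
    using BR.H_Suc_combed[OF k Suc.prems(2)] by blast
  have jk: "1 \<le> j" "j \<le> Suc k" using ucj by auto
  have uB: "u \<in> carrier B" by (rule U_carrier[OF k ucj(1)])
  have cB: "c \<in> carrier B" by (rule H_carrier[OF less_imp_le[OF k] ucj(2)])
  have rB: "BR.transversal k j \<in> carrier B" by (rule BR.transversal_closed[OF k jk(1)])
  \<comment> \<open>Forgetting strand k + 1 removes u and turns the transversal into forgetting
    strand j.\<close>
  have act: "?\<rho> w = artin n c (shift j w)" if w: "w \<in> carrier F" for w
  proof -
    have rw: "artin n (BR.transversal k j) w \<in> carrier F" using rB w by (simp add: artin_closed)
    have "?\<rho> w = ?\<rho> (artin n u (artin n c (artin n (BR.transversal k j) w)))"
      using Suc.prems(3)[OF w] uB cB rB w by (simp add: g artin_mult artin_closed)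
    also have "\<dots> = ?\<rho> (artin n c (artin n (BR.transversal k j) w))"
      using U_action[OF k ucj(1)] cB rw by (simp add: artin_closed)
    also have "\<dots> = artin n c (shift j w)"
      using H_action(1)[OF k ucj(2) rw] transversal_action(1)[OF k jk w] by simp
    finally show ?thesis .
  qed
  have jn: "j \<in> {1..n}" using jk k by auto
  have "?\<rho> (v j) = []"
    using act[OF gen_closed[OF jn]] shift_gen[OF jk(1) jn] cB by (simp add: F_one)
  \<comment> \<open>Among the generators, \<open>shift (Suc k)\<close> kills only v_{k+1}.\<close>
  then have j: "j = Suc k"
    using shift_gen[of "Suc k" j] jn jk by (auto simp: free_gen_def split: if_splits)
  have "artin n c (v l) = v l" if l: "l \<in> {1..n}" for l
  proof (cases "l \<le> k")
    case True
    then show ?thesis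
      using act[OF gen_closed[OF l]] shift_gen[of "Suc k" l] l unfolding j by simp
  next
    case False
    then show ?thesis using H_action(2)[OF k ucj(2), of l] l by simp
  qed
  then have "artin n c w = w" if "w \<in> carrier F" for w
    using F_hom_eqI[OF artin_hom[OF cB] _ _ that, of "\<lambda>w. w"] by (auto simp: hom_def)
  then have "c = \<one>\<^bsub>B\<^esub>" using Suc.IH[of c] k ucj(2) by simp
  then have gu: "g = u" using g j uB by simp
  let ?L = "free_lift B (BR.push k)"
  have pk: "BR.push k \<in> {1..k} \<rightarrow> carrier B" using BR.push_closed[OF k] by auto
  interpret K: group "free_group {1..k}" by (rule group_free_group)
  interpret L: group_hom "free_group {1..k}" B ?L
    using free_lift_hom[OF B.is_group pk] by unfold_locales
  have "BR.U k \<subseteq> ?L ` carrier (free_group {1..k})"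
    unfolding BR.U_def
  proof (rule B.generate_subgroup_incl)
    show "subgroup (?L ` carrier (free_group {1..k})) B" by (rule L.img_is_subgroup)
    show "BR.push k ` {1..k} \<subseteq> ?L ` carrier (free_group {1..k})"
    proof
      fix x assume "x \<in> BR.push k ` {1..k}"
      then obtain i where i: "i \<in> {1..k}" "x = BR.push k i" by blast
      then have "?L (free_gen i) = x" using pk by (subst free_lift_gen[OF B.is_group]) auto
      then show "x \<in> ?L ` carrier (free_group {1..k})"
        using free_gen_closed[OF i(1)] by blast
    qed
  qed
  then obtain w where w: "set w \<subseteq> {1..k} \<times> {1, -1}" "reduced w" "u = ?L w"
    using ucj(1) by (auto simp: free_group_def)
  obtain \<omega> where \<omega>: "\<omega> \<in> carrier F" "?\<rho> \<omega> = rev w"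
    "artin n u (v (Suc k)) = \<omega> \<cdot> v (Suc k) \<cdot> finv \<omega>"
    using push_word_action[OF k w(1,2)] w(3) by auto
  have kn: "Suc k \<in> {1..n}" using k by simp
  note vk = gen_closed[OF kn]
  have "v (Suc k) = \<omega> \<cdot> v (Suc k) \<cdot> finv \<omega>"
    using \<omega>(3) Suc.prems(3)[OF vk] gu by simp
  then have "\<omega> \<cdot> v (Suc k) = v (Suc k) \<cdot> \<omega>"
    using F.inv_solve_right[of "v (Suc k)" "\<omega> \<cdot> v (Suc k)" \<omega>] vk \<omega>(1) by simp
  then have "?\<rho> \<omega> = []"
    using gen_centralizer[OF kn S.homh _ \<omega>(1)] shift_gen[of "Suc k" "Suc k"] kn by (simp add: F_one)
  then have "w = []" using \<omega>(2) by simp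
  then show ?case using w(3) gu by (simp add: free_lift_def)
qed

theorem artin_faithful:
  assumes "g \<in> carrier B" "\<And>w. w \<in> carrier F \<Longrightarrow> artin n g w = w"
  shows "g = \<one>\<^bsub>B\<^esub>"
  using artin_faithful_H[of n g] assms carrier_B by (simp add: BR.H_def)

section \<open>The procedure\<close>

text \<open>For i = j the subword would cancel, but the entries are reduced words.\<close>

lemma admissible_distinct:
  assumes "t \<in> tuples n F" "admissible n u t i j \<eta>"
  shows "i \<noteq> j"
proof
  assume "i = j"
  with assms(2) obtain k p q where "k \<in> {1..n}" "t k = p @ (i, \<eta>) # (i, - \<eta>) # q"
    by (auto simp: admissible_def sublist_def)
  moreover from this have "reduced (t k)" using PiE_mem[OF assms(1)] F_carrier by blast
  ultimately show False by (auto simp: reduced_append reduced_Cons)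
qed

text \<open>With P the product of l, the braid whose Hurwitz image of the trivial tuple is t is b
  P^-1. \<open>act\<close> stands for the Hurwitz action on the group in which u lives.\<close>

definition invariant ::
  "(nat word set \<Rightarrow> (nat \<Rightarrow> nat word) \<Rightarrow> nat \<Rightarrow> nat word) \<Rightarrow> (nat \<Rightarrow> nat word) \<Rightarrow> nat word set \<Rightarrow> state \<Rightarrow> bool" where
  "invariant act u b = (\<lambda>(t, l). bkl_prod n l \<in> carrier B \<and> act (b \<star> binv (bkl_prod n l)) u = u \<and>
     t = bullet n (bkl_prod n l \<star> binv b) (t_triv n) \<and>
     (\<forall>(i, j, \<gamma>)\<in>set l. \<gamma> \<in> {1, -1} \<and> u i = u j))"

lemma invariant_tuple:
  assumes "b \<in> carrier B" "invariant act u b (t, l)"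
  shows "t \<in> tuples n F"
  using assms bullet_closed[OF _ t_triv_closed] by (auto simp: invariant_def)

lemma invariant_start:
  assumes "group G" "u \<in> tuples n G" "b \<in> carrier B" "hurwitz n G b u = u"
  shows "invariant (hurwitz n G) u b (start n b)"
  using assms hurwitz_t_triv[of "binv b"] by (simp add: invariant_def start_def bkl_prod_def)

text \<open>Prepending a = \<open>a_ij^-eta\<close> to l multiplies b P^-1 on the right by a^-1,
  which fixes u because u_i = u_j.\<close>

lemma invariant_step:
  assumes G: "group G" "u \<in> tuples n G" and b: "b \<in> carrier B"
    and inv: "invariant (hurwitz n G) u b (t, l)" and a: "admissible n u t i j \<eta>"
  shows "invariant (hurwitz n G) u b (bullet n (bkl n i j [^]\<^bsub>B\<^esub> (- \<eta>)) t, (i, j, - \<eta>) # l)"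
proof -
  have ij: "i \<in> {1..n}" "j \<in> {1..n}" "\<eta> = 1 \<or> \<eta> = -1" "u i = u j" "i \<noteq> j"
    using a admissible_distinct[OF invariant_tuple[OF b inv] a] by (auto simp: admissible_def)
  let ?P = "bkl_prod n l" and ?a = "bkl n i j [^]\<^bsub>B\<^esub> (- \<eta>)" and ?a' = "bkl n i j [^]\<^bsub>B\<^esub> \<eta>"
  have P: "?P \<in> carrier B" and fix_u: "hurwitz n G (b \<star> binv ?P) u = u"
    and t: "t = bullet n (?P \<star> binv b) (t_triv n)"
    and l: "\<forall>(i, j, \<gamma>)\<in>set l. \<gamma> \<in> {1, -1} \<and> u i = u j"
    using inv by (auto simp: invariant_def)
  have a: "bkl n i j \<in> carrier B" "?a \<in> carrier B" "?a' \<in> carrier B" using bkl_closed ij by auto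
  have P': "bkl_prod n ((i, j, - \<eta>) # l) = ?a \<star> ?P" by (simp add: bkl_prod_def)
  have "hurwitz n G (bkl n i j) u = u" by (rule hurwitz_bkl) (use G ij in auto)
  moreover from this have "hurwitz n G (binv (bkl n i j)) u = u"
    using hurwitz_inv(1)[OF G(1) a(1) G(2)] by simp
  ultimately have fix_a: "hurwitz n G ?a' u = u" using ij(3) a(1) by (auto simp: B.int_pow_neg)
  have "binv ?a = ?a'" using a by (simp add: B.int_pow_neg)
  then have "b \<star> binv (?a \<star> ?P) = b \<star> binv ?P \<star> ?a'"
    using a P b by (simp add: B.inv_mult_group B.m_assoc)
  then have "hurwitz n G (b \<star> binv (?a \<star> ?P)) u = u"
    using G a P b fix_u fix_a hurwitz_mult[OF G(1), of "b \<star> binv ?P" ?a' u] by simp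
  moreover have "bullet n ?a t = bullet n (?a \<star> ?P \<star> binv b) (t_triv n)"
    unfolding t using a P b t_triv_closed by (simp add: bullet_mult[symmetric] B.m_assoc)
  ultimately show ?thesis
    using a P l ij by (auto simp: invariant_def P')
qed

lemma invariant_reachable:
  assumes "group G" "u \<in> tuples n G" "b \<in> carrier B" "hurwitz n G b u = u"
    and "(step n u)\<^sup>*\<^sup>* (start n b) s"
  shows "invariant (hurwitz n G) u b s"
  using assms(5)
proof (induction rule: rtranclp_induct)
  case base
  then show ?case by (rule invariant_start[OF assms(1-4)])
next
  case (step s s')
  then show ?case using invariant_step[OF assms(1-3)] by (auto elim!: step.cases)
qed

lemma step_decreases:
  assumes "b \<in> carrier B" "invariant act u b s" "step n u s s'"
  shows "(\<Sum>k\<in>{1..n}. length (fst s' k)) < (\<Sum>k\<in>{1..n}. length (fst s k))"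
  using assms(3)
proof cases
  case (1 t i j \<eta> l)
  have inv: "invariant act u b (t, l)" using assms(2) 1 by simp
  then have t: "bkl_prod n l \<star> binv b \<in> carrier B" "t = bullet n (bkl_prod n l \<star> binv b) (t_triv n)"
    using assms(1) by (auto simp: invariant_def)
  from bkl_decreases[OF t 1(4) admissible_distinct[OF invariant_tuple[OF assms(1) inv] 1(4)]]
  show ?thesis unfolding 1(1,2) fst_conv .
qed

text \<open>The trivial tuple lists all generators, so P b^-1 fixes each of them and is 1 by
  faithfulness.\<close>

lemma result:
  assumes b: "b \<in> carrier B" and inv: "invariant act u b (t_triv n, l)"
  shows "b = bkl_prod n l"
proof -
  let ?P = "bkl_prod n l"
  have P: "?P \<in> carrier B" "t_triv n = bullet n (?P \<star> binv b) (t_triv n)"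
    using inv by (auto simp: invariant_def)
  have c: "?P \<star> binv b \<in> carrier B" using P b by simp
  have "artin n (?P \<star> binv b) (v k) = v k" if "k \<in> {1..n}" for k
    using fun_cong[OF P(2), of k] that by (simp add: bullet_def t_triv_def)
  then have "artin n (?P \<star> binv b) w = w" if "w \<in> carrier F" for w
    using F_hom_eqI[OF artin_hom[OF c] _ _ that, of "\<lambda>w. w"] by (auto simp: hom_def)
  then have "?P \<star> binv b = \<one>\<^bsub>B\<^esub>" by (rule artin_faithful[OF c])
  then show ?thesis using P b B.inv_solve_right'[of "\<one>\<^bsub>B\<^esub>" ?P b] by simp
qed

end

theorem mainTheorem3:
  fixes m n :: nat and u :: "nat \<Rightarrow> nat word" and b :: "nat word set"
  assumes "u \<in> {1..n} \<rightarrow>\<^sub>E free_gen ` {1..m}"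
    and "b \<in> stabilizer (braid_group n) (hurwitz n (free_n m)) u"
  shows "(\<forall>t l. (step n u)\<^sup>*\<^sup>* (start n b) (t, l) \<longrightarrow> t \<noteq> t_triv n \<longrightarrow>
            (\<exists>i j \<eta>. admissible n u t i j \<eta>)) \<and>
         (\<forall>t l i j \<eta>. (step n u)\<^sup>*\<^sup>* (start n b) (t, l) \<longrightarrow> admissible n u t i j \<eta> \<longrightarrow> i \<noteq> j) \<and>
         (\<nexists>s. s 0 = start n b \<and> (\<forall>k. step n u (s k) (s (Suc k)))) \<and>
         (\<forall>l. (step n u)\<^sup>*\<^sup>* (start n b) (t_triv n, l) \<longrightarrow>
            (\<forall>(i, j, \<gamma>) \<in> set l. \<gamma> \<in> {1, -1} \<and> u i = u j) \<and> b = bkl_prod n l)"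
proof -
  interpret braids n .
  have b: "b \<in> carrier B" "hurwitz n (free_n m) b u = u"
    using assms(2) by (auto simp: stabilizer_def)
  have "free_gen ` {1..m} \<subseteq> carrier (free_n m)" using free_gen_closed_n by blast
  then have u: "u \<in> tuples n (free_n m)" using assms(1) by (meson PiE_mono subsetD)
  let ?inv = "invariant (hurwitz n (free_n m)) u b"
  note reach = invariant_reachable[OF group_free_n u b]
  have "\<exists>i j \<eta>. admissible n u t i j \<eta>"
    if "(step n u)\<^sup>*\<^sup>* (start n b) (t, l)" "t \<noteq> t_triv n" for t l
  proof -
    let ?P = "bkl_prod n l"
    have P: "?P \<in> carrier B" "hurwitz n (free_n m) (b \<star> binv ?P) u = u"
      "t = bullet n (?P \<star> binv b) (t_triv n)"
      using reach[OF that(1)] by (auto simp: invariant_def)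
    have "t = hurwitz n F (b \<star> binv ?P) (t_triv n)"
      using P(3) hurwitz_t_triv[of "?P \<star> binv b"] P(1) b(1) by (simp add: B.inv_mult_group)
    then show ?thesis
      using exists_admissible[OF assms(1) _ P(2) _ that(2)] P(1) b(1) by blast
  qed
  moreover have "i \<noteq> j"
    if "(step n u)\<^sup>*\<^sup>* (start n b) (t, l)" "admissible n u t i j \<eta>" for t l i j \<eta>
    using admissible_distinct[OF invariant_tuple[OF b(1) reach[OF that(1)]] that(2)] .
  moreover have "\<nexists>s. s 0 = start n b \<and> (\<forall>k. step n u (s k) (s (Suc k)))"
  proof
    assume "\<exists>s. s 0 = start n b \<and> (\<forall>k. step n u (s k) (s (Suc k)))"
    then obtain s where s: "s 0 = start n b" "\<And>k. step n u (s k) (s (Suc k))" by blast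
    have "(step n u)\<^sup>*\<^sup>* (start n b) (s k)" for k
      by (induction k) (use s in \<open>auto intro: rtranclp.rtrancl_into_rtrancl\<close>)
    then have "(\<Sum>i\<in>{1..n}. length (fst (s (Suc k)) i)) < (\<Sum>i\<in>{1..n}. length (fst (s k) i))" for k
      using step_decreases[OF b(1) reach s(2)] by blast
    then have "\<exists>f :: nat \<Rightarrow> nat. \<forall>k. (f (Suc k), f k) \<in> less_than"
      by (intro exI[of _ "\<lambda>k. \<Sum>i\<in>{1..n}. length (fst (s k) i)"]) simp
    then show False using wf_less_than unfolding wf_iff_no_infinite_down_chain by blast
  qed
  moreover have "(\<forall>(i, j, \<gamma>)\<in>set l. \<gamma> \<in> {1, -1} \<and> u i = u j) \<and> b = bkl_prod n l"
    if "(step n u)\<^sup>*\<^sup>* (start n b) (t_triv n, l)" for l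
    using reach[OF that] result[OF b(1) reach[OF that]] by (simp add: invariant_def)
  ultimately show ?thesis by blast
qed

end
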